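(* Consider instances of the problem RDC (Ranking with Diverse Intents and Correlated Contents), with document set $\mathcal{S}$, topic set $\mathcal{E}$ and sets $C_s\subseteq\mathcal{E}$ ($s\in\mathcal{S}$), and let $\rho\ge 1$. Suppose that for any $F\subseteq\mathcal{E}$ there is a polynomial time algorithm that can produce a solution of the set cover instance $\mathrm{SC}(F)$ whose cost is at most $\rho$ times the optimal value of the linear program $\mathrm{LP}(\mathrm{SC}(F))$. Then there is a polynomial time $O(\rho)$-factor approximation algorithm for RDC.
   Context: RDC: An instance consists of a finite set $\mathcal{U}$ of users, a finite set $\mathcal{S}$ of $n$ documents and a finite set $\mathcal{E}$ of topics. Each document $s$ contains a subset $C_s\subseteq\mathcal{E}$ of topics, and $\mathcal{E}=\bigcup_{s\in\mathcal{S}}C_s$. Each user $u$ is interested in a subset $I_u\subseteq\mathcal{E}$ of topics and has a positive integer $K_u\le|I_u|$. A solution is an ordering of all documents. The satisfying time of $u$ is $t_u=\min\{t : \text{at least }K_u\text{ topics of }I_u\text{ belong to the union of the sets }C_s\text{ over the first }t\text{ documents}\}$. The objective is to minimize the average (equivalently, the total $\sum_{u}t_u$) satisfying time. Set cover: For $F\subseteq\mathcal{E}$, $\mathrm{SC}(F)$ is the set cover instance in which one must choose a subfamily of documents $H\subseteq\mathcal{S}$ of minimum cardinality (the cost is $|H|$) with $F\subseteq\bigcup_{s\in H}C_s$. $\mathrm{LP}(\mathrm{SC}(F))$ is the linear program: minimize $\sum_{s\in\mathcal{S}}x_s$ subject to $\sum_{s\in\mathcal{S}:\,e\in C_s}x_s\ge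 1$ for all $e\in F$ and $x_s\ge 0$ for all $s\in\mathcal{S}$. Conventions: an $\alpha$-factor approximation algorithm is an algorithm (possibly randomized) that outputs a feasible solution whose (expected) objective value is at most $\alpha$ times the optimum. "$O(\rho)$-factor" means factor $c\rho$ for an absolute constant $c$. The set cover algorithm in the hypothesis is available to the RDC algorithm as a subroutine on the given instance. *)

theory Defs
  imports
    "HOL-Probability.Probability"
    "HOL-Computational_Algebra.Polynomial"
    "HOL-Combinatorics.Multiset_Permutations"
begin

section \<open>Instances, orderings and satisfying times\<close>

text \<open>
  Documents, topics and users are numbered from 0, so that instances can be given to a program.
  The values of the last four fields outside these ranges are irrelevant.
\<close>

record rdc =
  num_docs :: nat
  num_topics :: nat
  num_users :: nat
  doc_topics :: "nat \<Rightarrow> nat set"  \<comment> \<open>\<open>C\<^sub>s\<close>\<close>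
  interests :: "nat \<Rightarrow> nat set"  \<comment> \<open>\<open>I\<^sub>u\<close>\<close>
  demand :: "nat \<Rightarrow> nat"  \<comment> \<open>\<open>K\<^sub>u\<close>\<close>

abbreviation docs :: "rdc \<Rightarrow> nat set" where "docs R \<equiv> {..<num_docs R}"
abbreviation topics :: "rdc \<Rightarrow> nat set" where "topics R \<equiv> {..<num_topics R}"
abbreviation users :: "rdc \<Rightarrow> nat set" where "users R \<equiv> {..<num_users R}"

definition rdc_instance :: "rdc \<Rightarrow> bool" where
  "rdc_instance R \<longleftrightarrow>
     (\<Union>s\<in>docs R. doc_topics R s) = topics R \<and>
     (\<forall>u\<in>users R. interests R u \<subseteq> topics R \<and>
        0 < demand R u \<and> demand R u \<le> card (interests R u))"

abbreviation orderings :: "rdc \<Rightarrow> nat list set" where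
  "orderings R \<equiv> permutations_of_set (docs R)"

definition sat_time :: "rdc \<Rightarrow> nat list \<Rightarrow> nat \<Rightarrow> nat" where
  "sat_time R \<sigma> u =
     (LEAST t. demand R u \<le> card (interests R u \<inter> (\<Union>s\<in>set (take t \<sigma>). doc_topics R s)))"

definition total_time :: "rdc \<Rightarrow> nat list \<Rightarrow> nat" where
  "total_time R \<sigma> = (\<Sum>u\<in>users R. sat_time R \<sigma> u)"

definition opt_time :: "rdc \<Rightarrow> nat" where
  "opt_time R = Min (total_time R ` orderings R)"


section \<open>Set cover\<close>

definition set_cover :: "rdc \<Rightarrow> nat set \<Rightarrow> nat set \<Rightarrow> bool" where
  "set_cover R F H \<longleftrightarrow> H \<subseteq> docs R \<and> F \<subseteq> (\<Union>s\<in>H. doc_topics R s)"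

definition lp_feasible :: "rdc \<Rightarrow> nat set \<Rightarrow> (nat \<Rightarrow> real) \<Rightarrow> bool" where
  "lp_feasible R F x \<longleftrightarrow>
     (\<forall>e\<in>F. (\<Sum>s | s \<in> docs R \<and> e \<in> doc_topics R s. x s) \<ge> 1) \<and> (\<forall>s\<in>docs R. x s \<ge> 0)"

definition lp_opt :: "rdc \<Rightarrow> nat set \<Rightarrow> real" where
  "lp_opt R F = (INF x\<in>{x. lp_feasible R F x}. \<Sum>s\<in>docs R. x s)"


section \<open>Randomized programs and their running time\<close>

text \<open>
  The machine model is Jones' WHILE language over binary trees (\<^emph>\<open>Computability and Complexity
  from a Programming Perspective\<close>), extended with a conditional and a fair coin flip. Every step
  of a program costs one unit; an expression has constant size and only moves, joins or
  dereferences pointers. There is no unit-cost arithmetic and no unit-cost comparison of trees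
  (only a test for \<open>Leaf\<close>). With trees represented as shared pointer structures, a run of \<open>T\<close> steps
  can be simulated by a Turing machine in time polynomial in \<open>T\<close> and the size of the input, and
  conversely a Turing machine is simulated with constant overhead per step. The polynomial-time
  programs of this model are therefore the usual ones.
\<close>

datatype tree = Leaf | Node tree tree

datatype expr = Var nat | LeafE | NodeE expr expr | LeftE expr | RightE expr

datatype com =
    Assign nat expr
  | Flip nat
  | Seq com com
  | If expr com com
  | While expr com

type_synonym store = "nat \<Rightarrow> tree"

fun left :: "tree \<Rightarrow> tree" where
  "left Leaf = Leaf"
| "left (Node l r) = l"

fun right :: "tree \<Rightarrow> tree" where
  "right Leaf = Leaf"
| "right (Node l r) = r"

fun eval_expr :: "expr \<Rightarrow> store \<Rightarrow> tree" where
  "eval_expr (Var v) st = st v"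
| "eval_expr LeafE st = Leaf"
| "eval_expr (NodeE a b) st = Node (eval_expr a st) (eval_expr b st)"
| "eval_expr (LeftE a) st = left (eval_expr a st)"
| "eval_expr (RightE a) st = right (eval_expr a st)"

definition enc_bool :: "bool \<Rightarrow> tree" where
  "enc_bool b = (if b then Node Leaf Leaf else Leaf)"

text \<open>A configuration consists of the stack of commands still to be executed and the store.\<close>

type_synonym config = "com list \<times> store"

fun step :: "config \<Rightarrow> config pmf" where
  "step ([], st) = return_pmf ([], st)"
| "step (Assign v a # cs, st) = return_pmf (cs, st(v := eval_expr a st))"
| "step (Flip v # cs, st) =
     map_pmf (\<lambda>b. (cs, st(v := enc_bool b))) (bernoulli_pmf (1 / 2))"
| "step (Seq c d # cs, st) = return_pmf (c # d # cs, st)"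
| "step (If a c d # cs, st) =
     return_pmf ((if eval_expr a st \<noteq> Leaf then c else d) # cs, st)"
| "step (While a c # cs, st) =
     return_pmf (if eval_expr a st \<noteq> Leaf then c # While a c # cs else cs, st)"

primrec steps :: "nat \<Rightarrow> config \<Rightarrow> config pmf" where
  "steps 0 cf = return_pmf cf"
| "steps (Suc T) cf = bind_pmf (steps T cf) step"

text \<open>The input is passed, and the output returned, in variable 0.\<close>

definition start :: "com \<Rightarrow> tree \<Rightarrow> config" where
  "start P x = ([P], (\<lambda>v. Leaf)(0 := x))"

definition halts_within :: "com \<Rightarrow> tree \<Rightarrow> nat \<Rightarrow> bool" where
  "halts_within P x T \<longleftrightarrow> (\<forall>(cs, st)\<in>set_pmf (steps T (start P x)). cs = [])"

text \<open>
  The distribution of the output. It is only meaningful if the number of steps is bounded over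
  all outcomes of the coin flips, which \<open>poly_time\<close> below guarantees.
\<close>

definition out_dist :: "com \<Rightarrow> tree \<Rightarrow> tree pmf" where
  "out_dist P x =
     map_pmf (\<lambda>(cs, st). st 0) (steps (LEAST T. halts_within P x T) (start P x))"

text \<open>The size of a tree is the number of its inner nodes.\<close>

definition poly_time :: "com \<Rightarrow> tree set \<Rightarrow> bool" where
  "poly_time P X \<longleftrightarrow> (\<exists>p :: nat poly. \<forall>x\<in>X. halts_within P x (poly p (size x)))"


section \<open>Encoding of inputs and outputs\<close>

text \<open>
  Sets are encoded as bit vectors, families of sets as incidence matrices. The demands and the
  document numbers in an ordering are encoded in unary; as they are at most the number of topics
  and less than the number of documents, respectively, this changes sizes only polynomially.
\<close>

definition enc_list :: "tree list \<Rightarrow> tree" where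
  "enc_list ts = foldr Node ts Leaf"

definition enc_nat :: "nat \<Rightarrow> tree" where
  "enc_nat k = enc_list (replicate k Leaf)"

text \<open>The subset \<open>A\<close> of \<open>{..<n}\<close>.\<close>

definition enc_set :: "nat \<Rightarrow> nat set \<Rightarrow> tree" where
  "enc_set n A = enc_list (map (\<lambda>i. enc_bool (i \<in> A)) [0..<n])"

definition enc_docs :: "rdc \<Rightarrow> tree" where
  "enc_docs R = enc_list (map (\<lambda>s. enc_set (num_topics R) (doc_topics R s)) [0..<num_docs R])"

definition enc_users :: "rdc \<Rightarrow> tree" where
  "enc_users R = enc_list
     (map (\<lambda>u. Node (enc_set (num_topics R) (interests R u)) (enc_nat (demand R u)))
       [0..<num_users R])"

definition enc_rdc :: "rdc \<Rightarrow> tree" where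
  "enc_rdc R = Node (enc_docs R) (enc_users R)"

text \<open>The set cover instance \<open>SC(F)\<close>; it does not involve the users.\<close>

definition enc_sc :: "rdc \<Rightarrow> nat set \<Rightarrow> tree" where
  "enc_sc R F = Node (enc_docs R) (enc_set (num_topics R) F)"

definition enc_ordering :: "nat list \<Rightarrow> tree" where
  "enc_ordering \<sigma> = enc_list (map enc_nat \<sigma>)"


section \<open>Algorithms with performance guarantees\<close>

text \<open>
  Both notions are relative to a class \<open>\<I>\<close> of instances; the factors may depend on the instance.
  The set cover algorithm has to meet its bound for every outcome of its coin flips (if any).
\<close>

definition sc_lp_algorithm :: "(rdc \<Rightarrow> real) \<Rightarrow> rdc set \<Rightarrow> com \<Rightarrow> bool" where
  "sc_lp_algorithm \<rho> \<I> A \<longleftrightarrow>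
     poly_time A {enc_sc R F | R F. R \<in> \<I> \<and> F \<subseteq> topics R} \<and>
     (\<forall>R\<in>\<I>. \<forall>F\<subseteq>topics R. \<forall>y\<in>set_pmf (out_dist A (enc_sc R F)).
        \<exists>H. y = enc_set (num_docs R) H \<and> set_cover R F H \<and>
            real (card H) \<le> \<rho> R * lp_opt R F)"

definition rdc_approx_algorithm :: "(rdc \<Rightarrow> real) \<Rightarrow> rdc set \<Rightarrow> com \<Rightarrow> bool" where
  "rdc_approx_algorithm \<alpha> \<I> B \<longleftrightarrow>
     poly_time B (enc_rdc ` \<I>) \<and>
     (\<forall>R\<in>\<I>. \<exists>\<mu> :: nat list pmf.
        out_dist B (enc_rdc R) = map_pmf enc_ordering \<mu> \<and>
        set_pmf \<mu> \<subseteq> orderings R \<and>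
        measure_pmf.expectation \<mu> (\<lambda>\<sigma>. real (total_time R \<sigma>)) \<le> \<alpha> R * real (opt_time R))"

end

theory Submission
  imports Defs
begin

text \<open>
  Phases \<open>t = 1, 2, 4, \<dots>\<close> choose \<open>O(\<rho> t)\<close> documents each. If some \<open>t\<close> documents satisfy all but a
  sixteenth of the remaining users, then the phase satisfies seven eighths of them; so the total
  time is \<open>O(\<rho>)\<close> times the optimum.

  A phase needs a fractional choice \<open>x\<close> of weight \<open>O(t)\<close>. Topics with at least constant fractional
  coverage are heavy, and the given algorithm covers all heavy topics by \<open>O(\<rho> t)\<close> documents. The
  demand that remains for a user is met by a greedy choice of \<open>O(t)\<close> documents, whose gains are
  truncated at the residual demands (as in the knapsack cover inequalities): light topics that are
  already covered take away only a small fraction of what \<open>x\<close> promises to a user, hence the greedy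
  algorithm makes progress as long as \<open>x\<close> satisfies the inequalities on average.

  If too many users remain, they yield an inequality that is violated by \<open>x\<close> but satisfied with a
  margin by every solution with \<open>t\<close> documents. Adding its coefficients to \<open>x\<close>, as in the perceptron
  algorithm, decreases the squared distance to that solution. This needs polynomially many steps
  with integers of polynomial size, so unary arithmetic suffices and no linear program has to be
  solved. The algorithm is deterministic; fixing the outcome of all coin flips makes the given
  algorithm deterministic as well.
\<close>

section \<open>Removing the coin flips\<close>

text \<open>Asking fractionally for \<open>demand\<close> many topics of a user is too weak to
  round: a document with many topics of one user earns credit beyond the demand, and topics already
  covered earn it again. Hence the residual demands and the truncation. There are far too many such
  inequalities to list, one for each set of paid topics and each selection of users, so the rounding
  doubles as separation: a greedy choice that stops with more than an eighth of the users left is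
  itself the certificate. The inequality is summed over the users left because a good solution may
  miss some of them. If it misses at most a sixteenth of all, it serves at least half of those left;
  integer division loses another half, so it collects a quarter of the ideal gain. The current
  weights collect at most an eighth, and this gap drives the update. Heavy topics must be bought
  separately, since covering them could use up most of what the weights promise; 16 times the
  weights are LP-feasible for them.\<close>

primrec derand :: "com \<Rightarrow> com" where
  "derand (Assign v e) = Assign v e"
| "derand (Flip v) = Assign v LeafE"
| "derand (Seq c d) = Seq (derand c) (derand d)"
| "derand (If e c d) = If e (derand c) (derand d)"
| "derand (While e c) = While e (derand c)"

text \<open>\<open>Leaf\<close> is \<open>enc_bool False\<close>, so this is the branch of
  \<open>step\<close> on which every coin shows \<open>False\<close>. It serves both as the
  semantics of programs without coins and as one possible run of the given set cover
  program.\<close>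

fun dstep :: "config \<Rightarrow> config" where
  "dstep ([], st) = ([], st)"
| "dstep (Assign v a # cs, st) = (cs, st(v := eval_expr a st))"
| "dstep (Flip v # cs, st) = (cs, st(v := Leaf))"
| "dstep (Seq c d # cs, st) = (c # d # cs, st)"
| "dstep (If a c d # cs, st) = ((if eval_expr a st \<noteq> Leaf then c else d) # cs, st)"
| "dstep (While a c # cs, st) = (if eval_expr a st \<noteq> Leaf then c # While a c # cs else cs, st)"

lemma step_derand:
  "step (map derand cs, st) = return_pmf (map_prod (map derand) id (dstep (cs, st)))"
  by (cases "(cs, st)" rule: dstep.cases) auto

lemma steps_derand:
  "steps T (map derand cs, st) = return_pmf (map_prod (map derand) id ((dstep ^^ T) (cs, st)))"
proof (induction T)
  case (Suc T)
  obtain cs' st' where "(dstep ^^ T) (cs, st) = (cs', st')"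
    by fastforce
  then show ?case
    using Suc by (simp add: bind_return_pmf step_derand id_def)
qed simp

lemma dstep_in_step: "dstep cf \<in> set_pmf (step cf)"
proof (cases cf rule: dstep.cases)
  case (3 v cs st)
  then show ?thesis
    by (auto simp: enc_bool_def set_pmf_bernoulli image_iff split: if_splits intro!: exI[of _ False])
qed auto

lemma funpow_dstep_in_steps: "(dstep ^^ T) cf \<in> set_pmf (steps T cf)"
proof (induction T)
  case (Suc T)
  then show ?case
    using dstep_in_step[of "(dstep ^^ T) cf"] by auto
qed simp

section \<open>Deterministic runs\<close>

text \<open>The arbitrary rest \<open>cs\<close> of the stack lets a run be used inside any larger
  program, and \<open>t \<le> T\<close> allows time bounds to be weakened.\<close>

definition runs :: "com \<Rightarrow> store \<Rightarrow> nat \<Rightarrow> store \<Rightarrow> bool" where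
  "runs c st T st' \<longleftrightarrow> (\<forall>cs. \<exists>t\<le>T. (dstep ^^ t) (c # cs, st) = (cs, st'))"

lemma runs_mono: "runs c st T st' \<Longrightarrow> T \<le> T' \<Longrightarrow> runs c st T' st'"
  unfolding runs_def by (meson le_trans)

lemma runs_Assign: "runs (Assign v e) st 1 (st(v := eval_expr e st))"
  unfolding runs_def by (auto intro!: exI[of _ 1])

lemma funpow_trans: "(f ^^ m) a = b \<Longrightarrow> (f ^^ n) b = c \<Longrightarrow> (f ^^ (m + n)) a = c"
  by (metis add.commute comp_apply funpow_add)

lemma runs_Seq:
  assumes "runs c st T st'" and "runs d st' T' st''"
  shows "runs (Seq c d) st (T + T' + 1) st''"
  unfolding runs_def
proof
  fix cs
  obtain t t' where "t \<le> T" "(dstep ^^ t) (c # d # cs, st) = (d # cs, st')"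
    "t' \<le> T'" "(dstep ^^ t') (d # cs, st') = (cs, st'')"
    using assms unfolding runs_def by meson
  moreover have "(dstep ^^ 1) (Seq c d # cs, st) = (c # d # cs, st)"
    by simp
  ultimately show "\<exists>t\<le>T + T' + 1. (dstep ^^ t) (Seq c d # cs, st) = (cs, st'')"
    by (intro exI[of _ "1 + (t + t')"]) (metis (no_types, lifting) add.commute add_mono funpow_trans le_refl)
qed

lemma runs_If:
  assumes "eval_expr e st \<noteq> Leaf \<Longrightarrow> runs c st T st'" and "eval_expr e st = Leaf \<Longrightarrow> runs d st T st'"
  shows "runs (If e c d) st (T + 1) st'"
  unfolding runs_def
proof
  fix cs
  let ?c = "if eval_expr e st \<noteq> Leaf then c else d"
  obtain t where "t \<le> T" "(dstep ^^ t) (?c # cs, st) = (cs, st')"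
    using assms unfolding runs_def by (cases "eval_expr e st = Leaf") auto
  moreover have "(dstep ^^ 1) (If e c d # cs, st) = (?c # cs, st)"
    by simp
  ultimately show "\<exists>t\<le>T + 1. (dstep ^^ t) (If e c d # cs, st) = (cs, st')"
    by (intro exI[of _ "1 + t"]) (metis add.commute add_le_mono1 funpow_trans)
qed

lemma runs_While_Leaf: "eval_expr e st = Leaf \<Longrightarrow> runs (While e c) st 1 st"
  unfolding runs_def by (auto intro!: exI[of _ 1])

lemma runs_While_Node:
  assumes "eval_expr e st \<noteq> Leaf" and "runs c st T st'" and "runs (While e c) st' T' st''"
  shows "runs (While e c) st (T + T' + 1) st''"
  unfolding runs_def
proof
  fix cs
  obtain t t' where "t \<le> T" "(dstep ^^ t) (c # While e c # cs, st) = (While e c # cs, st')"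
    "t' \<le> T'" "(dstep ^^ t') (While e c # cs, st') = (cs, st'')"
    using assms unfolding runs_def by meson
  moreover have "(dstep ^^ 1) (While e c # cs, st) = (c # While e c # cs, st)"
    using assms(1) by simp
  ultimately show "\<exists>t\<le>T + T' + 1. (dstep ^^ t) (While e c # cs, st) = (cs, st'')"
    by (intro exI[of _ "1 + (t + t')"]) (metis (no_types, lifting) add.commute add_mono funpow_trans le_refl)
qed

text \<open>The empty stack idles, whereas commands \<open>ds\<close> below would be executed; so
  the run has to be cut at the moment when \<open>cs\<close> is used up, which gives the smaller
  \<open>t'\<close>.\<close>

lemma dstep_append:
  assumes "(dstep ^^ t) (cs, st) = ([], st')"
  shows "\<exists>t'\<le>t. (dstep ^^ t') (cs @ ds, st) = (ds, st')"
  using assms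
proof (induction t arbitrary: cs st)
  case 0
  then show ?case by simp
next
  case (Suc t)
  show ?case
  proof (cases "cs = []")
    case True
    have "(dstep ^^ n) ([], st) = ([], st)" for n
      by (induction n) auto
    then show ?thesis
      using Suc.prems True by (auto intro!: exI[of _ 0] simp del: funpow.simps)
  next
    case False
    obtain cs1 st1 where s: "dstep (cs, st) = (cs1, st1)"
      by fastforce
    have "dstep (cs @ ds, st) = (cs1 @ ds, st1)"
      using False s by (cases "(cs, st)" rule: dstep.cases) (auto split: if_splits)
    moreover obtain t' where "t' \<le> t" "(dstep ^^ t') (cs1 @ ds, st1) = (ds, st')"
      using Suc s by (metis comp_apply funpow_Suc_right)
    ultimately show ?thesis
      by (intro exI[of _ "Suc t'"]) (simp add: funpow_Suc_right del: funpow.simps)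
  qed
qed

text \<open>A halted configuration idles, which turns "within \<open>T\<close> steps" into "after
  exactly \<open>T\<close> steps" and makes the final store unique.\<close>

lemma runs_iff_halts: "runs c st T st' \<longleftrightarrow> (dstep ^^ T) ([c], st) = ([], st')"
proof
  assume "runs c st T st'"
  then obtain t where "t \<le> T" "(dstep ^^ t) ([c], st) = ([], st')"
    unfolding runs_def by blast
  moreover have "(dstep ^^ n) ([], st') = ([], st')" for n
    by (induction n) auto
  ultimately show "(dstep ^^ T) ([c], st) = ([], st')"
    by (metis funpow_trans le_add_diff_inverse)
next
  assume "(dstep ^^ T) ([c], st) = ([], st')"
  then show "runs c st T st'"
    unfolding runs_def using dstep_append[of T "[c]" st st'] by auto
qed

text \<open>\<open>halts_within\<close> speaks of all outcomes of the coins, hence of the outcome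
  with all coins \<open>False\<close>. The output of that run lies in the support of
  \<open>out_dist\<close>, where the guarantee of the algorithm applies.\<close>

lemma runs_of_halts_within:
  assumes "halts_within A x T"
  shows "\<exists>st. runs A ((\<lambda>v. Leaf)(0 := x)) T st \<and> st 0 \<in> set_pmf (out_dist A x)"
proof -
  define T0 where "T0 = (LEAST T. halts_within A x T)"
  have h: "halts_within A x T0" and le: "T0 \<le> T"
    unfolding T0_def using assms by (rule LeastI, rule Least_le)
  obtain cs st where r: "(dstep ^^ T0) (start A x) = (cs, st)"
    by fastforce
  then have in_steps: "(cs, st) \<in> set_pmf (steps T0 (start A x))"
    using funpow_dstep_in_steps by metis
  then have "cs = []"
    using h unfolding halts_within_def by blast
  then have "runs A ((\<lambda>v. Leaf)(0 := x)) T st"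
    using r le by (intro runs_mono[OF _ le]) (simp add: runs_iff_halts start_def)
  moreover have "st 0 \<in> set_pmf (out_dist A x)"
    unfolding out_dist_def T0_def[symmetric] using in_steps by force
  ultimately show ?thesis by blast
qed

lemma halts_within_derand:
  assumes "runs P ((\<lambda>v. Leaf)(0 := x)) T st"
  shows "halts_within (derand P) x T" and "out_dist (derand P) x = return_pmf (st 0)"
proof -
  have eq: "steps T (start (derand P) x) =
      return_pmf (map_prod (map derand) id ((dstep ^^ T) ([P], (\<lambda>v. Leaf)(0 := x))))" for T
    using steps_derand[of T "[P]"] by (simp add: start_def)
  have halts: "halts_within (derand P) x T \<longleftrightarrow> (\<exists>st. runs P ((\<lambda>v. Leaf)(0 := x)) T st)" for T
    unfolding halts_within_def eq runs_iff_halts by (auto simp: prod_eq_iff map_prod_def split: prod.splits)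
  show *: "halts_within (derand P) x T"
    using assms halts by blast
  define T0 where "T0 = (LEAST T. halts_within (derand P) x T)"
  have h: "halts_within (derand P) x T0" and le: "T0 \<le> T"
    unfolding T0_def using * by (rule LeastI, rule Least_le)
  then obtain st0 where "runs P ((\<lambda>v. Leaf)(0 := x)) T0 st0"
    using halts by blast
  moreover from this have "st0 = st"
    using runs_mono[OF _ le] assms by (metis Pair_inject runs_iff_halts)
  ultimately show "out_dist (derand P) x = return_pmf (st 0)"
    unfolding out_dist_def T0_def[symmetric] eq runs_iff_halts by simp
qed

section \<open>The variables of a program\<close>

primrec expr_below :: "nat \<Rightarrow> expr \<Rightarrow> bool" where
  "expr_below k (Var v) \<longleftrightarrow> v < k"
| "expr_below k LeafE \<longleftrightarrow> True"
| "expr_below k (NodeE a b) \<longleftrightarrow> expr_below k a \<and> expr_below k b"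
| "expr_below k (LeftE a) \<longleftrightarrow> expr_below k a"
| "expr_below k (RightE a) \<longleftrightarrow> expr_below k a"

primrec com_below :: "nat \<Rightarrow> com \<Rightarrow> bool" where
  "com_below k (Assign v e) \<longleftrightarrow> v < k \<and> expr_below k e"
| "com_below k (Flip v) \<longleftrightarrow> v < k"
| "com_below k (Seq c d) \<longleftrightarrow> com_below k c \<and> com_below k d"
| "com_below k (If e c d) \<longleftrightarrow> expr_below k e \<and> com_below k c \<and> com_below k d"
| "com_below k (While e c) \<longleftrightarrow> expr_below k e \<and> com_below k c"

lemma expr_below_mono: "expr_below k e \<Longrightarrow> k \<le> l \<Longrightarrow> expr_below l e"
  by (induction e) auto

lemma com_below_mono: "com_below k c \<Longrightarrow> k \<le> l \<Longrightarrow> com_below l c"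
  by (induction c) (auto intro: expr_below_mono)

lemma expr_below_ex: "\<exists>k. expr_below k e"
proof (induction e)
  case (NodeE a b)
  then show ?case
    by (metis expr_below.simps(3) expr_below_mono le_cases)
qed auto

lemma com_below_ex: "\<exists>k. com_below k c"
proof (induction c)
  case (Assign v e)
  obtain k where "expr_below k e" using expr_below_ex by blast
  then show ?case
    by (intro exI[of _ "Suc (max v k)"]) (auto intro: expr_below_mono)
next
  case (Seq c d)
  then obtain k l where "com_below k c" "com_below l d" by blast
  then show ?case
    by (intro exI[of _ "max k l"]) (auto intro: com_below_mono)
next
  case (If e c d)
  then obtain j k l where "expr_below j e" "com_below k c" "com_below l d"
    using expr_below_ex by blast
  then show ?case
    by (intro exI[of _ "max j (max k l)"]) (auto intro: com_below_mono expr_below_mono)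
next
  case (While e c)
  then obtain j k where "expr_below j e" "com_below k c"
    using expr_below_ex by blast
  then show ?case
    by (intro exI[of _ "max j k"]) (auto intro: com_below_mono expr_below_mono)
qed auto

lemma eval_expr_cong:
  "expr_below k e \<Longrightarrow> (\<And>v. v < k \<Longrightarrow> st v = st' v) \<Longrightarrow> eval_expr e st = eval_expr e st'"
  by (induction e) auto

lemma dstep_local:
  assumes "\<forall>c\<in>set cs. com_below k c" and "\<And>v. v < k \<Longrightarrow> st v = st' v"
    and "dstep (cs, st) = (ds, st1)"
  shows "\<exists>st1'. dstep (cs, st') = (ds, st1') \<and> (\<forall>v<k. st1' v = st1 v) \<and>
    (\<forall>v\<ge>k. st1' v = st' v) \<and> (\<forall>c\<in>set ds. com_below k c)"
  using assms
  by (cases "(cs, st)" rule: dstep.cases) (auto split: if_splits dest: eval_expr_cong[where st = st and st' = st'])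

lemma funpow_dstep_local:
  assumes "\<forall>c\<in>set cs. com_below k c" and "\<And>v. v < k \<Longrightarrow> st v = st' v"
    and "(dstep ^^ t) (cs, st) = (ds, st1)"
  shows "\<exists>st1'. (dstep ^^ t) (cs, st') = (ds, st1') \<and> (\<forall>v<k. st1' v = st1 v) \<and>
    (\<forall>v\<ge>k. st1' v = st' v)"
  using assms
proof (induction t arbitrary: cs st st')
  case (Suc t)
  obtain ds0 st0 where s: "dstep (cs, st) = (ds0, st0)"
    by fastforce
  from dstep_local[OF Suc.prems(1,2) s] obtain st0' where s0:
    "dstep (cs, st') = (ds0, st0')" "\<forall>v<k. st0' v = st0 v" "\<forall>v\<ge>k. st0' v = st' v"
    "\<forall>c\<in>set ds0. com_below k c" by auto
  have "(dstep ^^ t) (ds0, st0) = (ds, st1)"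
    using Suc.prems(3) s by (simp add: funpow_Suc_right del: funpow.simps)
  from Suc.IH[OF s0(4) _ this, of st0'] s0 show ?case
    by (auto simp: funpow_Suc_right simp del: funpow.simps)
qed auto

text \<open>Makes a given program usable as a subroutine: its behaviour carries over to a caller's
  store that agrees on the variables below \<open>k\<close>, and the caller's variables from
  \<open>k\<close> on survive.\<close>

lemma runs_local:
  assumes "com_below k c" and "\<And>v. v < k \<Longrightarrow> st v = st' v" and "runs c st T st1"
  shows "\<exists>st1'. runs c st' T st1' \<and> (\<forall>v<k. st1' v = st1 v) \<and> (\<forall>v\<ge>k. st1' v = st' v)"
  using funpow_dstep_local[of "[c]" k st st' T "[]" st1] assms unfolding runs_iff_halts by auto

text \<open>Restores the initial store that \<open>start\<close> prescribes, keeping the input in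
  variable 0. The base case is a no-op.\<close>

primrec clear :: "nat \<Rightarrow> com" where
  "clear 0 = Assign 0 (Var 0)"
| "clear (Suc n) = Seq (clear n) (Assign (Suc n) LeafE)"

lemma runs_clear: "runs (clear n) st (2 * n + 1) (\<lambda>v. if 0 < v \<and> v \<le> n then Leaf else st v)"
proof (induction n)
  case 0
  have "(\<lambda>v. if 0 < v \<and> v \<le> 0 then Leaf else st v) = st"
    by auto
  then show ?case using runs_Assign[of 0 "Var 0" st] by simp
next
  case (Suc n)
  have "(\<lambda>v. if 0 < v \<and> v \<le> n then Leaf else st v)(Suc n := Leaf) =
      (\<lambda>v. if 0 < v \<and> v \<le> Suc n then Leaf else st v)"
    by (auto simp: fun_eq_iff)
  then show ?case
    using runs_Seq[OF Suc runs_Assign[of "Suc n" LeafE]] by simp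
qed

section \<open>Polynomial-time functions on encodable types\<close>

text \<open>The instances reproduce \<open>enc_bool\<close>, \<open>enc_nat\<close> and
  \<open>enc_list\<close>, so functions on lists and numbers act directly on the prescribed
  encodings.\<close>

class encodable = fixes tree_of :: "'a \<Rightarrow> tree"

instantiation tree :: encodable
begin
definition tree_of_tree :: "tree \<Rightarrow> tree" where [simp]: "tree_of_tree t = t"
instance ..
end

instantiation unit :: encodable
begin
definition tree_of_unit :: "unit \<Rightarrow> tree" where [simp]: "tree_of_unit u = Leaf"
instance ..
end

instantiation bool :: encodable
begin
definition tree_of_bool :: "bool \<Rightarrow> tree" where "tree_of_bool = enc_bool"
instance ..
end

instantiation nat :: encodable
begin
definition tree_of_nat :: "nat \<Rightarrow> tree" where "tree_of_nat = enc_nat"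
instance ..
end

instantiation list :: (encodable) encodable
begin
definition tree_of_list :: "'a list \<Rightarrow> tree" where "tree_of_list xs = enc_list (map tree_of xs)"
instance ..
end

instantiation prod :: (encodable, encodable) encodable
begin
definition tree_of_prod :: "'a \<times> 'b \<Rightarrow> tree" where
  "tree_of_prod p = Node (tree_of (fst p)) (tree_of (snd p))"
instance ..
end

lemma tree_of_Pair [simp]: "tree_of (a, b) = Node (tree_of a) (tree_of b)"
  by (simp add: tree_of_prod_def)

lemma tree_of_Nil [simp]: "tree_of [] = Leaf"
  and tree_of_Cons [simp]: "tree_of (x # xs) = Node (tree_of x) (tree_of xs)"
  by (simp_all add: tree_of_list_def enc_list_def)

lemma tree_of_0 [simp]: "tree_of (0 :: nat) = Leaf"
  and tree_of_Suc [simp]: "tree_of (Suc n) = Node Leaf (tree_of n)"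
  by (simp_all add: tree_of_nat_def enc_nat_def enc_list_def)

lemma tree_of_bool_simps [simp]: "tree_of True = Node Leaf Leaf" "tree_of False = Leaf"
  by (simp_all add: tree_of_bool_def enc_bool_def)

lemma tree_of_list_eq_Leaf_iff [simp]: "tree_of xs = Leaf \<longleftrightarrow> xs = []" for xs :: "'a::encodable list"
  by (cases xs) simp_all

lemma inj_tree_of_bool_list: "inj (tree_of :: bool list \<Rightarrow> tree)"
proof (rule injI)
  fix xs ys :: "bool list"
  have bool: "tree_of a = tree_of b \<longleftrightarrow> a = b" for a b :: bool
    by (cases a; cases b) simp_all
  show "tree_of xs = tree_of ys \<Longrightarrow> xs = ys"
  proof (induction xs arbitrary: ys)
    case Nil
    then show ?case by (metis tree_of_Nil tree_of_list_eq_Leaf_iff)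
  next
    case (Cons x xs)
    then show ?case by (cases ys) (auto simp: bool)
  qed
qed

abbreviation tsize :: "'a::encodable \<Rightarrow> nat" where "tsize x \<equiv> size (tree_of x)"

lemma tsize_nat [simp]: "tsize (n :: nat) = n"
  by (induction n) auto

lemma tsize_bool_le: "tsize (b :: bool) \<le> 1"
  by (cases b) auto

lemma tsize_list: "tsize xs = (\<Sum>x\<leftarrow>xs. tsize x + 1)"
  by (induction xs) auto

lemma tsize_append [simp]: "tsize (xs @ ys) = tsize xs + tsize ys"
  by (simp add: tsize_list)

lemma length_le_tsize: "length xs \<le> tsize xs"
  by (induction xs) auto

lemma tsize_elem: "x \<in> set xs \<Longrightarrow> tsize x < tsize xs"
  by (induction xs) auto

section \<open>Bounds that are polynomial in the size of the encoded argument\<close>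

definition poly_bounded :: "'a::encodable set \<Rightarrow> ('a \<Rightarrow> nat) \<Rightarrow> bool" where
  "poly_bounded D h \<longleftrightarrow> (\<exists>p :: nat poly. \<forall>x\<in>D. h x \<le> poly p (tsize x))"

text \<open>Natural coefficients exclude decreasing terms; this monotonicity is what allows bounds
  to be composed.\<close>

lemma poly_nat_mono: "a \<le> b \<Longrightarrow> poly p a \<le> poly p b" for p :: "nat poly"
  by (induction p) (auto intro!: add_mono mult_mono)

lemma poly_bounded_mono: "poly_bounded D h \<Longrightarrow> (\<And>x. x \<in> D \<Longrightarrow> g x \<le> h x) \<Longrightarrow> poly_bounded D g"
  unfolding poly_bounded_def by (meson le_trans)

lemma poly_bounded_subset: "poly_bounded E h \<Longrightarrow> D \<subseteq> E \<Longrightarrow> poly_bounded D h"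
  unfolding poly_bounded_def by blast

lemma poly_bounded_const: "poly_bounded D (\<lambda>x. c)"
  unfolding poly_bounded_def by (intro exI[of _ "[:c:]"]) simp

lemma poly_bounded_tsize: "poly_bounded D (\<lambda>x. tsize x)"
  unfolding poly_bounded_def by (intro exI[of _ "[:0, 1:]"]) simp

lemma poly_bounded_add: "poly_bounded D g \<Longrightarrow> poly_bounded D h \<Longrightarrow> poly_bounded D (\<lambda>x. g x + h x)"
proof -
  assume "poly_bounded D g" "poly_bounded D h"
  then obtain p q where "\<forall>x\<in>D. g x \<le> poly p (tsize x)" "\<forall>x\<in>D. h x \<le> poly q (tsize x)"
    unfolding poly_bounded_def by blast
  then show ?thesis
    unfolding poly_bounded_def by (intro exI[of _ "p + q"]) (auto intro: add_mono)
qed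

lemma poly_bounded_mult: "poly_bounded D g \<Longrightarrow> poly_bounded D h \<Longrightarrow> poly_bounded D (\<lambda>x. g x * h x)"
proof -
  assume "poly_bounded D g" "poly_bounded D h"
  then obtain p q where "\<forall>x\<in>D. g x \<le> poly p (tsize x)" "\<forall>x\<in>D. h x \<le> poly q (tsize x)"
    unfolding poly_bounded_def by blast
  then show ?thesis
    unfolding poly_bounded_def by (intro exI[of _ "p * q"]) (auto intro: mult_mono)
qed

lemma poly_bounded_comp:
  assumes "poly_bounded E h" and "poly_bounded D (\<lambda>x. tsize (g x))" and "\<And>x. x \<in> D \<Longrightarrow> g x \<in> E"
  shows "poly_bounded D (\<lambda>x. h (g x))"
proof -
  obtain p q where p: "\<forall>x\<in>E. h x \<le> poly p (tsize x)" and q: "\<forall>x\<in>D. tsize (g x) \<le> poly q (tsize x)"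
    using assms(1,2) unfolding poly_bounded_def by blast
  have "h (g x) \<le> poly (pcompose p q) (tsize x)" if "x \<in> D" for x
    using p q assms(3) that poly_nat_mono[of "tsize (g x)" "poly q (tsize x)" p]
    by (auto simp: poly_pcompose intro: le_trans)
  then show ?thesis
    unfolding poly_bounded_def by blast
qed

text \<open>
  The values of the other variables are arbitrary when the program starts, and it uses only
  finitely many of them: so programs can be composed without interfering.
\<close>

definition computes :: "com \<Rightarrow> nat \<Rightarrow> 'a::encodable set \<Rightarrow> ('a \<Rightarrow> nat) \<Rightarrow> ('a \<Rightarrow> 'b::encodable) \<Rightarrow> bool" where
  "computes P k D T f \<longleftrightarrow> (\<forall>x\<in>D. \<forall>st. st 0 = tree_of x \<longrightarrow>
     (\<exists>st'. runs P st (T x) st' \<and> st' 0 = tree_of (f x) \<and> (\<forall>v\<ge>k. st' v = st v)))"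

text \<open>The size of the output is bounded separately because the number of steps does not bound
  it: assigning \<open>NodeE (Var 0) (Var 0)\<close> doubles a tree in one step. The domain
  \<open>D\<close> is explicit because the set cover program is only reliable on encodings of
  instances in the given class.\<close>

definition ptime :: "'a::encodable set \<Rightarrow> ('a \<Rightarrow> 'b::encodable) \<Rightarrow> bool" where
  "ptime D f \<longleftrightarrow> poly_bounded D (\<lambda>x. tsize (f x)) \<and>
     (\<exists>P k T. poly_bounded D T \<and> computes P k D T f)"

named_theorems ptime_intros

lemma ptime_size: "ptime D f \<Longrightarrow> poly_bounded D (\<lambda>x. tsize (f x))"
  by (simp add: ptime_def)

lemma ptime_nat_bounded: "ptime D f \<Longrightarrow> poly_bounded D f" for f :: "'a::encodable \<Rightarrow> nat"
  using ptime_size[of D f] by simp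

lemma computesD:
  assumes "computes P k D T f" and "x \<in> D" and "st 0 = tree_of x"
  obtains st' where "runs P st (T x) st'" "st' 0 = tree_of (f x)" "\<And>v. v \<ge> k \<Longrightarrow> st' v = st v"
  using assms unfolding computes_def by blast

lemma computes_mono: "computes P k D T f \<Longrightarrow> k \<le> l \<Longrightarrow> computes P l D T f"
  unfolding computes_def by (meson le_trans)

lemma ptime_subset: "ptime E f \<Longrightarrow> D \<subseteq> E \<Longrightarrow> ptime D f"
proof -
  assume "ptime E f" and sub: "D \<subseteq> E"
  then obtain P k T where
    "poly_bounded E (\<lambda>x. tsize (f x))" "poly_bounded E T" "computes P k E T f"
    unfolding ptime_def by blast
  moreover from this have "computes P k D T f"
    using sub unfolding computes_def by blast
  ultimately show ?thesis
    unfolding ptime_def using poly_bounded_subset[OF _ sub] by blast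
qed

text \<open>A program sees only trees, so a change of type that preserves the encoding is free. Thus
  \<open>fst\<close> comes from \<open>left\<close>, the predecessor from \<open>right\<close>, and
  \<open>Cons\<close> and \<open>Suc\<close> from pairing.\<close>

lemma ptime_cong_tree:
  assumes "ptime D f" and "\<And>x. x \<in> D \<Longrightarrow> tree_of (g x) = tree_of (f x)"
  shows "ptime D g"
proof -
  from assms(1) obtain P k T where
    *: "poly_bounded D (\<lambda>x. tsize (f x))" "poly_bounded D T" "computes P k D T f"
    unfolding ptime_def by blast
  have "computes P k D T g"
    using *(3) assms(2) unfolding computes_def by simp
  moreover have "poly_bounded D (\<lambda>x. tsize (g x))"
    using *(1) by (rule poly_bounded_mono) (simp add: assms(2))
  ultimately show ?thesis
    using *(2) unfolding ptime_def by blast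
qed

section \<open>Closure properties of polynomial-time functions\<close>

lemma ptime_id [ptime_intros]: "ptime D (\<lambda>x. x)"
proof -
  have "computes (Assign 0 (Var 0)) 0 D (\<lambda>x. 1) (\<lambda>x. x)"
    unfolding computes_def using runs_Assign[of 0 "Var 0"] by fastforce
  then show ?thesis
    unfolding ptime_def using poly_bounded_const poly_bounded_tsize by blast
qed

lemma ptime_comp:
  assumes g: "ptime E g" and f: "ptime D f" and "\<And>x. x \<in> D \<Longrightarrow> f x \<in> E"
  shows "ptime D (\<lambda>x. g (f x))"
proof -
  from f obtain P k T where P: "poly_bounded D (\<lambda>x. tsize (f x))" "poly_bounded D T" "computes P k D T f"
    unfolding ptime_def by blast
  from g obtain Q l U where Q: "poly_bounded E (\<lambda>x. tsize (g x))" "poly_bounded E U" "computes Q l E U g"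
    unfolding ptime_def by blast
  have "computes (Seq P Q) (max k l) D (\<lambda>x. T x + U (f x) + 1) (\<lambda>x. g (f x))"
    unfolding computes_def
  proof (intro ballI allI impI)
    fix x and st :: store assume x: "x \<in> D" "st 0 = tree_of x"
    obtain st1 where 1: "runs P st (T x) st1" "st1 0 = tree_of (f x)" "\<And>v. v \<ge> k \<Longrightarrow> st1 v = st v"
      using computesD[OF P(3) x(1), of st] x(2) by blast
    obtain st2 where 2: "runs Q st1 (U (f x)) st2" "st2 0 = tree_of (g (f x))" "\<And>v. v \<ge> l \<Longrightarrow> st2 v = st1 v"
      using computesD[OF Q(3) assms(3)[OF x(1)], of st1] 1(2) by blast
    show "\<exists>st'. runs (Seq P Q) st (T x + U (f x) + 1) st' \<and> st' 0 = tree_of (g (f x)) \<and>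
      (\<forall>v\<ge>max k l. st' v = st v)"
      using runs_Seq[OF 1(1) 2(1)] 1 2 by auto
  qed
  moreover have "poly_bounded D (\<lambda>x. U (f x))" "poly_bounded D (\<lambda>x. tsize (g (f x)))"
    using poly_bounded_comp[OF _ P(1) assms(3)] Q by blast+
  ultimately show ?thesis
    unfolding ptime_def using P(2) poly_bounded_add poly_bounded_const by blast
qed

lemma ptime_comp_UNIV: "ptime UNIV g \<Longrightarrow> ptime D f \<Longrightarrow> ptime D (\<lambda>x. g (f x))"
  by (rule ptime_comp) auto

lemma ptime_left_right:
  "ptime UNIV left" "ptime UNIV right"
proof -
  have "size (left t) \<le> size t" "size (right t) \<le> size t" for t
    by (cases t; simp)+
  then have b: "poly_bounded UNIV (\<lambda>x. tsize (left x))" "poly_bounded UNIV (\<lambda>x. tsize (right x))"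
    by (auto intro: poly_bounded_mono[OF poly_bounded_tsize])
  have "computes (Assign 0 (LeftE (Var 0))) 1 UNIV (\<lambda>x. 1) left"
    unfolding computes_def using runs_Assign[of 0 "LeftE (Var 0)"] by fastforce
  then show "ptime UNIV left"
    unfolding ptime_def using b poly_bounded_const by blast
  have "computes (Assign 0 (RightE (Var 0))) 1 UNIV (\<lambda>x. 1) right"
    unfolding computes_def using runs_Assign[of 0 "RightE (Var 0)"] by fastforce
  then show "ptime UNIV right"
    unfolding ptime_def using b poly_bounded_const by blast
qed

lemma ptime_tree_of: "ptime D f \<Longrightarrow> ptime D (\<lambda>x. tree_of (f x))"
  by (erule ptime_cong_tree) simp

lemma ptime_fst [ptime_intros]:
  assumes "ptime D f" shows "ptime D (\<lambda>x. fst (f x))"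
  using ptime_comp_UNIV[OF ptime_left_right(1) ptime_tree_of[OF assms]]
  by (rule ptime_cong_tree) (simp add: tree_of_prod_def)

lemma ptime_snd [ptime_intros]:
  assumes "ptime D f" shows "ptime D (\<lambda>x. snd (f x))"
  using ptime_comp_UNIV[OF ptime_left_right(2) ptime_tree_of[OF assms]]
  by (rule ptime_cong_tree) (simp add: tree_of_prod_def)

lemma ptime_pred:
  assumes "ptime D f" shows "ptime D (\<lambda>x. f x - (1::nat))"
  using ptime_comp_UNIV[OF ptime_left_right(2) ptime_tree_of[OF assms]]
proof (rule ptime_cong_tree)
  fix x show "tree_of (f x - 1) = tree_of (right (tree_of (f x)))"
    by (cases "f x") auto
qed

fun expr_of :: "tree \<Rightarrow> expr" where
  "expr_of Leaf = LeafE"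
| "expr_of (Node l r) = NodeE (expr_of l) (expr_of r)"

lemma eval_expr_of [simp]: "eval_expr (expr_of t) st = t"
  by (induction t) auto

lemma ptime_const [ptime_intros]: "ptime D (\<lambda>x. c)"
proof -
  have "computes (Assign 0 (expr_of (tree_of c))) 1 D (\<lambda>x. 1) (\<lambda>x. c)"
    unfolding computes_def using runs_Assign[of 0 "expr_of (tree_of c)"] by fastforce
  then show ?thesis
    unfolding ptime_def using poly_bounded_const by blast
qed

lemma ptime_Pair [ptime_intros]:
  assumes f: "ptime D f" and g: "ptime D g"
  shows "ptime D (\<lambda>x. (f x, g x))"
proof -
  from f obtain P k T where P: "poly_bounded D (\<lambda>x. tsize (f x))" "poly_bounded D T" "computes P k D T f"
    unfolding ptime_def by blast
  from g obtain Q l U where Q: "poly_bounded D (\<lambda>x. tsize (g x))" "poly_bounded D U" "computes Q l D U g"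
    unfolding ptime_def by blast
  \<comment> \<open>Variables \<open>m\<close> and \<open>Suc m\<close> lie above those of both
    programs: they keep the input and the first result safe.\<close>
  define m where "m = Suc (max k l)"
  have m: "k \<le> m" "l \<le> m" "0 < m"
    by (auto simp: m_def)
  let ?C = "Seq (Assign m (Var 0)) (Seq P (Seq (Assign (Suc m) (Var 0)) (Seq (Assign 0 (Var m))
    (Seq Q (Assign 0 (NodeE (Var (Suc m)) (Var 0)))))))"
  have "computes ?C (Suc (Suc m)) D (\<lambda>x. T x + U x + 9) (\<lambda>x. (f x, g x))"
    unfolding computes_def
  proof (intro ballI allI impI)
    fix x and st :: store assume x: "x \<in> D" "st 0 = tree_of x"
    obtain st1 where 1: "runs P (st(m := st 0)) (T x) st1" "st1 0 = tree_of (f x)"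
      "\<And>v. v \<ge> m \<Longrightarrow> st1 v = (st(m := st 0)) v"
      using computesD[OF computes_mono[OF P(3) m(1)] x(1), of "st(m := st 0)"] x(2) m(3) by auto
    define st2 where "st2 = st1(Suc m := st1 0, 0 := st1 m)"
    have "st2 0 = tree_of x"
      using 1(3)[of m] x by (simp add: st2_def)
    then obtain st3 where 3: "runs Q st2 (U x) st3" "st3 0 = tree_of (g x)"
      "\<And>v. v \<ge> m \<Longrightarrow> st3 v = st2 v"
      using computesD[OF computes_mono[OF Q(3) m(2)] x(1), of st2] by auto
    define st4 where "st4 = st3(0 := Node (st3 (Suc m)) (st3 0))"
    have "st4 0 = tree_of (f x, g x)"
      using 3(2) 3(3)[of "Suc m"] 1(2) by (simp add: st4_def st2_def)
    moreover have "\<forall>v\<ge>Suc (Suc m). st4 v = st v"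
      using 3(3) 1(3) by (auto simp: st4_def st2_def)
    moreover have "runs ?C st (1 + (T x + (1 + (1 + (U x + 1 + 1) + 1) + 1) + 1) + 1) st4"
    proof (intro runs_Seq)
      show "runs (Assign m (Var 0)) st 1 (st(m := st 0))"
        using runs_Assign[of m "Var 0" st] by simp
      show "runs (Assign (Suc m) (Var 0)) st1 1 (st1(Suc m := st1 0))"
        using runs_Assign[of "Suc m" "Var 0" st1] by simp
      show "runs (Assign 0 (Var m)) (st1(Suc m := st1 0)) 1 st2"
        using runs_Assign[of 0 "Var m" "st1(Suc m := st1 0)"] by (simp add: st2_def)
      show "runs (Assign 0 (NodeE (Var (Suc m)) (Var 0))) st3 1 st4"
        using runs_Assign[of 0 "NodeE (Var (Suc m)) (Var 0)" st3] by (simp add: st4_def)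
    qed (use 1 3 in auto)
    ultimately show "\<exists>st'. runs ?C st (T x + U x + 9) st' \<and> st' 0 = tree_of (f x, g x) \<and>
      (\<forall>v\<ge>Suc (Suc m). st' v = st v)"
      by (intro exI[of _ st4]) (auto elim: runs_mono)
  qed
  moreover have "poly_bounded D (\<lambda>x. tsize (f x, g x))"
    using P Q by (auto intro!: poly_bounded_add poly_bounded_const simp flip: One_nat_def)
  moreover have "poly_bounded D (\<lambda>x. T x + U x + 9)"
    using P Q by (intro poly_bounded_add poly_bounded_const)
  ultimately show ?thesis
    unfolding ptime_def by blast
qed

lemma ptime_Cons [ptime_intros]:
  assumes "ptime D f" "ptime D g" shows "ptime D (\<lambda>x. f x # g x)"
  using ptime_Pair[OF assms] by (rule ptime_cong_tree) simp

lemma ptime_Suc [ptime_intros]: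
  assumes "ptime D f" shows "ptime D (\<lambda>x. Suc (f x))"
  using ptime_Pair[OF ptime_const[of D "()"] assms] by (rule ptime_cong_tree) simp

lemma ptime_If:
  assumes b: "ptime D b" and f: "ptime {x \<in> D. b x} f" and g: "ptime {x \<in> D. \<not> b x} g"
  shows "ptime D (\<lambda>x. if b x then f x else g x)"
proof -
  let ?E = "{x \<in> D. b x}" and ?F = "{x \<in> D. \<not> b x}"
  from b obtain P k T where P: "poly_bounded D T" "computes P k D T b"
    unfolding ptime_def by blast
  from f obtain Q l U where Q: "poly_bounded ?E (\<lambda>x. tsize (f x))" "poly_bounded ?E U" "computes Q l ?E U f"
    unfolding ptime_def by blast
  from g obtain R j V where R: "poly_bounded ?F (\<lambda>x. tsize (g x))" "poly_bounded ?F V" "computes R j ?F V g"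
    unfolding ptime_def by blast
  have split: "poly_bounded D (\<lambda>x. if b x then h x else h' x)"
    if hh': "poly_bounded ?E h" "poly_bounded ?F h'" for h h'
  proof -
    obtain p q where "\<forall>x\<in>?E. h x \<le> poly p (tsize x)" "\<forall>x\<in>?F. h' x \<le> poly q (tsize x)"
      using hh' unfolding poly_bounded_def by blast
    then show ?thesis
      unfolding poly_bounded_def by (intro exI[of _ "p + q"]) (auto intro: trans_le_add1 trans_le_add2)
  qed
  define m where "m = Suc (max k (max l j))"
  have m: "k \<le> m" "l \<le> m" "j \<le> m" "0 < m"
    by (auto simp: m_def)
  let ?W = "\<lambda>x. if b x then U x else V x"
  let ?C = "Seq (Assign m (Var 0)) (Seq P (Seq (Assign (Suc m) (Var 0)) (Seq (Assign 0 (Var m))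
    (If (Var (Suc m)) Q R))))"
  have "computes ?C (Suc (Suc m)) D (\<lambda>x. T x + ?W x + 9) (\<lambda>x. if b x then f x else g x)"
    unfolding computes_def
  proof (intro ballI allI impI)
    fix x and st :: store assume x: "x \<in> D" "st 0 = tree_of x"
    obtain st1 where 1: "runs P (st(m := st 0)) (T x) st1" "st1 0 = tree_of (b x)"
      "\<And>v. v \<ge> m \<Longrightarrow> st1 v = (st(m := st 0)) v"
      using computesD[OF computes_mono[OF P(2) m(1)] x(1), of "st(m := st 0)"] x(2) m(4) by auto
    define st2 where "st2 = st1(Suc m := st1 0, 0 := st1 m)"
    have 2: "st2 0 = tree_of x"
      using 1(3)[of m] x by (simp add: st2_def)
    obtain st3 where 3: "b x \<Longrightarrow> runs Q st2 (?W x) st3" "\<not> b x \<Longrightarrow> runs R st2 (?W x) st3"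
      "st3 0 = tree_of (if b x then f x else g x)" "\<And>v. v \<ge> m \<Longrightarrow> st3 v = st2 v"
    proof (cases "b x")
      case True
      then show ?thesis
        using computesD[OF computes_mono[OF Q(3) m(2)], of x st2] 2 x(1) that by auto
    next
      case False
      then show ?thesis
        using computesD[OF computes_mono[OF R(3) m(3)], of x st2] 2 x(1) that by auto
    qed
    have "\<forall>v\<ge>Suc (Suc m). st3 v = st v"
      using 3(4) 1(3) by (auto simp: st2_def)
    moreover have "runs ?C st (1 + (T x + (1 + (1 + (?W x + 1) + 1) + 1) + 1) + 1) st3"
    proof (intro runs_Seq runs_If)
      show "runs (Assign m (Var 0)) st 1 (st(m := st 0))"
        using runs_Assign[of m "Var 0" st] by simp
      show "runs (Assign (Suc m) (Var 0)) st1 1 (st1(Suc m := st1 0))"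
        using runs_Assign[of "Suc m" "Var 0" st1] by simp
      show "runs (Assign 0 (Var m)) (st1(Suc m := st1 0)) 1 st2"
        using runs_Assign[of 0 "Var m" "st1(Suc m := st1 0)"] by (simp add: st2_def)
    qed (use 1 3 in \<open>auto simp: st2_def\<close>)
    ultimately show "\<exists>st'. runs ?C st (T x + ?W x + 9) st' \<and>
        st' 0 = tree_of (if b x then f x else g x) \<and> (\<forall>v\<ge>Suc (Suc m). st' v = st v)"
      using 3(3) by (intro exI[of _ st3]) (auto elim: runs_mono)
  qed
  moreover have "poly_bounded D (\<lambda>x. tsize (if b x then f x else g x))"
    using split[OF Q(1) R(1)] by (simp add: if_distrib)
  moreover have "poly_bounded D (\<lambda>x. T x + ?W x + 9)"
    using P split[OF Q(2) R(2)] by (intro poly_bounded_add poly_bounded_const)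
  ultimately show ?thesis
    unfolding ptime_def by blast
qed

lemma ptime_If' [ptime_intros]:
  assumes "ptime D b" "ptime D f" "ptime D g"
  shows "ptime D (\<lambda>x. if b x then f x else g x)"
  by (rule ptime_If[OF assms(1) ptime_subset[OF assms(2)] ptime_subset[OF assms(3)]]) auto

text \<open>The loop keeps \<open>x\<close> in variable \<open>k\<close>, the rest of the list in
  \<open>Suc k\<close> and the accumulator in \<open>Suc (Suc k)\<close>. The body only has to work
  on the reachable triples in \<open>E\<close>, and \<open>h\<close> bounds the intermediate
  accumulators and hence the time of each round.\<close>

lemma ptime_loop:
  assumes body: "ptime E (\<lambda>p. f (fst p) (fst (snd p)) (snd (snd p)))"
    and dom: "\<And>x l a ys y zs. (x, l, a) \<in> D \<Longrightarrow> l = ys @ y # zs \<Longrightarrow> (x, y, fold (f x) ys a) \<in> E"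
    and h: "poly_bounded D h"
    and size: "\<And>x l a ys zs. (x, l, a) \<in> D \<Longrightarrow> l = ys @ zs \<Longrightarrow> tsize (fold (f x) ys a) \<le> h (x, l, a)"
  shows "ptime D (\<lambda>p. fold (f (fst p)) (fst (snd p)) (snd (snd p)))"
proof -
  from body obtain P k0 T where T: "poly_bounded E T"
    and P0: "computes P k0 E T (\<lambda>p. f (fst p) (fst (snd p)) (snd (snd p)))"
    unfolding ptime_def by blast
  define k where "k = Suc k0"
  have P: "computes P k E T (\<lambda>p. f (fst p) (fst (snd p)) (snd (snd p)))" and k: "0 < k"
    using computes_mono[OF P0, of k] by (auto simp: k_def)
  from T obtain q where q: "\<And>z. z \<in> E \<Longrightarrow> T z \<le> poly q (tsize z)"
    unfolding poly_bounded_def by blast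
  define B where "B z = poly q (tsize z + h z)" for z
  have B: "T (x, y, fold (f x) ys a) \<le> B (x, l, a)" if "(x, l, a) \<in> D" "l = ys @ y # zs" for x l a ys y zs
  proof -
    have "tsize (x, y, fold (f x) ys a) \<le> tsize (x, l, a) + h (x, l, a)"
      using size[OF that(1), of ys "y # zs"] that(2) by auto
    then show ?thesis
      unfolding B_def using q[OF dom[OF that]] poly_nat_mono le_trans by blast
  qed
  let ?body = "Seq (Assign 0 (NodeE (Var k) (NodeE (LeftE (Var (Suc k))) (Var (Suc (Suc k))))))
    (Seq P (Seq (Assign (Suc (Suc k)) (Var 0)) (Assign (Suc k) (RightE (Var (Suc k))))))"
  let ?W = "While (Var (Suc k)) ?body"
  \<comment> \<open>Generalized to a split \<open>ys @ zs\<close> of the list: \<open>ys\<close> has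
    been processed, \<open>zs\<close> is still in the variable.\<close>
  have loop: "\<exists>st'. runs ?W st (length zs * (B (x, l, a) + 9) + 1) st' \<and>
      st' (Suc (Suc k)) = tree_of (fold (f x) l a) \<and> (\<forall>v\<ge>Suc (Suc (Suc k)). st' v = st v)"
    if D: "(x, l, a) \<in> D" and "l = ys @ zs" "st k = tree_of x" "st (Suc k) = tree_of zs"
      "st (Suc (Suc k)) = tree_of (fold (f x) ys a)" for x l a ys zs st
    using that(2-)
  proof (induction zs arbitrary: ys st)
    case Nil
    then show ?case
      using runs_While_Leaf[of "Var (Suc k)" st ?body] by auto
  next
    case (Cons y zs)
    define z where "z = (x, y, fold (f x) ys a)"
    define st1 where "st1 = st(0 := tree_of z)"
    have "z \<in> E"
      unfolding z_def using dom[OF D] Cons.prems(1) by blast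
    then obtain st2 where 2: "runs P st1 (T z) st2" "st2 0 = tree_of (f x y (fold (f x) ys a))"
      "\<And>v. v \<ge> k \<Longrightarrow> st2 v = st1 v"
      using computesD[OF P, of z st1] by (auto simp: st1_def z_def)
    define st3 where "st3 = st2(Suc (Suc k) := st2 0)"
    define st4 where "st4 = st3(Suc k := right (st3 (Suc k)))"
    have "runs ?body st (1 + (T z + (1 + 1 + 1) + 1) + 1) st4"
    proof (intro runs_Seq)
      show "runs (Assign 0 (NodeE (Var k) (NodeE (LeftE (Var (Suc k))) (Var (Suc (Suc k)))))) st 1 st1"
        using runs_Assign[of 0 "NodeE (Var k) (NodeE (LeftE (Var (Suc k))) (Var (Suc (Suc k))))" st] Cons.prems
        by (simp add: st1_def z_def)
      show "runs (Assign (Suc (Suc k)) (Var 0)) st2 1 st3"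
        using runs_Assign[of "Suc (Suc k)" "Var 0" st2] by (simp add: st3_def)
      show "runs (Assign (Suc k) (RightE (Var (Suc k)))) st3 1 st4"
        using runs_Assign[of "Suc k" "RightE (Var (Suc k))" st3] by (simp add: st4_def)
    qed (use 2 in auto)
    then have body: "runs ?body st (B (x, l, a) + 7) st4"
      by (rule runs_mono) (use B[OF D Cons.prems(1)] in \<open>auto simp: z_def\<close>)
    have v: "st4 k = st k" "st4 (Suc k) = tree_of zs" "st4 (Suc (Suc k)) = tree_of (fold (f x) (ys @ [y]) a)"
      "\<And>v. v \<ge> Suc (Suc (Suc k)) \<Longrightarrow> st4 v = st v"
      using 2(2,3) k Cons.prems(3) by (auto simp: st4_def st3_def st1_def)
    obtain st5 where 5: "runs ?W st4 (length zs * (B (x, l, a) + 9) + 1) st5"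
      "st5 (Suc (Suc k)) = tree_of (fold (f x) l a)" "\<forall>v\<ge>Suc (Suc (Suc k)). st5 v = st4 v"
      using Cons.IH[of "ys @ [y]" st4] Cons.prems v by auto
    have "runs ?W st (B (x, l, a) + 7 + (length zs * (B (x, l, a) + 9) + 1) + 1) st5"
      using runs_While_Node[OF _ body 5(1)] Cons.prems(3) by simp
    then have "runs ?W st (length (y # zs) * (B (x, l, a) + 9) + 1) st5"
      by (rule runs_mono) simp
    then show ?case
      using 5 v by auto
  qed
  let ?C = "Seq (Assign k (LeftE (Var 0))) (Seq (Assign (Suc k) (LeftE (RightE (Var 0))))
    (Seq (Assign (Suc (Suc k)) (RightE (RightE (Var 0)))) (Seq ?W (Assign 0 (Var (Suc (Suc k)))))))"
  have "computes ?C (Suc (Suc (Suc k))) D (\<lambda>z. tsize z * (B z + 9) + 9)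
      (\<lambda>p. fold (f (fst p)) (fst (snd p)) (snd (snd p)))"
    unfolding computes_def
  proof (intro ballI allI impI)
    fix z and st :: store assume z: "z \<in> D" "st 0 = tree_of z"
    obtain x l a where xla: "z = (x, l, a)"
      by (cases z) auto
    define st1 where "st1 = st(k := tree_of x)"
    define st2 where "st2 = st1(Suc k := tree_of l)"
    define st3 where "st3 = st2(Suc (Suc k) := tree_of a)"
    note st = st1_def st2_def st3_def
    obtain st4 where 4: "runs ?W st3 (length l * (B z + 9) + 1) st4"
      "st4 (Suc (Suc k)) = tree_of (fold (f x) l a)" "\<forall>v\<ge>Suc (Suc (Suc k)). st4 v = st3 v"
      using loop[of x l a "[]" l st3] z xla by (auto simp: st)
    define st5 where "st5 = st4(0 := tree_of (fold (f x) l a))"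
    have "runs ?C st (1 + (1 + (1 + ((length l * (B z + 9) + 1) + 1 + 1) + 1) + 1) + 1) st5"
    proof (intro runs_Seq)
      show "runs (Assign k (LeftE (Var 0))) st 1 st1"
        using runs_Assign[of k "LeftE (Var 0)" st] z xla by (simp add: st)
      show "runs (Assign (Suc k) (LeftE (RightE (Var 0)))) st1 1 st2"
        using runs_Assign[of "Suc k" "LeftE (RightE (Var 0))" st1] z xla k by (simp add: st)
      show "runs (Assign (Suc (Suc k)) (RightE (RightE (Var 0)))) st2 1 st3"
        using runs_Assign[of "Suc (Suc k)" "RightE (RightE (Var 0))" st2] z xla k by (simp add: st)
      show "runs (Assign 0 (Var (Suc (Suc k)))) st4 1 st5"
        using runs_Assign[of 0 "Var (Suc (Suc k))" st4] 4 by (simp add: st5_def)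
    qed (use 4 in auto)
    moreover have "length l * (B z + 9) \<le> tsize z * (B z + 9)"
      using length_le_tsize[of l] xla by (intro mult_right_mono) auto
    ultimately have "runs ?C st (tsize z * (B z + 9) + 9) st5"
      by (auto elim!: runs_mono)
    then show "\<exists>st'. runs ?C st (tsize z * (B z + 9) + 9) st' \<and>
        st' 0 = tree_of (fold (f (fst z)) (fst (snd z)) (snd (snd z))) \<and>
        (\<forall>v\<ge>Suc (Suc (Suc k)). st' v = st v)"
      using 4 xla by (intro exI[of _ st5]) (auto simp: st5_def st)
  qed
  moreover have "poly_bounded D (\<lambda>z. tsize z * (B z + 9) + 9)"
  proof -
    obtain p where p: "\<And>z. z \<in> D \<Longrightarrow> h z \<le> poly p (tsize z)"
      using h unfolding poly_bounded_def by blast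
    have "poly_bounded D B"
      unfolding poly_bounded_def
    proof (intro exI[of _ "pcompose q ([:0, 1:] + p)"] ballI)
      fix z assume "z \<in> D"
      then show "B z \<le> poly (pcompose q ([:0, 1:] + p)) (tsize z)"
        using p[of z] by (simp add: B_def poly_pcompose del: split_paired_All) (intro poly_nat_mono add_left_mono)
    qed
    then show ?thesis
      by (intro poly_bounded_add poly_bounded_mult poly_bounded_const poly_bounded_tsize)
  qed
  moreover have "poly_bounded D (\<lambda>p. tsize (fold (f (fst p)) (fst (snd p)) (snd (snd p))))"
    by (rule poly_bounded_mono[OF h]) (use size in force)
  ultimately show ?thesis
    unfolding ptime_def by blast
qed

text \<open>
  Without the bound on the accumulator its size might double in every round.
\<close>

lemma ptime_fold:
  assumes l: "ptime D l" and a: "ptime D a"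
    and body: "ptime {(x, e, b). x \<in> D \<and> e \<in> set (l x)} (\<lambda>p. f (fst p) (fst (snd p)) (snd (snd p)))"
    and h: "poly_bounded D h"
    and size: "\<And>x ys zs. x \<in> D \<Longrightarrow> l x = ys @ zs \<Longrightarrow> tsize (fold (f x) ys (a x)) \<le> h x"
  shows "ptime D (\<lambda>x. fold (f x) (l x) (a x))"
proof -
  let ?D = "(\<lambda>x. (x, l x, a x)) ` D"
  have "ptime ?D (\<lambda>p. fold (f (fst p)) (fst (snd p)) (snd (snd p)))"
  proof (rule ptime_loop[OF body])
    show "poly_bounded ?D (\<lambda>p. h (fst p))"
      by (rule poly_bounded_comp[OF h]) (auto intro: poly_bounded_mono[OF poly_bounded_tsize])
    show "(x, y, fold (f x) ys c) \<in> {(x, e, b). x \<in> D \<and> e \<in> set (l x)}"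
      if "(x, m, c) \<in> ?D" "m = ys @ y # zs" for x m c ys y zs
    proof -
      have "l x = ys @ y # zs" "x \<in> D"
        using that by auto
      then show ?thesis by auto
    qed
    show "tsize (fold (f x) ys c) \<le> h (fst (x, m, c))"
      if "(x, m, c) \<in> ?D" "m = ys @ zs" for x m c ys zs
    proof -
      have "l x = ys @ zs" "x \<in> D" "c = a x"
        using that by auto
      then show ?thesis
        using size by simp
    qed
  qed
  from ptime_comp[OF this ptime_Pair[OF ptime_id ptime_Pair[OF l a]]] show ?thesis
    by simp
qed

text \<open>Additive growth is harmless: there are at most \<open>tsize (l x)\<close> rounds, and
  each adds at most \<open>h x\<close>.\<close>

lemma ptime_fold_grow:
  assumes l: "ptime D l" and a: "ptime D a"
    and body: "ptime {(x, e, b). x \<in> D \<and> e \<in> set (l x)} (\<lambda>p. f (fst p) (fst (snd p)) (snd (snd p)))"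
    and h: "poly_bounded D h"
    and size: "\<And>x e b. x \<in> D \<Longrightarrow> e \<in> set (l x) \<Longrightarrow> tsize (f x e b) \<le> tsize b + h x"
  shows "ptime D (\<lambda>x. fold (f x) (l x) (a x))"
proof (rule ptime_fold[OF l a body])
  show "poly_bounded D (\<lambda>x. tsize (a x) + tsize (l x) * h x)"
    using h ptime_size[OF l] ptime_size[OF a] by (intro poly_bounded_add poly_bounded_mult)
  fix x ys zs
  assume x: "x \<in> D" "l x = ys @ zs"
  have fold: "tsize (fold (f x) ys b) \<le> tsize b + length ys * h x" if "set ys \<subseteq> set (l x)" for ys b
    using that
  proof (induction ys arbitrary: b)
    case (Cons y ys)
    then have "tsize (fold (f x) (y # ys) b) \<le> tsize (f x y b) + length ys * h x"
      by simp
    then show ?case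
      using size[OF x(1), of y b] Cons.prems by simp
  qed simp
  have "length ys \<le> tsize (l x)"
    using x(2) length_le_tsize[of "l x"] by simp
  then have "length ys * h x \<le> tsize (l x) * h x"
    by (rule mult_right_mono) simp
  moreover have "set ys \<subseteq> set (l x)"
    using x(2) by simp
  ultimately show "tsize (fold (f x) ys (a x)) \<le> tsize (a x) + tsize (l x) * h x"
    using fold[of ys "a x"] by linarith
qed

subsection \<open>Lists and unary numbers\<close>

text \<open>An element is smaller than the list that contains it, so a bound in terms of the pair
  \<open>(x, e)\<close> becomes one in terms of \<open>x\<close> alone.\<close>

lemma poly_bounded_elem:
  assumes b: "poly_bounded {(x, e). x \<in> D \<and> e \<in> set (l x)} b" and l: "poly_bounded D (\<lambda>x. tsize (l x))"
  obtains h where "poly_bounded D h" "\<And>x e. x \<in> D \<Longrightarrow> e \<in> set (l x) \<Longrightarrow> b (x, e) \<le> h x"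
proof -
  obtain p where p: "\<And>x e. x \<in> D \<Longrightarrow> e \<in> set (l x) \<Longrightarrow> b (x, e) \<le> poly p (tsize (x, e))"
    using b unfolding poly_bounded_def by blast
  obtain q where q: "\<And>x. x \<in> D \<Longrightarrow> tsize (l x) \<le> poly q (tsize x)"
    using l unfolding poly_bounded_def by blast
  define h where "h x = poly p (tsize x + tsize (l x))" for x
  have "poly_bounded D h"
    unfolding poly_bounded_def
  proof (intro exI[of _ "pcompose p ([:0, 1:] + q)"] ballI)
    fix x assume "x \<in> D"
    then show "h x \<le> poly (pcompose p ([:0, 1:] + q)) (tsize x)"
      using q by (simp add: h_def poly_pcompose poly_nat_mono)
  qed
  moreover have "b (x, e) \<le> h x" if "x \<in> D" "e \<in> set (l x)" for x e
  proof -
    have "tsize (x, e) \<le> tsize x + tsize (l x)"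
      using tsize_elem[OF that(2)] by simp
    then show ?thesis
      using p[OF that] poly_nat_mono le_trans unfolding h_def by blast
  qed
  ultimately show ?thesis by (rule that)
qed

lemma ptime_rev [ptime_intros]:
  assumes "ptime D l" shows "ptime D (\<lambda>x. rev (l x))"
  unfolding rev_conv_fold
  by (rule ptime_fold_grow[OF assms, where h = "\<lambda>x. tsize (l x) + 1"])
    (auto intro!: ptime_intros poly_bounded_add poly_bounded_const ptime_size[OF assms] dest: tsize_elem
      simp flip: One_nat_def)

lemma ptime_append [ptime_intros]:
  assumes l: "ptime D l" and m: "ptime D m" shows "ptime D (\<lambda>x. l x @ m x)"
proof -
  have eq: "fold (#) (rev xs) ys = xs @ ys" for xs ys :: "'c list"
    by (induction xs arbitrary: ys) auto
  have "ptime D (\<lambda>x. fold (#) (rev (l x)) (m x))"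
    by (rule ptime_fold_grow[OF ptime_rev[OF l] m, where h = "\<lambda>x. tsize (l x) + 1"])
      (auto intro!: ptime_intros poly_bounded_add poly_bounded_const ptime_size[OF l] dest: tsize_elem
        simp flip: One_nat_def)
  then show ?thesis
    by (simp add: eq)
qed

lemma ptime_closure:
  assumes "ptime {p. fst p \<in> D \<and> snd p \<in> set (l (fst p))} (\<lambda>p. f (fst p) (snd p))"
  shows "ptime {(x, e, b). x \<in> D \<and> e \<in> set (l x)} (\<lambda>p. f (fst p) (fst (snd p)))"
proof -
  have "ptime {(x, e, b). x \<in> D \<and> e \<in> set (l x)} (\<lambda>p. (fst p, fst (snd p)))"
    by (intro ptime_intros)
  from ptime_comp[OF assms this] show ?thesis
    by auto
qed

lemma ptime_elem_bounded:
  assumes l: "ptime D l"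
    and f: "ptime {p. fst p \<in> D \<and> snd p \<in> set (l (fst p))} (\<lambda>p. f (fst p) (snd p))"
  obtains h where "poly_bounded D h" "\<And>x e. x \<in> D \<Longrightarrow> e \<in> set (l x) \<Longrightarrow> tsize (f x e) \<le> h x"
proof -
  have "poly_bounded {(x, e). x \<in> D \<and> e \<in> set (l x)} (\<lambda>p. tsize (f (fst p) (snd p)))"
    using ptime_size[OF f] by (simp add: case_prod_beta')
  from poly_bounded_elem[OF this ptime_size[OF l]] show ?thesis
    using that by auto
qed

lemma ptime_map [ptime_intros]:
  assumes l: "ptime D l"
    and f: "ptime {p. fst p \<in> D \<and> snd p \<in> set (l (fst p))} (\<lambda>p. f (fst p) (snd p))"
  shows "ptime D (\<lambda>x. map (f x) (l x))"
proof -
  have eq: "fold (\<lambda>e. (#) (g e)) (rev xs) [] = map g xs" for g :: "'b \<Rightarrow> 'c" and xs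
    by (induction xs) auto
  obtain h where h: "poly_bounded D h" "\<And>x e. x \<in> D \<Longrightarrow> e \<in> set (l x) \<Longrightarrow> tsize (f x e) \<le> h x"
    using ptime_elem_bounded[OF l f] by blast
  have "ptime D (\<lambda>x. fold (\<lambda>e. (#) (f x e)) (rev (l x)) [])"
    by (rule ptime_fold_grow[where h = "\<lambda>x. h x + 1"])
      (use ptime_closure[OF f] h in \<open>auto intro!: ptime_intros l poly_bounded_add poly_bounded_const
        simp flip: One_nat_def\<close>)
  then show ?thesis
    by (simp add: eq)
qed

lemma ptime_filter [ptime_intros]:
  assumes l: "ptime D l"
    and f: "ptime {p. fst p \<in> D \<and> snd p \<in> set (l (fst p))} (\<lambda>p. f (fst p) (snd p))"
  shows "ptime D (\<lambda>x. filter (f x) (l x))"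
proof -
  have eq: "fold (\<lambda>e a. if g e then e # a else a) (rev xs) [] = filter g xs" for g :: "'b \<Rightarrow> bool" and xs
    by (induction xs) auto
  have "ptime D (\<lambda>x. fold (\<lambda>e a. if f x e then e # a else a) (rev (l x)) [])"
    by (rule ptime_fold_grow[where h = "\<lambda>x. tsize (l x) + 1"])
      (use ptime_closure[OF f] in \<open>auto intro!: ptime_intros l poly_bounded_add poly_bounded_const ptime_size[OF l]
        dest: tsize_elem simp flip: One_nat_def\<close>)
  then show ?thesis
    by (simp add: eq)
qed

lemma ptime_length [ptime_intros]:
  assumes l: "ptime D l" shows "ptime D (\<lambda>x. length (l x))"
proof -
  have eq: "fold (\<lambda>e. Suc) xs a = length xs + a" for xs :: "'b list" and a
    by (induction xs arbitrary: a) auto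
  have "ptime D (\<lambda>x. fold (\<lambda>e. Suc) (l x) 0)"
    by (rule ptime_fold_grow[where h = "\<lambda>x. 1"])
      (auto intro!: ptime_intros l poly_bounded_const)
  then show ?thesis
    by (simp add: eq)
qed

text \<open>In unary, a number and the list of that many units are the same tree. So iteration a
  given number of times is a fold.\<close>

lemma ptime_units:
  assumes "ptime D n" shows "ptime D (\<lambda>x. replicate (n x) ())"
  using assms
proof (rule ptime_cong_tree)
  show "tree_of (replicate (n x) ()) = tree_of (n x)" for x
    by (induction "n x" arbitrary: x) (simp_all add: tree_of_nat_def tree_of_list_def enc_nat_def)
qed

lemma fold_units: "fold (\<lambda>u. f) (replicate n ()) a = (f ^^ n) a"
  by (induction n arbitrary: a) (simp_all add: funpow_Suc_right del: funpow.simps)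

lemma ptime_funpow:
  fixes f :: "'a::encodable \<Rightarrow> 'b::encodable \<Rightarrow> 'b"
  assumes n: "ptime D n" and a: "ptime D a"
    and body: "ptime {p. fst p \<in> D} (\<lambda>p. f (fst p) (snd p))"
    and h: "poly_bounded D h"
    and size: "\<And>x i. x \<in> D \<Longrightarrow> i \<le> n x \<Longrightarrow> tsize ((f x ^^ i) (a x)) \<le> h x"
  shows "ptime D (\<lambda>x. (f x ^^ n x) (a x))"
proof -
  have "ptime D (\<lambda>x. fold (\<lambda>u. f x) (replicate (n x) ()) (a x))"
  proof (rule ptime_fold[OF ptime_units[OF n] a _ h])
    show "ptime {(x, e, b). x \<in> D \<and> e \<in> set (replicate (n x) ())} (\<lambda>p. f (fst p) (snd (snd p)))"
    proof -
      have "ptime {(x, e, b). x \<in> D \<and> e \<in> set (replicate (n x) ())} (\<lambda>p. (fst p, snd (snd p)))"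
        by (intro ptime_intros)
      from ptime_comp[OF body this] show ?thesis
        by auto
    qed
    show "tsize (fold (\<lambda>u. f x) ys (a x)) \<le> h x" if "x \<in> D" "replicate (n x) () = ys @ zs" for x ys zs
    proof -
      have "ys = replicate (length ys) ()" "length ys \<le> n x"
        using arg_cong[OF that(2), of length] by (auto simp: replicate_length_same)
      then show ?thesis
        using size[OF that(1), of "length ys"] fold_units[of "f x" "length ys" "a x"] by simp
    qed
  qed
  then show ?thesis
    by (simp add: fold_units)
qed

lemma ptime_add [ptime_intros]:
  assumes m: "ptime D m" and n: "ptime D n" shows "ptime D (\<lambda>x. m x + (n x :: nat))"
proof -
  have eq: "(Suc ^^ i) a = i + a" for i a
    by (induction i) auto
  have "ptime D (\<lambda>x. (Suc ^^ m x) (n x))"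
    by (rule ptime_funpow[OF m n, where h = "\<lambda>x. m x + n x"])
      (auto intro!: ptime_intros poly_bounded_add ptime_nat_bounded[OF m] ptime_nat_bounded[OF n] simp: eq)
  then show ?thesis
    by (simp add: eq)
qed

lemma ptime_diff [ptime_intros]:
  assumes m: "ptime D m" and n: "ptime D n" shows "ptime D (\<lambda>x. m x - (n x :: nat))"
proof -
  have eq: "((\<lambda>a. a - 1) ^^ i) a = a - i" for i a :: nat
    by (induction i) auto
  have "ptime D (\<lambda>x. ((\<lambda>a. a - 1) ^^ n x) (m x))"
    by (rule ptime_funpow[OF n m, where h = m])
      (auto intro!: ptime_intros ptime_pred[OF ptime_snd[OF ptime_id], simplified] ptime_nat_bounded[OF m] simp: eq[simplified])
  then show ?thesis
    by (simp add: eq[simplified])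
qed

lemma ptime_mult [ptime_intros]:
  assumes m: "ptime D m" and n: "ptime D n" shows "ptime D (\<lambda>x. m x * (n x :: nat))"
proof -
  have eq: "((\<lambda>a. b + a) ^^ i) 0 = i * b" for i b :: nat
    by (induction i) auto
  have "ptime D (\<lambda>x. ((\<lambda>a. n x + a) ^^ m x) 0)"
    by (rule ptime_funpow[OF m, where h = "\<lambda>x. m x * n x"])
      (auto intro!: ptime_intros poly_bounded_mult ptime_nat_bounded[OF m] ptime_nat_bounded[OF n]
        ptime_comp[OF n] mult_right_mono simp: eq)
  then show ?thesis
    by (simp add: eq)
qed

lemma ptime_not_Nil [ptime_intros]:
  assumes l: "ptime D l" shows "ptime D (\<lambda>x. l x \<noteq> [])"
proof -
  have eq: "fold (\<lambda>e a. True) xs b = (xs \<noteq> [] \<or> b)" for xs :: "'b list" and b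
    by (induction xs arbitrary: b) auto
  have "ptime D (\<lambda>x. fold (\<lambda>e a. True) (l x) False)"
    by (rule ptime_fold_grow[where h = "\<lambda>x. 1"]) (auto intro!: ptime_intros l poly_bounded_const)
  then show ?thesis
    by (simp add: eq)
qed

lemma ptime_not [ptime_intros]:
  assumes "ptime D b" shows "ptime D (\<lambda>x. \<not> b x)"
proof -
  have "(\<lambda>x. \<not> b x) = (\<lambda>x. if b x then False else True)"
    by auto
  then show ?thesis
    using ptime_If'[OF assms ptime_const ptime_const, of False True] by (simp only:)
qed

lemma ptime_conj [ptime_intros]:
  assumes "ptime D b" "ptime D c" shows "ptime D (\<lambda>x. b x \<and> c x)"
proof -
  have "(\<lambda>x. b x \<and> c x) = (\<lambda>x. if b x then c x else False)"
    by auto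
  then show ?thesis
    using ptime_If'[OF assms ptime_const, of False] by (simp only:)
qed

lemma ptime_le [ptime_intros]:
  assumes "ptime D m" "ptime D n" shows "ptime D (\<lambda>x. m x \<le> (n x :: nat))"
  using ptime_not[OF ptime_not_Nil[OF ptime_units[OF ptime_diff[OF assms]]]] by simp

lemma ptime_less [ptime_intros]:
  assumes "ptime D m" "ptime D n" shows "ptime D (\<lambda>x. m x < (n x :: nat))"
  using ptime_not[OF ptime_le[OF assms(2,1)]] by (simp add: not_le)

lemma ptime_eq_nat [ptime_intros]:
  assumes "ptime D m" "ptime D n" shows "ptime D (\<lambda>x. m x = (n x :: nat))"
  using ptime_conj[OF ptime_le[OF assms] ptime_le[OF assms(2,1)]] by (simp add: eq_iff)

lemma ptime_min [ptime_intros]: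
  assumes "ptime D m" "ptime D n" shows "ptime D (\<lambda>x. min (m x) (n x :: nat))"
  unfolding min_def by (intro ptime_intros assms)

text \<open>Gives the body of a \<open>map\<close>, \<open>filter\<close> or sum access to values
  computed in the enclosing context.\<close>

lemma ptime_outer:
  assumes "ptime D f" shows "ptime {p. fst p \<in> D \<and> Q p} (\<lambda>p. f (fst p))"
  by (rule ptime_comp[OF assms]) (auto intro: ptime_intros)

lemma ptime_mem [ptime_intros]:
  assumes "ptime D e" "ptime D l" shows "ptime D (\<lambda>x. (e x :: nat) \<in> set (l x))"
proof -
  have "ptime D (\<lambda>x. filter (\<lambda>a. a = e x) (l x) \<noteq> [])"
    by (intro ptime_intros assms ptime_outer)
  moreover have "filter (\<lambda>a. a = e x) (l x) \<noteq> [] \<longleftrightarrow> e x \<in> set (l x)" for x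
    by (auto simp: filter_empty_conv)
  ultimately show ?thesis by simp
qed

lemma ptime_upt [ptime_intros]:
  assumes n: "ptime D n" shows "ptime D (\<lambda>x. [0..<n x])"
proof -
  have eq: "((\<lambda>a. a @ [length a]) ^^ i) [] = [0..<i]" for i
    by (induction i) auto
  have size: "tsize [0..<i] \<le> m * (m + 1)" if "i \<le> m" for i m
  proof -
    have "tsize [0..<i] = (\<Sum>j\<leftarrow>[0..<i]. j + 1)"
      by (simp add: tsize_list)
    also have "\<dots> \<le> (\<Sum>j\<leftarrow>[0..<i]. i)"
      by (rule sum_list_mono) auto
    also have "\<dots> \<le> m * (m + 1)"
      using that by (simp add: sum_list_triv del: mult_Suc_right) (intro mult_mono, auto)
    finally show ?thesis .
  qed
  have "ptime D (\<lambda>x. ((\<lambda>a. a @ [length a]) ^^ n x) [])"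
    by (rule ptime_funpow[OF n, where h = "\<lambda>x. n x * (n x + 1)"])
      (use size in \<open>auto intro!: ptime_intros poly_bounded_mult poly_bounded_add poly_bounded_const
        ptime_nat_bounded[OF n] simp: eq simp del: mult_Suc_right simp flip: One_nat_def\<close>)
  then show ?thesis
    by (simp add: eq)
qed

lemma ptime_enumerate [ptime_intros]:
  assumes l: "ptime D l" shows "ptime D (\<lambda>x. List.enumerate 0 (l x))"
proof -
  let ?f = "\<lambda>e b. (Suc (fst b), (fst b, e) # snd b)"
  have eq: "fold ?f xs (0, []) = (length xs, rev (List.enumerate 0 xs))" for xs :: "'b list"
    by (induction xs rule: rev_induct) (auto simp: enumerate_append_eq)
  have size: "tsize (rev (List.enumerate 0 xs)) \<le> length xs * (length xs + 2) + tsize xs" for xs :: "'b list"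
    by (induction xs rule: rev_induct) (auto simp: enumerate_append_eq algebra_simps)
  have "ptime D (\<lambda>x. fold ?f (l x) (0, []))"
  proof (rule ptime_fold[OF l, where h = "\<lambda>x. tsize (l x) * (tsize (l x) + 2) + 2 * tsize (l x) + 1"])
    show "poly_bounded D (\<lambda>x. tsize (l x) * (tsize (l x) + 2) + 2 * tsize (l x) + 1)"
      by (intro poly_bounded_add poly_bounded_mult poly_bounded_const ptime_size l)
    fix x ys zs
    assume "l x = ys @ zs"
    then have le: "length ys \<le> tsize (l x)" "tsize ys \<le> tsize (l x)"
      using length_le_tsize[of "l x"] by auto
    have "length ys * (length ys + 2) \<le> tsize (l x) * (tsize (l x) + 2)"
      using le by (intro mult_mono) auto
    then show "tsize (fold ?f ys (0, [])) \<le> tsize (l x) * (tsize (l x) + 2) + 2 * tsize (l x) + 1"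
      using size[of ys] le unfolding eq by simp
  qed (intro ptime_intros)+
  then have "ptime D (\<lambda>x. rev (snd (fold ?f (l x) (0, []))))"
    by (intro ptime_intros)
  then show ?thesis
    by (simp add: eq)
qed

lemma ptime_sum_list [ptime_intros]:
  assumes l: "ptime D l"
    and f: "ptime {p. fst p \<in> D \<and> snd p \<in> set (l (fst p))} (\<lambda>p. f (fst p) (snd p))"
  shows "ptime D (\<lambda>x. \<Sum>e\<leftarrow>l x. f x e :: nat)"
proof -
  have eq: "fold (\<lambda>e. (+) (g e)) xs a = (\<Sum>e\<leftarrow>xs. g e) + a" for g :: "'b \<Rightarrow> nat" and xs a
    by (induction xs arbitrary: a) auto
  obtain h where h: "poly_bounded D h" "\<And>x e. x \<in> D \<Longrightarrow> e \<in> set (l x) \<Longrightarrow> tsize (f x e) \<le> h x"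
    using ptime_elem_bounded[OF l f] by blast
  have "ptime D (\<lambda>x. fold (\<lambda>e. (+) (f x e)) (l x) 0)"
    by (rule ptime_fold_grow[OF l, where h = h])
      (use ptime_closure[OF f] h in \<open>auto intro!: ptime_intros\<close>)
  then show ?thesis
    by (simp add: eq)
qed

lemma ptime_concat [ptime_intros]:
  assumes l: "ptime D l" shows "ptime D (\<lambda>x. concat (l x))"
proof -
  have eq: "fold (\<lambda>e a. a @ e) xss b = b @ concat xss" for xss :: "'b list list" and b
    by (induction xss arbitrary: b) auto
  have "ptime D (\<lambda>x. fold (\<lambda>e a. a @ e) (l x) [])"
    by (rule ptime_fold_grow[OF l, where h = "\<lambda>x. tsize (l x)"])
      (auto intro!: ptime_intros ptime_size l dest: tsize_elem)
  then show ?thesis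
    by (simp add: eq)
qed

lemma ptime_div [ptime_intros]:
  assumes "ptime D m" "ptime D n" shows "ptime D (\<lambda>x. m x div (n x :: nat))"
proof -
  \<comment> \<open>The quotient is counted as the number of positive multiples of \<open>n\<close>
    up to \<open>m\<close>; the case \<open>n = 0\<close> agrees with division by zero.\<close>
  have eq: "m div n = (if n = 0 then 0 else length (filter (\<lambda>i. n * Suc i \<le> m) [0..<m]))" for m n :: nat
  proof (cases "n = 0")
    case False
    have "n * Suc i \<le> m \<longleftrightarrow> i < m div n" for i
      using False by (metis Suc_le_eq less_eq_div_iff_mult_less_eq mult.commute neq0_conv)
    moreover have "i < m div n \<Longrightarrow> i < m" for i
      using div_le_dividend less_le_trans by blast
    ultimately have "set (filter (\<lambda>i. n * Suc i \<le> m) [0..<m]) = {..<m div n}"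
      by auto
    then have "length (filter (\<lambda>i. n * Suc i \<le> m) [0..<m]) = m div n"
      by (metis card_lessThan distinct_card distinct_filter distinct_upt)
    then show ?thesis using False by simp
  qed simp
  show ?thesis
    unfolding eq by (intro ptime_intros assms ptime_outer)
qed

text \<open>First occurrences are kept, unlike with \<open>remdups\<close>, so that no document is
  delayed and the accumulator remains a prefix of the result.\<close>

definition dedup_onto :: "'a list \<Rightarrow> 'a list \<Rightarrow> 'a list" where
  "dedup_onto a l = fold (\<lambda>e a. if e \<in> set a then a else a @ [e]) l a"

lemma set_dedup_onto [simp]: "set (dedup_onto a l) = set a \<union> set l"
  unfolding dedup_onto_def by (induction l arbitrary: a) auto

lemma distinct_dedup_onto: "distinct a \<Longrightarrow> distinct (dedup_onto a l)"
  unfolding dedup_onto_def by (induction l arbitrary: a) auto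

lemma dedup_onto_append: "dedup_onto a (l @ m) = dedup_onto (dedup_onto a l) m"
  by (simp add: dedup_onto_def)

lemma length_dedup_onto_le: "length (dedup_onto a l) \<le> length a + length l"
proof (induction l arbitrary: a)
  case (Cons e l)
  show ?case
    using Cons[of a] Cons[of "a @ [e]"] by (simp add: dedup_onto_def)
qed (simp add: dedup_onto_def)

lemma dedup_onto_prefix: "\<exists>b. dedup_onto a l = a @ b"
proof (induction l arbitrary: a)
  case (Cons e l)
  show ?case
    using Cons[of a] Cons[of "a @ [e]"] by (auto simp: dedup_onto_def)
qed (simp add: dedup_onto_def)

lemma ptime_dedup_onto [ptime_intros]:
  assumes a: "ptime D a" and l: "ptime D l" shows "ptime D (\<lambda>x. dedup_onto (a x) (l x) :: nat list)"
  unfolding dedup_onto_def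
  by (rule ptime_fold_grow[OF l a, where h = "\<lambda>x. tsize (l x) + 1"])
    (auto intro!: ptime_intros l poly_bounded_add poly_bounded_const ptime_size dest: tsize_elem simp flip: One_nat_def)

lemma ptime_card [ptime_intros]:
  assumes "ptime D l" shows "ptime D (\<lambda>x. card (set (l x :: nat list)))"
proof -
  have "card (set xs) = length (dedup_onto [] xs)" for xs :: "nat list"
    using distinct_card[OF distinct_dedup_onto[of "[]" xs]] by simp
  then show ?thesis
    using assms by (auto intro!: ptime_intros)
qed

lemma ptime_card_Int [ptime_intros]:
  assumes "ptime D l" "ptime D m" shows "ptime D (\<lambda>x. card (set (l x :: nat list) \<inter> set (m x)))"
proof -
  have "ptime D (\<lambda>x. card (set (filter (\<lambda>e. e \<in> set (m x)) (l x))))"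
    by (intro ptime_intros assms ptime_outer)
  then show ?thesis
    by (simp add: Int_def)
qed

lemma ptime_card_Diff [ptime_intros]:
  assumes "ptime D l" "ptime D m" shows "ptime D (\<lambda>x. card (set (l x :: nat list) - set (m x)))"
proof -
  have "ptime D (\<lambda>x. card (set (filter (\<lambda>e. e \<notin> set (m x)) (l x))))"
    by (intro ptime_intros assms ptime_outer)
  then show ?thesis
    by (simp add: set_diff_eq)
qed

section \<open>One phase of the algorithm\<close>

text \<open>
  A document is a pair of its number and its topics, a user a pair of interests and demand.
\<close>

type_synonym doc = "nat \<times> nat list"
type_synonym user = "nat list \<times> nat"

definition unsat :: "nat list \<Rightarrow> user \<Rightarrow> bool" where
  "unsat B u \<longleftrightarrow> card (set (fst u) \<inter> set B) < snd u"

definition residual :: "nat list \<Rightarrow> user \<Rightarrow> nat" where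
  "residual H u = snd u - card (set (fst u) \<inter> set H)"

text \<open>An integer version of \<open>L\<close> times the minimum of 1 and the fraction of the
  residual demand that \<open>C\<close> newly meets. The residual refers to \<open>H\<close> and
  stays fixed while the covered set \<open>B\<close> grows.\<close>

definition user_gain :: "nat \<Rightarrow> nat list \<Rightarrow> nat list \<Rightarrow> nat list \<Rightarrow> user \<Rightarrow> nat" where
  "user_gain L H B C u =
     (L div residual H u) * min (residual H u) (card (set C \<inter> set (fst u) - set B))"

definition gain :: "nat \<Rightarrow> nat list \<Rightarrow> nat list \<Rightarrow> user list \<Rightarrow> nat list \<Rightarrow> nat" where
  "gain L H B V C = (\<Sum>u\<leftarrow>V. user_gain L H B C u)"

definition covered :: "doc list \<Rightarrow> nat list" where
  "covered Q = concat (map snd Q)"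

text \<open>The threshold for the gain is \<open>2 * L * length U / r\<close>, multiplied out to
  avoid division.\<close>

definition greedy_step :: "nat \<Rightarrow> nat \<Rightarrow> user list \<Rightarrow> nat list \<Rightarrow> doc \<Rightarrow> doc list \<Rightarrow> doc list" where
  "greedy_step r L U H d Q =
     (if 2 * L * length U < r * gain L H (H @ covered Q) (filter (unsat (H @ covered Q)) U) (snd d)
      then d # Q else Q)"

definition greedy :: "doc list \<Rightarrow> nat \<Rightarrow> nat \<Rightarrow> user list \<Rightarrow> nat list \<Rightarrow> doc list" where
  "greedy ds r L U H = fold (greedy_step r L U H) ds []"

definition left_over :: "doc list \<Rightarrow> nat \<Rightarrow> nat \<Rightarrow> user list \<Rightarrow> nat list \<Rightarrow> user list" where
  "left_over ds r L U H = filter (unsat (H @ covered (greedy ds r L U H))) U"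

text \<open>The weights count units of \<open>1 / M\<close>, so heavy means fractional coverage at
  least 1/16.\<close>

definition heavy :: "nat \<Rightarrow> nat \<Rightarrow> (doc \<times> nat) list \<Rightarrow> nat list" where
  "heavy nt M X = filter (\<lambda>e. M \<le> 16 * (\<Sum>p\<leftarrow>X. if e \<in> set (snd (fst p)) then snd p else 0)) [0..<nt]"

definition weight :: "(doc \<times> nat) list \<Rightarrow> nat" where
  "weight X = (\<Sum>p\<leftarrow>X. snd p)"

text \<open>The common denominator of the weights. Its first summand makes the squared step lengths
  negligible in \<open>potential_update\<close>, and \<open>length ds\<close> absorbs the error of
  subtracting 1 everywhere in \<open>potential_decrease\<close>.\<close>

definition scale :: "doc list \<Rightarrow> nat \<Rightarrow> user list \<Rightarrow> nat" where
  "scale ds L U = 8 * (length ds * (L * length U)) + length ds + 1"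

text \<open>The first case corrects a violated bound on the total weight, whose coefficients are all
  1; the last corrects a violated covering inequality with the gains as coefficients. The budget
  \<open>2 * t\<close> is twice that of the solution aimed at, which provides the margin in the
  first case.\<close>

definition adjust :: "doc list \<Rightarrow> nat \<Rightarrow> nat \<Rightarrow> nat \<Rightarrow> user list \<Rightarrow> (doc \<times> nat) list \<Rightarrow> (doc \<times> nat) list" where
  "adjust ds nt t L U X =
     (if 2 * t * scale ds L U < weight X then map (\<lambda>p. (fst p, snd p - 1)) X
      else if 8 * length (left_over ds (512 * t) L U (heavy nt (scale ds L U) X)) \<le> length U then X
      else map (\<lambda>p. (fst p, snd p + gain L (heavy nt (scale ds L U) X) (heavy nt (scale ds L U) X)
        (left_over ds (512 * t) L U (heavy nt (scale ds L U) X)) (snd (fst p)))) X)"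

text \<open>From weights 0, the squared distance to a solution scaled by M =
  \<open>scale ds L U\<close> is at most M * M * \<open>length ds\<close>. Every step from
  unbalanced weights lowers this integer, so one step more than that value suffices.\<close>

definition fractional :: "doc list \<Rightarrow> nat \<Rightarrow> nat \<Rightarrow> nat \<Rightarrow> user list \<Rightarrow> (doc \<times> nat) list" where
  "fractional ds nt t L U =
     (adjust ds nt t L U ^^ (scale ds L U * scale ds L U * length ds + 1)) (map (\<lambda>d. (d, 0)) ds)"

subsection \<open>The greedy algorithm\<close>

lemma residual_div_le: "(L div residual H u) * residual H u \<le> L"
  by (simp add: div_times_less_eq_dividend)

lemma user_gain_le: "user_gain L H B C u \<le> L"
proof -
  have "user_gain L H B C u \<le> (L div residual H u) * residual H u"
    unfolding user_gain_def by (intro mult_left_mono) auto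
  then show ?thesis
    using residual_div_le le_trans by blast
qed

lemma gain_le: "gain L H B V C \<le> L * length V"
  unfolding gain_def using user_gain_le by (induction V) (auto intro: add_mono)

lemma user_gain_antimono:
  assumes "set B \<subseteq> set B'" shows "user_gain L H B' C u \<le> user_gain L H B C u"
proof -
  have "card (set C \<inter> set (fst u) - set B') \<le> card (set C \<inter> set (fst u) - set B)"
    using assms by (intro card_mono) auto
  then show ?thesis
    unfolding user_gain_def by (intro mult_left_mono) auto
qed

lemma unsat_antimono: "set B \<subseteq> set B' \<Longrightarrow> unsat B' u \<Longrightarrow> unsat B u"
  unfolding unsat_def by (meson card_mono finite_Int finite_set inf_mono le_less_trans order_refl)

lemma gain_filter: "gain L H B (filter (unsat B) U) C = (\<Sum>u\<leftarrow>U. if unsat B u then user_gain L H B C u else 0)"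
  unfolding gain_def by (induction U) auto

text \<open>Diminishing returns: as more is covered, fewer topics are new and fewer users still
  count, while the residual demands and coefficients stay fixed.\<close>

lemma gain_antimono:
  assumes "set B \<subseteq> set B'"
  shows "gain L H B' (filter (unsat B') U) C \<le> gain L H B (filter (unsat B) U) C"
  unfolding gain_filter
  by (rule sum_list_mono) (use assms user_gain_antimono unsat_antimono in auto)

lemma gain_covered:
  assumes "set C \<subseteq> set B" shows "gain L H B V C = 0"
proof -
  have "user_gain L H B C u = 0" for u
  proof -
    have "set C \<inter> set (fst u) - set B = {}"
      using assms by blast
    then have "card (set C \<inter> set (fst u) - set B) = 0"
      by (simp only: card.empty)
    then show ?thesis
      unfolding user_gain_def by (simp only: min_0R mult_0_right)
  qed
  then show ?thesis
    unfolding gain_def by (induction V) auto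
qed

lemma covered_Cons [simp]: "covered (d # Q) = snd d @ covered Q"
  by (simp add: covered_def)

lemma covered_Nil [simp]: "covered [] = []"
  by (simp add: covered_def)

definition saturated :: "nat \<Rightarrow> nat \<Rightarrow> user list \<Rightarrow> nat list \<Rightarrow> doc list \<Rightarrow> doc \<Rightarrow> bool" where
  "saturated r L U H Q d \<longleftrightarrow>
     r * gain L H (H @ covered Q) (filter (unsat (H @ covered Q)) U) (snd d) \<le> 2 * L * length U"

lemma saturated_Cons: "saturated r L U H Q d \<Longrightarrow> saturated r L U H (d' # Q) d"
proof -
  assume "saturated r L U H Q d"
  moreover have "gain L H (H @ covered (d' # Q)) (filter (unsat (H @ covered (d' # Q))) U) (snd d) \<le>
      gain L H (H @ covered Q) (filter (unsat (H @ covered Q)) U) (snd d)"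
    by (rule gain_antimono) auto
  ultimately show ?thesis
    unfolding saturated_def by (meson le_trans mult_le_mono2)
qed

lemma greedy_step_saturated:
  "saturated r L U H (greedy_step r L U H d Q) d"
  "saturated r L U H Q d' \<Longrightarrow> saturated r L U H (greedy_step r L U H d Q) d'"
proof -
  have "gain L H (H @ covered (d # Q)) V (snd d) = 0" for V
    by (rule gain_covered) auto
  then show "saturated r L U H (greedy_step r L U H d Q) d"
    unfolding greedy_step_def by (simp add: saturated_def)
  show "saturated r L U H Q d' \<Longrightarrow> saturated r L U H (greedy_step r L U H d Q) d'"
    unfolding greedy_step_def by (simp add: saturated_Cons)
qed

text \<open>Why a single scan suffices: a document is saturated once examined, either because it was
  rejected or because it was taken and has no new topics; by \<open>gain_antimono\<close> it stays
  saturated.\<close>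

lemma greedy_saturated: "d \<in> set ds \<Longrightarrow> saturated r L U H (greedy ds r L U H) d"
  unfolding greedy_def
proof (induction ds rule: rev_induct)
  case (snoc d' ds)
  then show ?case
    using greedy_step_saturated by (cases "d = d'") auto
qed simp

lemma set_greedy: "set (greedy ds r L U H) \<subseteq> set ds"
proof -
  have "set (fold (greedy_step r L U H) ds Q) \<subseteq> set Q \<union> set ds" for Q
  proof (induction ds arbitrary: Q)
    case (Cons d ds)
    show ?case
      using Cons[of "greedy_step r L U H d Q"] by (auto simp: greedy_step_def split: if_splits)
  qed simp
  from this[of "[]"] show ?thesis
    by (simp add: greedy_def)
qed

text \<open>
  Counting the step in which a user becomes satisfied as the full residual demand makes the
  progress of the user grow by at least the truncated gain in every step.
\<close>

definition progress :: "nat list \<Rightarrow> nat list \<Rightarrow> user \<Rightarrow> nat" where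
  "progress H B u = (if card (set (fst u) \<inter> set B - set H) < residual H u
     then card (set (fst u) \<inter> set B - set H) else 2 * residual H u)"

definition total_progress :: "nat \<Rightarrow> nat list \<Rightarrow> user list \<Rightarrow> nat list \<Rightarrow> nat" where
  "total_progress L H U B = (\<Sum>u\<leftarrow>U. (L div residual H u) * progress H B u)"

lemma total_progress_le: "total_progress L H U B \<le> 2 * L * length U"
proof -
  have "(L div residual H u) * progress H B u \<le> 2 * L" for u
  proof -
    have "(L div residual H u) * progress H B u \<le> (L div residual H u) * (2 * residual H u)"
      by (intro mult_left_mono) (auto simp: progress_def)
    also have "\<dots> \<le> 2 * L"
      using residual_div_le[of L H u] by simp
    finally show ?thesis .
  qed
  then show ?thesis
    unfolding total_progress_def by (induction U) (auto intro: add_mono)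
qed

lemma card_Int_split:
  assumes "set H \<subseteq> set B"
  shows "card (A \<inter> set B) = card (A \<inter> set H) + card (A \<inter> set B - set H)"
proof -
  have "A \<inter> set B = (A \<inter> set H) \<union> (A \<inter> set B - set H)"
    using assms by blast
  then show ?thesis
    by (metis Diff_disjoint Int_lower2 card_Un_disjoint finite_Diff finite_Int finite_set inf.assoc inf_bot_right inf_commute)
qed

lemma unsat_iff_residual:
  assumes "set H \<subseteq> set B"
  shows "unsat B u \<longleftrightarrow> card (set (fst u) \<inter> set B - set H) < residual H u"
  using card_Int_split[OF assms, of "set (fst u)"] unfolding unsat_def residual_def by linarith

text \<open>If the user becomes satisfied, the old count is below \<open>residual H u\<close> and
  the truncated gain is at most \<open>residual H u\<close>; the value
  \<open>2 * residual H u\<close> covers both.\<close>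

lemma progress_step:
  assumes H: "set H \<subseteq> set B" and B': "set B' = set B \<union> set C"
  shows "progress H B u + (if unsat B u then min (residual H u) (card (set C \<inter> set (fst u) - set B)) else 0)
    \<le> progress H B' u"
proof -
  let ?I = "set (fst u)"
  have "?I \<inter> set B' - set H = (?I \<inter> set B - set H) \<union> (set C \<inter> ?I - set B)"
    using H B' by blast
  then have "card (?I \<inter> set B' - set H) = card (?I \<inter> set B - set H) + card (set C \<inter> ?I - set B)"
    by (subst card_Un_disjoint[symmetric]) auto
  then show ?thesis
    unfolding progress_def unsat_iff_residual[OF H] by auto
qed

lemma total_progress_step:
  assumes H: "set H \<subseteq> set B" and B': "set B' = set B \<union> set C"
  shows "total_progress L H U B + gain L H B (filter (unsat B) U) C \<le> total_progress L H U B'"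
proof -
  have "(L div residual H u) * progress H B u + (if unsat B u then user_gain L H B C u else 0)
      \<le> (L div residual H u) * progress H B' u" for u
    using mult_left_mono[OF progress_step[OF assms, of u], of "L div residual H u"]
    by (auto simp: user_gain_def algebra_simps)
  then have "(\<Sum>u\<leftarrow>U. (L div residual H u) * progress H B u + (if unsat B u then user_gain L H B C u else 0))
      \<le> (\<Sum>u\<leftarrow>U. (L div residual H u) * progress H B' u)"
    by (rule sum_list_mono)
  then show ?thesis
    unfolding total_progress_def gain_filter by (simp add: sum_list_addf)
qed

text \<open>A document that is taken adds more than \<open>2 * L * length U / r\<close> to
  \<open>total_progress\<close>, which never exceeds \<open>2 * L * length U\<close>.\<close>

lemma length_greedy_le: "length (greedy ds r L U H) \<le> r"
proof -
  \<comment> \<open>The \<open>+ 1\<close> uses the strictness of the threshold over the integers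
    and makes the factor positive, so that it can be cancelled at the end.\<close>
  have "length (fold (greedy_step r L U H) ds []) * (2 * L * length U + 1) \<le>
      r * total_progress L H U (H @ covered (fold (greedy_step r L U H) ds []))"
  proof (induction ds rule: rev_induct)
    case (snoc d ds)
    define Q where "Q = fold (greedy_step r L U H) ds []"
    define B where "B = H @ covered Q"
    define g where "g = gain L H B (filter (unsat B) U) (snd d)"
    have IH: "length Q * (2 * L * length U + 1) \<le> r * total_progress L H U B"
      using snoc by (simp only: Q_def B_def)
    have step: "fold (greedy_step r L U H) (ds @ [d]) [] = (if 2 * L * length U < r * g then d # Q else Q)"
      by (simp add: greedy_step_def g_def B_def Q_def)
    show ?case
    proof (cases "2 * L * length U < r * g")
      case True
      have "r * (total_progress L H U B + g) \<le> r * total_progress L H U (H @ covered (d # Q))"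
        unfolding g_def by (intro mult_left_mono total_progress_step) (auto simp: B_def)
      then have "length Q * (2 * L * length U + 1) + (2 * L * length U + 1) \<le>
          r * total_progress L H U (H @ covered (d # Q))"
        using IH True unfolding distrib_left by linarith
      then show ?thesis
        using True unfolding step by (simp add: algebra_simps)
    next
      case False
      then show ?thesis
        using IH unfolding step B_def by (simp only: if_False)
    qed
  qed simp
  also have "\<dots> \<le> r * (2 * L * length U)"
    by (intro mult_left_mono total_progress_le) simp
  also have "\<dots> \<le> r * (2 * L * length U + 1)"
    by simp
  finally show ?thesis
    unfolding greedy_def by (metis Suc_eq_plus1 mult_le_cancel2 zero_less_Suc)
qed

subsection \<open>Convergence of the weights\<close>

lemma sum_sum_list_swap:
  "(\<Sum>i\<in>J. \<Sum>u\<leftarrow>V. g i u) = (\<Sum>u\<leftarrow>V. \<Sum>i\<in>J. g i u :: nat)"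
  by (induction V) (auto simp: sum.distrib)

lemma sum_list_nth: "(\<Sum>p\<leftarrow>X. g p) = (\<Sum>i<length X. g (X ! i) :: 'a::comm_monoid_add)"
  by (simp add: sum_list_sum_nth atLeast0LessThan)

text \<open>If greedy leaves many users, the weights violate the inequality for these users. What
  the weights promise relative to \<open>H\<close> splits into gains that are still available, small
  since all documents are saturated, and gains lost to light topics covered meanwhile. Each part is
  at most a sixteenth of \<open>M * L * length V\<close>.\<close>

lemma weighted_gain_le:
  fixes x :: "'i \<Rightarrow> nat" and C :: "'i \<Rightarrow> nat list"
  assumes J: "finite J" and t: "0 < t" and sum: "(\<Sum>i\<in>J. x i) \<le> 2 * t * M"
    and H: "set H \<subseteq> set B"
    and light: "\<And>e. e \<in> set B - set H \<Longrightarrow> 16 * (\<Sum>i\<in>J. if e \<in> set (C i) then x i else 0) \<le> M"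
    and sat: "\<And>i. i \<in> J \<Longrightarrow> 512 * t * gain L H B (filter (unsat B) U) (C i) \<le> 2 * L * length U"
    and V: "V = filter (unsat B) U" and large: "length U \<le> 8 * length V"
  shows "8 * (\<Sum>i\<in>J. x i * gain L H H V (C i)) \<le> M * L * length V"
proof -
  let ?a = "\<lambda>u. L div residual H u"
  let ?c = "\<lambda>i u. card (set (C i) \<inter> (set (fst u) \<inter> (set B - set H)))"
  have split: "user_gain L H H (C i) u \<le> user_gain L H B (C i) u + ?a u * ?c i u" for i u
  proof -
    let ?A = "set (C i) \<inter> set (fst u)"
    have "?A - set H \<subseteq> (?A - set B) \<union> (set (C i) \<inter> (set (fst u) \<inter> (set B - set H)))"
      by blast
    then have "card (?A - set H) \<le> card ((?A - set B) \<union> (set (C i) \<inter> (set (fst u) \<inter> (set B - set H))))"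
      by (intro card_mono) auto
    also have "\<dots> \<le> card (?A - set B) + ?c i u"
      by (rule card_Un_le)
    finally have "min (residual H u) (card (?A - set H)) \<le> min (residual H u) (card (?A - set B)) + ?c i u"
      by linarith
    from mult_left_mono[OF this, of "?a u"] show ?thesis
      unfolding user_gain_def by (simp add: algebra_simps)
  qed
  \<comment> \<open>A user in \<open>V\<close> is still unsatisfied, so fewer than
    \<open>residual H u\<close> of the interests lie in \<open>B\<close> outside \<open>H\<close>,
    and each of these has weight at most \<open>M / 16\<close>.\<close>
  have load: "16 * (\<Sum>i\<in>J. x i * ?c i u) \<le> M * residual H u" if u: "u \<in> set V" for u
  proof -
    let ?E = "set (fst u) \<inter> (set B - set H)"
    have "x i * ?c i u = (\<Sum>e\<in>?E. if e \<in> set (C i) then x i else 0)" for i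
    proof -
      have "set (C i) \<inter> ?E = {e \<in> ?E. e \<in> set (C i)}"
        by blast
      then show ?thesis
        by (simp add: sum.inter_filter[symmetric] mult.commute)
    qed
    then have "(\<Sum>i\<in>J. x i * ?c i u) = (\<Sum>i\<in>J. \<Sum>e\<in>?E. if e \<in> set (C i) then x i else 0)"
      by simp
    also have "\<dots> = (\<Sum>e\<in>?E. \<Sum>i\<in>J. if e \<in> set (C i) then x i else 0)"
      by (rule sum.swap)
    finally have "16 * (\<Sum>i\<in>J. x i * ?c i u) = (\<Sum>e\<in>?E. 16 * (\<Sum>i\<in>J. if e \<in> set (C i) then x i else 0))"
      by (simp add: sum_distrib_left)
    also have "\<dots> \<le> (\<Sum>e\<in>?E. M)"
      by (intro sum_mono light) auto
    also have "\<dots> = M * card (set (fst u) \<inter> set B - set H)"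
      by (simp add: Int_Diff)
    also have "\<dots> \<le> M * residual H u"
      using u unsat_iff_residual[OF H, of u] V by (intro mult_left_mono) auto
    finally show ?thesis .
  qed
  \<comment> \<open>Weight \<open>2 * t * M\<close>, gain at most
    \<open>2 * L * length U / (512 * t)\<close> and \<open>length U \<le> 8 * length V\<close> give
    the factor 2 * 2 * 8 / 512 = 1/16.\<close>
  have part1: "16 * (\<Sum>i\<in>J. x i * gain L H B V (C i)) \<le> M * L * length V"
  proof -
    have "512 * t * (\<Sum>i\<in>J. x i * gain L H B V (C i)) = (\<Sum>i\<in>J. x i * (512 * t * gain L H B V (C i)))"
      by (simp add: sum_distrib_left algebra_simps)
    also have "\<dots> \<le> (\<Sum>i\<in>J. x i * (2 * L * length U))"
      using sat V by (intro sum_mono mult_left_mono) auto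
    also have "\<dots> = (\<Sum>i\<in>J. x i) * (2 * L * length U)"
      by (simp add: sum_distrib_right)
    also have "\<dots> \<le> (2 * t * M) * (2 * L * (8 * length V))"
      using sum large by (intro mult_mono) auto
    finally have "(32 * t) * (16 * (\<Sum>i\<in>J. x i * gain L H B V (C i))) \<le> (32 * t) * (M * L * length V)"
      by (simp add: algebra_simps)
    then show ?thesis
      by (rule mult_left_le_imp_le) (use t in simp)
  qed
  have "(\<Sum>u\<leftarrow>V. \<Sum>i\<in>J. x i * (?a u * ?c i u)) * 16 = (\<Sum>u\<leftarrow>V. ?a u * (16 * (\<Sum>i\<in>J. x i * ?c i u)))"
  proof -
    have "(\<Sum>i\<in>J. x i * (?a u * ?c i u)) * 16 = ?a u * (16 * (\<Sum>i\<in>J. x i * ?c i u))" for u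
      by (simp add: sum_distrib_left sum_distrib_right algebra_simps)
    then show ?thesis
      by (simp only: sum_list_mult_const[symmetric])
  qed
  also have "\<dots> \<le> (\<Sum>u\<leftarrow>V. M * L)"
  proof (rule sum_list_mono)
    fix u assume "u \<in> set V"
    have "?a u * (16 * (\<Sum>i\<in>J. x i * ?c i u)) \<le> ?a u * (M * residual H u)"
      by (intro mult_left_mono load \<open>u \<in> set V\<close>) simp
    also have "\<dots> = M * (?a u * residual H u)"
      by simp
    also have "\<dots> \<le> M * L"
      by (intro mult_left_mono residual_div_le) simp
    finally show "?a u * (16 * (\<Sum>i\<in>J. x i * ?c i u)) \<le> M * L" .
  qed
  also have "\<dots> = M * L * length V"
    by (simp add: sum_list_triv)
  finally have part2: "16 * (\<Sum>u\<leftarrow>V. \<Sum>i\<in>J. x i * (?a u * ?c i u)) \<le> M * L * length V"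
    by (simp add: mult.commute)
  have "(\<Sum>i\<in>J. x i * gain L H H V (C i)) \<le> (\<Sum>i\<in>J. x i * (gain L H B V (C i) + (\<Sum>u\<leftarrow>V. ?a u * ?c i u)))"
    unfolding gain_def sum_list_addf[symmetric]
    by (intro sum_mono mult_left_mono sum_list_mono split) auto
  also have "\<dots> = (\<Sum>i\<in>J. x i * gain L H B V (C i)) + (\<Sum>u\<leftarrow>V. \<Sum>i\<in>J. x i * (?a u * ?c i u))"
    unfolding sum_sum_list_swap[symmetric] by (simp add: sum.distrib algebra_simps sum_list_const_mult)
  finally show ?thesis
    using part1 part2 by linarith
qed

text \<open>A user whom \<open>J\<close> satisfies gets the whole residual demand from topics
  outside \<open>H\<close>, even after truncation, which is worth at least \<open>L / 2\<close>. At
  most \<open>length U / 16\<close>, hence at most half of \<open>V\<close>, are not satisfied by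
  \<open>J\<close>.\<close>

lemma gain_solution_ge:
  fixes C :: "'i \<Rightarrow> nat list"
  assumes J: "finite J" and L: "\<And>u. u \<in> set U \<Longrightarrow> snd u \<le> L"
    and B: "set H \<subseteq> set B" and V: "V = filter (unsat B) U" and large: "length U \<le> 8 * length V"
    and few: "16 * length (filter (\<lambda>u. card (set (fst u) \<inter> (\<Union>i\<in>J. set (C i))) < snd u) U) \<le> length U"
  shows "L * length V \<le> 4 * (\<Sum>i\<in>J. gain L H H V (C i))"
proof -
  let ?bad = "\<lambda>u. card (set (fst u) \<inter> (\<Union>i\<in>J. set (C i))) < snd u"
  have good: "L \<le> 2 * (\<Sum>i\<in>J. user_gain L H H (C i) u)" if u: "u \<in> set V" "\<not> ?bad u" for u
  proof -
    let ?I = "set (fst u)" and ?r = "residual H u"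
    have "unsat H u"
      using u(1) V B unsat_antimono by auto
    then have r: "0 < ?r" "?r \<le> L"
      using L[of u] u(1) V unfolding unsat_def residual_def by auto
    have min: "min k (\<Sum>i\<in>J'. f i) \<le> (\<Sum>i\<in>J'. min k (f i))" if "finite J'" for k :: nat and f and J' :: "'i set"
      using that by (induction J') auto
    have "?I \<inter> (\<Union>i\<in>J. set (C i)) \<subseteq> (?I \<inter> set H) \<union> (\<Union>i\<in>J. set (C i) \<inter> ?I - set H)"
      by blast
    then have "card (?I \<inter> (\<Union>i\<in>J. set (C i))) \<le> card ((?I \<inter> set H) \<union> (\<Union>i\<in>J. set (C i) \<inter> ?I - set H))"
      using J by (intro card_mono) auto
    also have "\<dots> \<le> card (?I \<inter> set H) + card (\<Union>i\<in>J. set (C i) \<inter> ?I - set H)"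
      by (rule card_Un_le)
    also have "card (\<Union>i\<in>J. set (C i) \<inter> ?I - set H) \<le> (\<Sum>i\<in>J. card (set (C i) \<inter> ?I - set H))"
      using J by (rule card_UN_le)
    finally have "?r \<le> min ?r (\<Sum>i\<in>J. card (set (C i) \<inter> ?I - set H))"
      using u(2) unfolding residual_def by simp
    also note min[OF J]
    finally have "(L div ?r) * ?r \<le> (L div ?r) * (\<Sum>i\<in>J. min ?r (card (set (C i) \<inter> ?I - set H)))"
      by (rule mult_left_mono) simp
    also have "\<dots> = (\<Sum>i\<in>J. user_gain L H H (C i) u)"
      unfolding user_gain_def by (simp add: sum_distrib_left)
    finally have *: "(L div ?r) * ?r \<le> (\<Sum>i\<in>J. user_gain L H H (C i) u)" .
    \<comment> \<open>Since \<open>?r \<le> L\<close>, the remainder is smaller than the part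
      divisible by \<open>?r\<close>: rounding loses less than half.\<close>
    have "L = (L div ?r) * ?r + L mod ?r"
      by (simp only: div_mult_mod_eq)
    moreover have "L mod ?r < ?r" "1 \<le> L div ?r"
      using r by (auto simp: Suc_le_eq div_greater_zero_iff)
    moreover from this have "?r \<le> (L div ?r) * ?r"
      by simp
    ultimately have "L \<le> 2 * ((L div ?r) * ?r)"
      by linarith
    then show ?thesis
      using * by linarith
  qed
  have "L * length (filter (\<lambda>u. \<not> ?bad u) V) \<le> (\<Sum>u\<leftarrow>V. 2 * (\<Sum>i\<in>J. user_gain L H H (C i) u))"
    using good
  proof (induction V)
    case (Cons u V)
    then show ?case
      by (cases "?bad u") (fastforce intro: add_mono trans_le_add2)+
  qed simp
  also have "\<dots> = 2 * (\<Sum>i\<in>J. gain L H H V (C i))"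
    unfolding gain_def sum_sum_list_swap by (simp add: sum_list_const_mult)
  finally have 1: "L * length (filter (\<lambda>u. \<not> ?bad u) V) \<le> 2 * (\<Sum>i\<in>J. gain L H H V (C i))" .
  have "length (filter ?bad V) \<le> length (filter ?bad U)"
    unfolding V by (induction U) auto
  moreover have "length V = length (filter ?bad V) + length (filter (\<lambda>u. \<not> ?bad u) V)"
    by (simp add: sum_length_filter_compl)
  ultimately have "length V \<le> 2 * length (filter (\<lambda>u. \<not> ?bad u) V)"
    using few large by linarith
  then have "L * length V \<le> L * (2 * length (filter (\<lambda>u. \<not> ?bad u) V))"
    by (rule mult_left_mono) simp
  also have "\<dots> = 2 * (L * length (filter (\<lambda>u. \<not> ?bad u) V))"
    by simp
  finally show ?thesis
    using 1 by linarith
qed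

text \<open>The squared Euclidean distance from the weights to \<open>M\<close> times the incidence
  vector of \<open>J\<close>. It occurs only in the analysis; the algorithm does not know
  \<open>J\<close>.\<close>

definition potential :: "nat \<Rightarrow> nat set \<Rightarrow> (doc \<times> nat) list \<Rightarrow> int" where
  "potential M J X = (\<Sum>i<length X. (int (snd (X ! i)) - (if i \<in> J then int M else 0))\<^sup>2)"

lemma potential_nonneg: "0 \<le> potential M J X"
  unfolding potential_def by (rule sum_nonneg) simp

definition balanced :: "doc list \<Rightarrow> nat \<Rightarrow> nat \<Rightarrow> nat \<Rightarrow> user list \<Rightarrow> (doc \<times> nat) list \<Rightarrow> bool" where
  "balanced ds nt t L U X \<longleftrightarrow> weight X \<le> 2 * t * scale ds L U \<and>
     8 * length (left_over ds (512 * t) L U (heavy nt (scale ds L U) X)) \<le> length U"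

lemma map_fst_adjust: "map fst (adjust ds nt t L U X) = map fst X"
  unfolding adjust_def by (simp add: o_def)

text \<open>Subtracting 1 everywhere changes the squared distance by at most minus twice the excess
  of the weight over \<open>card J * M\<close>, plus \<open>length ds\<close>. The excess is more
  than \<open>t * M \<ge> M > length ds\<close>.\<close>

lemma potential_decrease:
  assumes X: "map fst X = ds" and M: "length ds < M" and t: "0 < t" and w: "2 * t * M < weight X"
    and J: "J \<subseteq> {..<length ds}" "card J \<le> t"
  shows "potential M J (map (\<lambda>p. (fst p, snd p - 1)) X) < potential M J X"
proof -
  let ?n = "length X" and ?b = "\<lambda>i. if i \<in> J then int M else 0"
  have n: "?n = length ds"
    using X by auto
  \<comment> \<open>A weight 0 is left unchanged by the truncated subtraction; the inequality then
    holds because \<open>?b i\<close> is nonnegative.\<close>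
  have "(int (snd (X ! i) - 1) - ?b i)\<^sup>2 \<le> (int (snd (X ! i)) - ?b i)\<^sup>2 - (2 * (int (snd (X ! i)) - ?b i) - 1)" for i
    by (cases "snd (X ! i)") (auto simp: power2_eq_square algebra_simps)
  then have "potential M J (map (\<lambda>p. (fst p, snd p - 1)) X) \<le>
      (\<Sum>i<?n. (int (snd (X ! i)) - ?b i)\<^sup>2 - (2 * (int (snd (X ! i)) - ?b i) - 1))"
    unfolding potential_def by (auto intro!: sum_mono)
  also have "\<dots> = potential M J X - 2 * int (weight X) + 2 * (\<Sum>i<?n. ?b i) + int ?n"
    unfolding potential_def weight_def sum_list_nth
    by (simp add: sum_subtractf sum_distrib_left[symmetric] right_diff_distrib)
  also have "(\<Sum>i<?n. ?b i) = int (card J * M)"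
    using J(1) n by (simp add: sum.inter_restrict[symmetric] Int_absorb1)
  finally have "potential M J (map (\<lambda>p. (fst p, snd p - 1)) X) \<le>
      potential M J X - 2 * int (weight X) + 2 * int (card J * M) + int ?n" .
  moreover have "card J * M \<le> t * M"
    using J(2) by simp
  moreover have "M \<le> t * M"
    using t by simp
  ultimately show ?thesis
    using w M n by linarith
qed

text \<open>Write w for \<open>L * length V\<close>. The cross terms contribute at most 2 (1/8 -
  1/4) M w = - M w / 4, and the squared gains less than M w / 8 by the choice of
  \<open>M\<close>.\<close>

lemma potential_update:
  assumes X: "map fst X = ds" and M: "8 * (length ds * (L * m)) < M" and m: "length V \<le> m"
    and J: "J \<subseteq> {..<length ds}"
    and x: "8 * (\<Sum>i<length ds. snd (X ! i) * gain L H H V (snd (ds ! i))) \<le> M * L * length V"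
    and o: "L * length V \<le> 4 * (\<Sum>i\<in>J. gain L H H V (snd (ds ! i)))"
    and pos: "0 < L * length V"
  shows "potential M J (map (\<lambda>p. (fst p, snd p + gain L H H V (snd (fst p)))) X) < potential M J X"
proof -
  let ?n = "length ds" and ?b = "\<lambda>i. if i \<in> J then int M else 0"
  define g where "g i = gain L H H V (snd (ds ! i))" for i
  define a where "a i = snd (X ! i)" for i
  define w where "w = L * length V"
  have n: "length X = ?n" "\<And>i. i < ?n \<Longrightarrow> fst (X ! i) = ds ! i"
    using X by auto
  have "potential M J (map (\<lambda>p. (fst p, snd p + gain L H H V (snd (fst p)))) X) =
      (\<Sum>i<?n. (int (a i) + int (g i) - ?b i)\<^sup>2)"
    unfolding potential_def using n by (auto simp: a_def g_def intro!: sum.cong)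
  also have "\<dots> = (\<Sum>i<?n. (int (a i) - ?b i)\<^sup>2 + (2 * int (a i * g i) - 2 * int M * (if i \<in> J then int (g i) else 0)
      + (int (g i))\<^sup>2))"
    by (intro sum.cong) (auto simp: power2_eq_square algebra_simps)
  also have "\<dots> = potential M J X + 2 * int (\<Sum>i<?n. a i * g i) - 2 * int M * (\<Sum>i<?n. if i \<in> J then int (g i) else 0)
      + (\<Sum>i<?n. (int (g i))\<^sup>2)"
    unfolding potential_def using n(1) by (simp add: a_def sum.distrib sum_subtractf sum_distrib_left[symmetric])
  also have "(\<Sum>i<?n. if i \<in> J then int (g i) else 0) = int (\<Sum>i\<in>J. g i)"
    using J by (simp add: sum.inter_restrict[symmetric] Int_absorb1)
  finally have eq: "potential M J (map (\<lambda>p. (fst p, snd p + gain L H H V (snd (fst p)))) X) =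
      potential M J X + 2 * int (\<Sum>i<?n. a i * g i) - 2 * int M * int (\<Sum>i\<in>J. g i) + (\<Sum>i<?n. (int (g i))\<^sup>2)" .
  have "(\<Sum>i<?n. (int (g i))\<^sup>2) \<le> (\<Sum>i<?n. (int w)\<^sup>2)"
    using gain_le by (intro sum_mono power_mono) (auto simp: g_def w_def simp flip: of_nat_mult)
  then have sq: "(\<Sum>i<?n. (int (g i))\<^sup>2) \<le> int (?n * (w * w))"
    by (simp add: power2_eq_square)
  have "8 * (\<Sum>i<?n. a i * g i) \<le> M * w"
    using x by (simp add: a_def g_def w_def mult.assoc)
  moreover have "M * w \<le> 4 * (M * (\<Sum>i\<in>J. g i))"
    using mult_left_mono[OF o, of M] by (simp add: g_def w_def)
  moreover have "8 * (?n * (w * w)) < M * w"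
  proof -
    have "?n * w \<le> ?n * (L * m)"
      unfolding w_def using m by (intro mult_left_mono) auto
    then have "8 * (?n * w) < M"
      using M by linarith
    then have "8 * (?n * w) * w < M * w"
      using pos by (intro mult_strict_right_mono) (auto simp: w_def)
    then show ?thesis
      by (simp only: mult.assoc)
  qed
  ultimately have "2 * (\<Sum>i<?n. a i * g i) + ?n * (w * w) < 2 * (M * (\<Sum>i\<in>J. g i))"
    by linarith
  then have "int (2 * (\<Sum>i<?n. a i * g i) + ?n * (w * w)) < int (2 * (M * (\<Sum>i\<in>J. g i)))"
    by (simp only: of_nat_less_iff)
  then show ?thesis
    using eq sq by (simp only: of_nat_add of_nat_mult of_nat_numeral mult.assoc)
qed

lemma adjust_progress:
  assumes X: "map fst X = ds" and nt: "\<And>d. d \<in> set ds \<Longrightarrow> set (snd d) \<subseteq> {..<nt}"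
    and t: "0 < t" and L: "\<And>u. u \<in> set U \<Longrightarrow> snd u \<le> L"
    and J: "J \<subseteq> {..<length ds}" "card J \<le> t"
    and few: "16 * length (filter (\<lambda>u. card (set (fst u) \<inter> (\<Union>i\<in>J. set (snd (ds ! i)))) < snd u) U) \<le> length U"
    and unbalanced: "\<not> balanced ds nt t L U X"
  shows "potential (scale ds L U) J (adjust ds nt t L U X) < potential (scale ds L U) J X"
proof (cases "2 * t * scale ds L U < weight X")
  case True
  then show ?thesis
    unfolding adjust_def using potential_decrease[OF X _ t True J] by (simp add: scale_def)
next
  case False
  define M where "M = scale ds L U"
  define H where "H = heavy nt M X"
  define B where "B = H @ covered (greedy ds (512 * t) L U H)"
  define V where "V = left_over ds (512 * t) L U H"
  have w: "weight X \<le> 2 * t * M"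
    using False by (simp add: M_def)
  have large: "length U < 8 * length V"
    using unbalanced False unfolding balanced_def V_def H_def M_def by simp
  have V: "V = filter (unsat B) U"
    by (simp add: V_def left_over_def B_def)
  have HB: "set H \<subseteq> set B"
    by (simp add: B_def)
  have n: "length X = length ds" and nth: "\<And>i. i < length ds \<Longrightarrow> fst (X ! i) = ds ! i"
    using X by auto
  have x: "8 * (\<Sum>i\<in>{..<length ds}. snd (X ! i) * gain L H H V (snd (ds ! i))) \<le> M * L * length V"
  proof (rule weighted_gain_le[OF _ t _ HB _ _ V])
    show "(\<Sum>i\<in>{..<length ds}. snd (X ! i)) \<le> 2 * t * M"
      using w n by (simp add: weight_def sum_list_nth)
    fix e assume e: "e \<in> set B - set H"
    then have "e \<in> set (covered (greedy ds (512 * t) L U H))"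
      by (auto simp: B_def)
    \<comment> \<open>\<open>heavy\<close> ranges over topics below \<open>nt\<close> only, so this
      is what makes a covered topic outside \<open>H\<close> light.\<close>
    then have "e < nt"
      using set_greedy[of ds "512 * t" L U H] nt unfolding covered_def by fastforce
    then have "\<not> M \<le> 16 * (\<Sum>p\<leftarrow>X. if e \<in> set (snd (fst p)) then snd p else 0)"
      using e by (auto simp: H_def heavy_def)
    moreover have "(\<Sum>p\<leftarrow>X. if e \<in> set (snd (fst p)) then snd p else 0) =
        (\<Sum>i\<in>{..<length ds}. if e \<in> set (snd (ds ! i)) then snd (X ! i) else 0)"
      unfolding sum_list_nth n using nth by (intro sum.cong) auto
    ultimately show "16 * (\<Sum>i\<in>{..<length ds}. if e \<in> set (snd (ds ! i)) then snd (X ! i) else 0) \<le> M"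
      by linarith
  next
    fix i assume "i \<in> {..<length ds}"
    then show "512 * t * gain L H B (filter (unsat B) U) (snd (ds ! i)) \<le> 2 * L * length U"
      using greedy_saturated[of "ds ! i" ds "512 * t" L U H] by (simp add: saturated_def B_def)
  qed (use large in auto)
  have fin: "finite J"
    using J(1) finite_subset by blast
  have o: "L * length V \<le> 4 * (\<Sum>i\<in>J. gain L H H V (snd (ds ! i)))"
    by (rule gain_solution_ge[OF fin L HB V _ few]) (use large in auto)
  \<comment> \<open>A strict decrease needs a positive gain of the solution: a user left over has a
    positive demand, whence \<open>0 < L\<close>.\<close>
  obtain u where "u \<in> set V"
    using large by (cases V) auto
  then have "0 < L"
    using L[of u] V by (auto simp: unsat_def)
  then have pos: "0 < L * length V"
    using large by (cases V) auto
  have "potential M J (map (\<lambda>p. (fst p, snd p + gain L H H V (snd (fst p)))) X) < potential M J X"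
    by (rule potential_update[OF X _ _ J(1) x o pos, of "length U"])
      (auto simp: M_def scale_def V)
  then show ?thesis
    unfolding adjust_def M_def[symmetric] H_def[symmetric] V_def[symmetric]
    using w large by simp
qed

lemma balanced_adjust: "balanced ds nt t L U X \<Longrightarrow> adjust ds nt t L U X = X"
  unfolding balanced_def adjust_def by simp

lemma map_fst_fractional: "map fst (fractional ds nt t L U) = ds"
proof -
  have "map fst ((adjust ds nt t L U ^^ i) (map (\<lambda>d. (d, 0)) ds)) = ds" for i
    by (induction i) (simp_all add: map_fst_adjust o_def)
  then show ?thesis
    by (simp add: fractional_def del: funpow.simps)
qed

lemma balanced_fractional:
  assumes nt: "\<And>d. d \<in> set ds \<Longrightarrow> set (snd d) \<subseteq> {..<nt}"
    and t: "0 < t" and L: "\<And>u. u \<in> set U \<Longrightarrow> snd u \<le> L"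
    and J: "J \<subseteq> {..<length ds}" "card J \<le> t"
    and few: "16 * length (filter (\<lambda>u. card (set (fst u) \<inter> (\<Union>i\<in>J. set (snd (ds ! i)))) < snd u) U) \<le> length U"
  shows "balanced ds nt t L U (fractional ds nt t L U)"
proof -
  let ?M = "scale ds L U" and ?X = "\<lambda>i. (adjust ds nt t L U ^^ i) (map (\<lambda>d. (d, 0)) ds)"
  have "balanced ds nt t L U (?X i) \<or> potential ?M J (?X i) \<le> int (?M * ?M * length ds) - int i" for i
  proof (induction i)
    case 0
    have "potential ?M J (?X 0) = (\<Sum>i<length ds. (if i \<in> J then int ?M else 0)\<^sup>2)"
      unfolding potential_def by simp
    also have "\<dots> \<le> (\<Sum>i<length ds. (int ?M)\<^sup>2)"
      by (intro sum_mono) auto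
    finally show ?case
      by (simp add: power2_eq_square algebra_simps)
  next
    case (Suc i)
    have X: "map fst (?X i) = ds"
      by (induction i) (simp_all add: map_fst_adjust o_def)
    show ?case
    proof (cases "balanced ds nt t L U (?X i)")
      case True
      then show ?thesis
        using balanced_adjust[OF True] by simp
    next
      case False
      then show ?thesis
        using adjust_progress[OF X nt t L J few False] Suc by simp
    qed
  qed
  \<comment> \<open>At this index the second alternative would make the potential negative.\<close>
  from this[of "?M * ?M * length ds + 1"] show ?thesis
    unfolding fractional_def using potential_nonneg[of ?M J] by (smt (verit) of_nat_add of_nat_1)
qed

section \<open>Phases with doubling budgets and the ordering they produce\<close>

definition topics_of :: "doc list \<Rightarrow> nat list \<Rightarrow> nat list" where
  "topics_of ds P = concat (map snd (filter (\<lambda>d. fst d \<in> set P) ds))"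

text \<open>The test of the weight makes the bound on the number of documents valid even for budgets
  at which no good solution exists. Filtering the document numbers removes repetitions and bounds
  the size of the result whatever \<open>sc\<close> returns.\<close>

definition phase :: "(nat list \<Rightarrow> nat list) \<Rightarrow> doc list \<Rightarrow> nat \<Rightarrow> nat \<Rightarrow> nat \<Rightarrow> user list \<Rightarrow> nat list" where
  "phase sc ds nt t L U =
     (if weight (fractional ds nt t L U) \<le> 2 * t * scale ds L U
      then filter (\<lambda>s. s \<in> set (sc (heavy nt (scale ds L U) (fractional ds nt t L U)) @
        map fst (greedy ds (512 * t) L U (heavy nt (scale ds L U) (fractional ds nt t L U))))) (map fst ds)
      else [])"

text \<open>The guard keeps the unary number \<open>fst st\<close> polynomial although it doubles.
  Users are removed only if the documents of this phase alone satisfy them.\<close>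

definition phase_step :: "(nat list \<Rightarrow> nat list) \<Rightarrow> doc list \<Rightarrow> nat \<Rightarrow> nat \<Rightarrow>
    nat \<times> nat list \<times> user list \<Rightarrow> nat \<times> nat list \<times> user list" where
  "phase_step sc ds nt L st =
     (if fst st \<le> length ds
      then (2 * fst st, fst (snd st) @ phase sc ds nt (fst st) L (snd (snd st)),
        filter (unsat (topics_of ds (phase sc ds nt (fst st) L (snd (snd st))))) (snd (snd st)))
      else st)"

text \<open>The sum of all demands is a simple bound \<open>L\<close> on each of them. As
  \<open>2 ^ n > n\<close>, \<open>length ds\<close> rounds push the budget past the number of
  documents.\<close>

definition all_phases :: "(nat list \<Rightarrow> nat list) \<Rightarrow> doc list \<Rightarrow> nat \<Rightarrow> user list \<Rightarrow> nat \<times> nat list \<times> user list" where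
  "all_phases sc ds nt us = (phase_step sc ds nt (\<Sum>u\<leftarrow>us. snd u) ^^ length ds) (1, [], us)"

definition schedule :: "(nat list \<Rightarrow> nat list) \<Rightarrow> doc list \<Rightarrow> nat \<Rightarrow> user list \<Rightarrow> nat list" where
  "schedule sc ds nt us = dedup_onto [] (fst (snd (all_phases sc ds nt us)) @ map fst ds)"

section \<open>The algorithm runs in polynomial time\<close>

lemma ptime_outer1: "ptime D f \<Longrightarrow> ptime {p. fst p \<in> D} (\<lambda>p. f (fst p))"
  by (rule ptime_comp) (auto intro: ptime_intros)

lemma ptime_card_Int_Diff [ptime_intros]:
  assumes "ptime D l" "ptime D m" "ptime D k"
  shows "ptime D (\<lambda>x. card (set (l x :: nat list) \<inter> set (m x) - set (k x)))"
proof -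
  have "ptime D (\<lambda>x. card (set (filter (\<lambda>e. e \<in> set (m x)) (l x)) - set (k x)))"
    by (intro ptime_intros assms ptime_outer)
  then show ?thesis
    by (simp add: Int_def)
qed

lemma ptime_unsat [ptime_intros]: "ptime D B \<Longrightarrow> ptime D u \<Longrightarrow> ptime D (\<lambda>x. unsat (B x) (u x))"
  unfolding unsat_def by (intro ptime_intros)

lemma ptime_residual [ptime_intros]: "ptime D H \<Longrightarrow> ptime D u \<Longrightarrow> ptime D (\<lambda>x. residual (H x) (u x))"
  unfolding residual_def by (intro ptime_intros)

lemma ptime_user_gain [ptime_intros]:
  "ptime D L \<Longrightarrow> ptime D H \<Longrightarrow> ptime D B \<Longrightarrow> ptime D C \<Longrightarrow> ptime D u \<Longrightarrow>
    ptime D (\<lambda>x. user_gain (L x) (H x) (B x) (C x) (u x))"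
  unfolding user_gain_def by (intro ptime_intros)

lemma ptime_gain [ptime_intros]:
  "ptime D L \<Longrightarrow> ptime D H \<Longrightarrow> ptime D B \<Longrightarrow> ptime D V \<Longrightarrow> ptime D C \<Longrightarrow>
    ptime D (\<lambda>x. gain (L x) (H x) (B x) (V x) (C x))"
  unfolding gain_def by (intro ptime_intros ptime_outer)

lemma ptime_covered [ptime_intros]: "ptime D Q \<Longrightarrow> ptime D (\<lambda>x. covered (Q x))"
  unfolding covered_def by (intro ptime_intros)

lemma ptime_greedy_step [ptime_intros]:
  "ptime D r \<Longrightarrow> ptime D L \<Longrightarrow> ptime D U \<Longrightarrow> ptime D H \<Longrightarrow> ptime D d \<Longrightarrow> ptime D Q \<Longrightarrow>
    ptime D (\<lambda>x. greedy_step (r x) (L x) (U x) (H x) (d x) (Q x))"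
  unfolding greedy_step_def by (intro ptime_intros ptime_outer)

lemma ptime_outer_fold: "ptime D f \<Longrightarrow> ptime {(x, e, b). x \<in> D \<and> e \<in> set (l x)} (\<lambda>p. f (fst p))"
  by (rule ptime_comp) (auto intro: ptime_intros)

lemma ptime_greedy [ptime_intros]:
  assumes "ptime D ds" "ptime D r" "ptime D L" "ptime D U" "ptime D H"
  shows "ptime D (\<lambda>x. greedy (ds x) (r x) (L x) (U x) (H x))"
  unfolding greedy_def
proof (rule ptime_fold_grow[where h = "\<lambda>x. tsize (ds x)"])
  show "tsize (greedy_step (r x) (L x) (U x) (H x) e b) \<le> tsize b + tsize (ds x)"
    if "e \<in> set (ds x)" for x e b
    using tsize_elem[OF that] by (auto simp: greedy_step_def)
qed (intro ptime_intros ptime_outer_fold assms ptime_size)+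

lemma ptime_left_over [ptime_intros]:
  "ptime D ds \<Longrightarrow> ptime D r \<Longrightarrow> ptime D L \<Longrightarrow> ptime D U \<Longrightarrow> ptime D H \<Longrightarrow>
    ptime D (\<lambda>x. left_over (ds x) (r x) (L x) (U x) (H x))"
  unfolding left_over_def by (intro ptime_intros ptime_outer)

lemma ptime_heavy [ptime_intros]:
  "ptime D nt \<Longrightarrow> ptime D M \<Longrightarrow> ptime D X \<Longrightarrow> ptime D (\<lambda>x. heavy (nt x) (M x) (X x))"
  unfolding heavy_def by (intro ptime_intros ptime_outer)

lemma ptime_weight [ptime_intros]: "ptime D X \<Longrightarrow> ptime D (\<lambda>x. weight (X x))"
  unfolding weight_def by (intro ptime_intros)

lemma ptime_scale [ptime_intros]:
  "ptime D ds \<Longrightarrow> ptime D L \<Longrightarrow> ptime D U \<Longrightarrow> ptime D (\<lambda>x. scale (ds x) (L x) (U x))"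
  unfolding scale_def by (intro ptime_intros)

lemma ptime_adjust [ptime_intros]:
  "ptime D ds \<Longrightarrow> ptime D nt \<Longrightarrow> ptime D t \<Longrightarrow> ptime D L \<Longrightarrow> ptime D U \<Longrightarrow> ptime D X \<Longrightarrow>
    ptime D (\<lambda>x. adjust (ds x) (nt x) (t x) (L x) (U x) (X x))"
  unfolding adjust_def by (intro ptime_intros ptime_outer)

lemma tsize_weights: "tsize X = tsize (map fst X) + length X + weight X" for X :: "(doc \<times> nat) list"
  unfolding weight_def by (induction X) (auto simp: tree_of_prod_def)

text \<open>Weights are unary, so this additive growth per round is what keeps the state of the
  iteration polynomial.\<close>

lemma weight_adjust_le: "weight (adjust ds nt t L U X) \<le> weight X + length X * (L * length U)"
proof -
  define H V where "H = heavy nt (scale ds L U) X" and "V = left_over ds (512 * t) L U H"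
  have "length V \<le> length U"
    by (simp add: V_def left_over_def)
  then have g: "gain L H H V C \<le> L * length U" for C
    using gain_le[of L H H V C] by (meson le_trans mult_le_mono2)
  have "weight (map (\<lambda>p. (fst p, snd p + gain L H H V (snd (fst p)))) Y) \<le> weight Y + length Y * (L * length U)" for Y
    unfolding weight_def
  proof (induction Y)
    case (Cons p Y)
    then show ?case
      using g[of "snd (fst p)"] by simp
  qed simp
  moreover have "weight (map (\<lambda>p. (fst p, snd p - 1)) Y) \<le> weight Y" for Y :: "(doc \<times> nat) list"
    unfolding weight_def by (induction Y) auto
  ultimately show ?thesis
    unfolding adjust_def H_def[symmetric] V_def[symmetric] by (auto intro: trans_le_add1)
qed

lemma ptime_fractional [ptime_intros]:
  assumes "ptime D ds" "ptime D nt" "ptime D t" "ptime D L" "ptime D U"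
  shows "ptime D (\<lambda>x. fractional (ds x) (nt x) (t x) (L x) (U x))"
proof -
  let ?N = "\<lambda>x. scale (ds x) (L x) (U x) * scale (ds x) (L x) (U x) * length (ds x) + 1"
  let ?h = "\<lambda>x. tsize (ds x) + length (ds x) + ?N x * (length (ds x) * (L x * length (U x)))"
  have size: "tsize ((adjust ds nt t L U ^^ i) (map (\<lambda>d. (d, 0)) ds)) \<le>
      tsize ds + length ds + N * (length ds * (L * length U))" if "i \<le> N" for i N ds nt t L U
  proof -
    let ?X = "(adjust ds nt t L U ^^ i) (map (\<lambda>d. (d, 0)) ds)"
    have "map fst ?X = ds \<and> weight ?X \<le> i * (length ds * (L * length U))"
    proof (induction i)
      case 0
      then show ?case by (simp add: weight_def o_def)
    next
      case (Suc i)
      let ?Y = "(adjust ds nt t L U ^^ i) (map (\<lambda>d. (d, 0)) ds)"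
      have "length ?Y = length ds"
        using Suc by (metis length_map)
      then show ?case
        using Suc weight_adjust_le[of ds nt t L U ?Y] by (simp add: map_fst_adjust)
    qed
    then have 1: "map fst ?X = ds" and 2: "weight ?X \<le> i * (length ds * (L * length U))"
      by blast+
    have 3: "length ?X = length ds"
      using 1 by (metis length_map)
    have "i * (length ds * (L * length U)) \<le> N * (length ds * (L * length U))"
      using that by (rule mult_right_mono) simp
    then show ?thesis
      using 2 unfolding tsize_weights[of ?X] 1 3 by linarith
  qed
  show ?thesis
    unfolding fractional_def
  proof (rule ptime_funpow[where h = ?h])
    show "poly_bounded D ?h"
      by (rule ptime_nat_bounded[where f = "\<lambda>x. length (ds x) + ?N x * (length (ds x) * (L x * length (U x)))",
            THEN poly_bounded_add[OF ptime_size[OF assms(1)]], unfolded add.assoc[symmetric]])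
        (intro ptime_intros assms)
  qed (intro ptime_intros assms ptime_outer1 size)+
qed

lemma ptime_topics_of [ptime_intros]:
  "ptime D ds \<Longrightarrow> ptime D P \<Longrightarrow> ptime D (\<lambda>x. topics_of (ds x) (P x))"
  unfolding topics_of_def by (intro ptime_intros ptime_outer)

lemma ptime_phase:
  assumes sc: "\<And>H. ptime D H \<Longrightarrow> ptime D (\<lambda>x. sc x (H x))"
    and "ptime D ds" "ptime D nt" "ptime D t" "ptime D L" "ptime D U"
  shows "ptime D (\<lambda>x. phase (sc x) (ds x) (nt x) (t x) (L x) (U x))"
proof -
  have "ptime D (\<lambda>x. sc x (heavy (nt x) (scale (ds x) (L x) (U x)) (fractional (ds x) (nt x) (t x) (L x) (U x))) @
      map fst (greedy (ds x) (512 * t x) (L x) (U x) (heavy (nt x) (scale (ds x) (L x) (U x))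
        (fractional (ds x) (nt x) (t x) (L x) (U x)))))" (is "ptime D ?f")
    by (intro ptime_intros sc assms)
  from ptime_outer[OF this] show ?thesis
    unfolding phase_def
    by (intro ptime_If' ptime_filter ptime_mem ptime_outer[of D ?f]) (intro ptime_intros assms)+
qed

lemma ptime_phase_step:
  assumes sc: "\<And>H. ptime D H \<Longrightarrow> ptime D (\<lambda>x. sc x (H x))"
    and "ptime D ds" "ptime D nt" "ptime D L" "ptime D st"
  shows "ptime D (\<lambda>x. phase_step (sc x) (ds x) (nt x) (L x) (st x))"
  unfolding phase_step_def
  by (intro ptime_intros ptime_phase[OF sc] ptime_outer assms; assumption)

lemma tsize_filter_le: "tsize (filter P xs) \<le> tsize xs"
  by (induction xs) auto

text \<open>The subroutine enters as a closure property because its argument \<open>H\<close> is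
  computed from the loop state as well as from the input, and it is reliable only for inputs in
  \<open>D\<close>.\<close>

lemma ptime_schedule:
  assumes sc: "\<And>H :: 'a::encodable \<times> nat \<times> nat list \<times> user list \<Rightarrow> nat list.
      ptime {p. fst p \<in> D} H \<Longrightarrow> ptime {p. fst p \<in> D} (\<lambda>p. sc (fst p) (H p))"
    and "ptime D ds" "ptime D nt" "ptime D us"
  shows "ptime D (\<lambda>x. schedule (sc x) (ds x) (nt x) (us x))"
proof -
  let ?h = "\<lambda>x. 2 * length (ds x) + 3 + length (ds x) * tsize (map fst (ds x)) + tsize (us x)"
  have size: "tsize ((phase_step sc ds nt L ^^ i) (1, [], us)) \<le>
      2 * length ds + 3 + N * tsize (map fst ds) + tsize us" if "i \<le> N" for i N sc ds nt L us
  proof -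
    let ?X = "(phase_step sc ds nt L ^^ i) (1, [], us)"
    have "fst ?X \<le> 2 * length ds + 1 \<and> tsize (fst (snd ?X)) \<le> i * tsize (map fst ds) \<and> tsize (snd (snd ?X)) \<le> tsize us"
    proof (induction i)
      case 0
      then show ?case by simp
    next
      case (Suc i)
      obtain t S U where st: "(phase_step sc ds nt L ^^ i) (1, [], us) = (t, S, U)"
        by (metis prod_cases3)
      have "tsize (phase sc ds nt t L U) \<le> tsize (map fst ds)"
        unfolding phase_def using tsize_filter_le[of _ "map fst ds"] by simp
      moreover have "fst (t, S, U) \<le> 2 * length ds + 1" "tsize S \<le> i * tsize (map fst ds)" "tsize U \<le> tsize us"
        using Suc st by auto
      ultimately have "fst (phase_step sc ds nt L (t, S, U)) \<le> 2 * length ds + 1 \<and>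
          tsize (fst (snd (phase_step sc ds nt L (t, S, U)))) \<le> Suc i * tsize (map fst ds) \<and>
          tsize (snd (snd (phase_step sc ds nt L (t, S, U)))) \<le> tsize us"
        by (auto simp: phase_step_def intro: add_mono le_trans[OF tsize_filter_le])
      then show ?case
        using st by simp
    qed
    moreover have "i * tsize (map fst ds) \<le> N * tsize (map fst ds)"
      using that by (rule mult_right_mono) simp
    ultimately have "fst ?X + tsize (fst (snd ?X)) + tsize (snd (snd ?X)) + 2 \<le>
        2 * length ds + 3 + N * tsize (map fst ds) + tsize us"
      by linarith
    then show ?thesis
      by (simp add: tree_of_prod_def)
  qed
  have "ptime D (\<lambda>x. all_phases (sc x) (ds x) (nt x) (us x))"
    unfolding all_phases_def
  proof (rule ptime_funpow[where h = ?h])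
    show "poly_bounded D ?h"
      by (intro poly_bounded_add poly_bounded_mult poly_bounded_const ptime_size ptime_nat_bounded)
        (intro ptime_intros assms)+
    show "ptime {p. fst p \<in> D} (\<lambda>p. phase_step (sc (fst p)) (ds (fst p)) (nt (fst p)) (\<Sum>u\<leftarrow>us (fst p). snd u) (snd p))"
    proof (rule ptime_phase_step[where sc = "\<lambda>p. sc (fst p)"])
      show "ptime {p. fst p \<in> D} (\<lambda>p. sc (fst p) (H p))" if "ptime {p. fst p \<in> D} H"
        for H :: "'a \<times> nat \<times> nat list \<times> user list \<Rightarrow> nat list"
        using sc[OF that] .
    qed (intro ptime_intros ptime_outer1 assms)+
  qed (intro ptime_intros assms size)+
  then show ?thesis
    unfolding schedule_def by (intro ptime_intros assms)
qed

section \<open>The approximation guarantee\<close>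

lemma set_topics_of: "set (topics_of ds P) = (\<Union>d\<in>{d \<in> set ds. fst d \<in> set P}. set (snd d))"
  by (auto simp: topics_of_def)

lemma unsat_cong: "set B = set B' \<Longrightarrow> unsat B u \<longleftrightarrow> unsat B' u"
  by (simp add: unsat_def)

section \<open>Satisfying times of users in list form\<close>

definition user_time :: "doc list \<Rightarrow> nat list \<Rightarrow> user \<Rightarrow> nat" where
  "user_time ds \<sigma> u = (LEAST t. \<not> unsat (topics_of ds (take t \<sigma>)) u)"

lemma user_time_le: "\<not> unsat (topics_of ds (take t \<sigma>)) u \<Longrightarrow> user_time ds \<sigma> u \<le> t"
  unfolding user_time_def by (rule Least_le)

text \<open>The second assumption ensures that the \<open>LEAST\<close> is attained; as coverage is
  monotone in the prefix, an unsatisfying prefix must be shorter.\<close>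

lemma less_user_time:
  assumes "unsat (topics_of ds (take t \<sigma>)) u" and "\<not> unsat (topics_of ds \<sigma>) u"
  shows "t < user_time ds \<sigma> u"
proof (rule ccontr)
  assume "\<not> t < user_time ds \<sigma> u"
  have "\<not> unsat (topics_of ds (take (length \<sigma>) \<sigma>)) u"
    using assms(2) by simp
  then have "\<not> unsat (topics_of ds (take (user_time ds \<sigma> u) \<sigma>)) u"
    unfolding user_time_def by (rule LeastI)
  moreover have "set (topics_of ds (take (user_time ds \<sigma> u) \<sigma>)) \<subseteq> set (topics_of ds (take t \<sigma>))"
    using \<open>\<not> t < user_time ds \<sigma> u\<close> set_take_subset_set_take[of "user_time ds \<sigma> u" t \<sigma>]
    by (auto simp: set_topics_of)
  ultimately show False
    using assms(1) unsat_antimono by blast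
qed

lemma set_phase_subset: "set (phase sc ds nt t L U) \<subseteq> fst ` set ds"
  unfolding phase_def by auto

text \<open>\<open>sc_card\<close> replaces the LP optimum by an arbitrary feasible
  \<open>y\<close>, which is the form in which scaled weights are compared with the cover.\<close>

locale rdc_lists =
  fixes ds :: "doc list" and nt :: nat and us :: "user list" and sc :: "nat list \<Rightarrow> nat list" and \<rho> :: real
  assumes fst_ds: "map fst ds = [0..<length ds]"
    and topics_less: "\<And>d. d \<in> set ds \<Longrightarrow> set (snd d) \<subseteq> {..<nt}"
    and demand: "\<And>u. u \<in> set us \<Longrightarrow> 0 < snd u \<and> \<not> unsat (topics_of ds [0..<length ds]) u"
    and rho: "1 \<le> \<rho>"
    and sc_cover: "\<And>H. set H \<subseteq> {..<nt} \<Longrightarrow> set H \<subseteq> set (topics_of ds (sc H))"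
    and sc_card: "\<And>H y. set H \<subseteq> {..<nt} \<Longrightarrow> (\<And>i. i < length ds \<Longrightarrow> 0 \<le> y i) \<Longrightarrow>
      (\<And>e. e \<in> set H \<Longrightarrow> 1 \<le> (\<Sum>i<length ds. if e \<in> set (snd (ds ! i)) then y i else 0)) \<Longrightarrow>
      real (card (set (sc H))) \<le> \<rho> * (\<Sum>i<length ds. y i)"
begin

lemma fst_nth: "i < length ds \<Longrightarrow> fst (ds ! i) = i"
  using arg_cong[OF fst_ds, of "\<lambda>xs. xs ! i"] by simp

lemma topics_of_nth: "set (topics_of ds P) = (\<Union>i\<in>{i. i < length ds \<and> i \<in> set P}. set (snd (ds ! i)))"
proof -
  have "{d \<in> set ds. fst d \<in> set P} = (\<lambda>i. ds ! i) ` {i. i < length ds \<and> i \<in> set P}"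
    unfolding set_conv_nth[of ds] using fst_nth by auto
  then show ?thesis
    by (simp add: set_topics_of image_image)
qed

lemma demand_le: "u \<in> set us \<Longrightarrow> snd u \<le> (\<Sum>u\<leftarrow>us. snd u)"
  by (rule member_le_sum_list) auto

text \<open>544 = 32 + 512: the scaled weights of the heavy topics sum to at most
  \<open>32 * t\<close>, which costs a factor \<open>\<rho>\<close>, and greedy adds at most
  \<open>512 * t\<close> documents.\<close>

lemma length_phase:
  assumes "0 < t"
  shows "real (length (phase sc ds nt t L U)) \<le> 544 * \<rho> * real t"
proof (cases "weight (fractional ds nt t L U) \<le> 2 * t * scale ds L U")
  case True
  define X where "X = fractional ds nt t L U"
  define M where "M = scale ds L U"
  define H where "H = heavy nt M X"
  define Q where "Q = greedy ds (512 * t) L U H"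
  \<comment> \<open>Heavy topics have coverage at least 1/16, so the factor 16 makes
    \<open>y\<close> feasible for them.\<close>
  define y where "y i = 16 * real (snd (X ! i)) / real M" for i
  have M: "0 < M"
    by (simp add: M_def scale_def)
  have X: "map fst X = ds"
    by (simp add: X_def map_fst_fractional)
  then have n: "length X = length ds" and nth: "\<And>i. i < length ds \<Longrightarrow> fst (X ! i) = ds ! i"
    by auto
  have "real (card (set (sc H))) \<le> \<rho> * (\<Sum>i<length ds. y i)"
  proof (rule sc_card)
    show "set H \<subseteq> {..<nt}"
      by (auto simp: H_def heavy_def)
    fix e assume "e \<in> set H"
    then have "M \<le> 16 * (\<Sum>p\<leftarrow>X. if e \<in> set (snd (fst p)) then snd p else 0)"
      by (simp add: H_def heavy_def)
    also have "(\<Sum>p\<leftarrow>X. if e \<in> set (snd (fst p)) then snd p else 0) =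
        (\<Sum>i<length ds. if e \<in> set (snd (ds ! i)) then snd (X ! i) else 0)"
      unfolding sum_list_nth n using nth by (intro sum.cong) auto
    finally have "real M \<le> real (16 * (\<Sum>i<length ds. if e \<in> set (snd (ds ! i)) then snd (X ! i) else 0))"
      by (simp only: of_nat_le_iff)
    also have "\<dots> = (\<Sum>i<length ds. if e \<in> set (snd (ds ! i)) then y i else 0) * real M"
      using M by (auto simp: y_def sum_distrib_left sum_distrib_right intro!: sum.cong)
    finally show "1 \<le> (\<Sum>i<length ds. if e \<in> set (snd (ds ! i)) then y i else 0)"
      using M by simp
  qed (simp add: y_def)
  also have "(\<Sum>i<length ds. y i) = 16 * real (weight X) / real M"
    by (simp add: y_def weight_def sum_list_nth n sum_distrib_left sum_divide_distrib)
  also have "\<dots> \<le> 32 * real t"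
  proof -
    have "weight X \<le> 2 * t * M"
      using True by (simp add: X_def M_def)
    then have "real (weight X) \<le> real (2 * t * M)"
      by (simp only: of_nat_le_iff)
    then show ?thesis
      using M by (simp add: field_simps)
  qed
  finally have sc: "real (card (set (sc H))) \<le> \<rho> * (32 * real t)"
    using rho by simp
  have phase: "phase sc ds nt t L U = filter (\<lambda>s. s \<in> set (sc H @ map fst Q)) (map fst ds)"
    using True unfolding phase_def X_def[symmetric] M_def[symmetric] H_def[symmetric] Q_def[symmetric] by simp
  have "length (phase sc ds nt t L U) = card (set (phase sc ds nt t L U))"
    by (rule distinct_card[symmetric]) (simp add: phase fst_ds)
  also have "\<dots> \<le> card (set (sc H) \<union> set (map fst Q))"
    by (rule card_mono) (auto simp: phase)
  also have "\<dots> \<le> card (set (sc H)) + length Q"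
    using card_Un_le[of "set (sc H)" "set (map fst Q)"] card_length[of "map fst Q"] by simp
  also have "\<dots> \<le> card (set (sc H)) + 512 * t"
    using length_greedy_le by (simp add: Q_def)
  finally have "real (length (phase sc ds nt t L U)) \<le> real (card (set (sc H))) + 512 * real t"
    by (simp flip: of_nat_add of_nat_mult of_nat_numeral only: of_nat_le_iff)
  also have "\<dots> \<le> \<rho> * (32 * real t) + \<rho> * (512 * real t)"
    using sc mult_right_mono[OF rho, of "512 * real t"] by (intro add_mono) auto
  finally show ?thesis
    by simp
next
  case False
  then show ?thesis
    using rho by (simp add: phase_def)
qed

lemma phase_satisfies:
  assumes t: "0 < t" and U: "set U \<subseteq> set us" and J: "J \<subseteq> {..<length ds}" "card J \<le> t"
    and few: "16 * length (filter (\<lambda>u. card (set (fst u) \<inter> (\<Union>i\<in>J. set (snd (ds ! i)))) < snd u) U) \<le> length U"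
  defines "L \<equiv> \<Sum>u\<leftarrow>us. snd u"
  shows "8 * length (filter (unsat (topics_of ds (phase sc ds nt t L U))) U) \<le> length U"
proof -
  define X where "X = fractional ds nt t L U"
  define M where "M = scale ds L U"
  define H where "H = heavy nt M X"
  define Q where "Q = greedy ds (512 * t) L U H"
  define B where "B = topics_of ds (phase sc ds nt t L U)"
  have "balanced ds nt t L U X"
    unfolding X_def
    by (rule balanced_fractional[OF topics_less t _ J few]) (use U demand_le in \<open>auto simp: L_def\<close>)
  then have w: "weight X \<le> 2 * t * M" and V: "8 * length (filter (unsat (H @ covered Q)) U) \<le> length U"
    unfolding balanced_def left_over_def M_def[symmetric] H_def[symmetric] Q_def[symmetric] by auto
  have phase: "phase sc ds nt t L U = filter (\<lambda>s. s \<in> set (sc H @ map fst Q)) (map fst ds)"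
    using w unfolding phase_def X_def[symmetric] M_def[symmetric] H_def[symmetric] Q_def[symmetric] by simp
  have "set H \<subseteq> set (topics_of ds (sc H))"
    by (rule sc_cover) (auto simp: H_def heavy_def)
  moreover have "set (topics_of ds (sc H)) \<subseteq> set B"
    unfolding B_def phase set_topics_of by auto
  moreover have "set (covered Q) \<subseteq> set B"
    using set_greedy[of ds "512 * t" L U H] unfolding B_def phase set_topics_of covered_def Q_def[symmetric] by auto
  ultimately have sub: "set (H @ covered Q) \<subseteq> set B"
    by auto
  have "length (filter (unsat B) U) \<le> length (filter (unsat (H @ covered Q)) U)"
    using unsat_antimono[OF sub] by (induction U) auto
  then show ?thesis
    using V by (simp add: B_def)
qed

text \<open>If at most a sixteenth of \<open>U\<close> is late, the first \<open>t\<close> documents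
  of \<open>\<sigma>\<close> serve as the solution \<open>J\<close>. Otherwise
  \<open>length U\<close> is less than 16 times the number of late users, and 8 * 16 = 128 pays even
  if nobody is satisfied.\<close>

lemma phase_unsatisfied:
  assumes t: "0 < t" and U: "set U \<subseteq> set us" and \<sigma>: "set \<sigma> = {..<length ds}" "distinct \<sigma>"
  defines "P \<equiv> phase sc ds nt t (\<Sum>u\<leftarrow>us. snd u) U"
  shows "8 * length (filter (unsat (topics_of ds P)) U) \<le>
    length U + 128 * length (filter (\<lambda>u. t < user_time ds \<sigma> u) U)"
proof -
  define J where "J = set (take t \<sigma>)"
  have J: "J \<subseteq> {..<length ds}" "card J \<le> t"
    using \<sigma>(1) set_take_subset[of t \<sigma>] card_length[of "take t \<sigma>"] by (auto simp: J_def)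
  have union: "(\<Union>i\<in>J. set (snd (ds ! i))) = set (topics_of ds (take t \<sigma>))"
    unfolding topics_of_nth J_def[symmetric] using J(1) by auto
  have late: "t < user_time ds \<sigma> u"
    if "u \<in> set U" "card (set (fst u) \<inter> (\<Union>i\<in>J. set (snd (ds ! i)))) < snd u" for u
  proof (rule less_user_time)
    show "unsat (topics_of ds (take t \<sigma>)) u"
      using that(2) by (simp add: unsat_def union)
    have "set (topics_of ds \<sigma>) = set (topics_of ds [0..<length ds])"
      using \<sigma>(1) by (auto simp: topics_of_nth)
    then show "\<not> unsat (topics_of ds \<sigma>) u"
      using demand that(1) U unsat_cong by blast
  qed
  let ?late = "length (filter (\<lambda>u. t < user_time ds \<sigma> u) U)"
  have le: "length (filter (\<lambda>u. card (set (fst u) \<inter> (\<Union>i\<in>J. set (snd (ds ! i)))) < snd u) U) \<le> ?late"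
    using late by (induction U) auto
  show ?thesis
  proof (cases "16 * ?late \<le> length U")
    case True
    then have "8 * length (filter (unsat (topics_of ds P)) U) \<le> length U"
      unfolding P_def by (intro phase_satisfies[OF t U J]) (use le in linarith)
    then show ?thesis by simp
  next
    case False
    then show ?thesis
      using length_filter_le[of "unsat (topics_of ds P)" U] by linarith
  qed
qed

text \<open>During the phases the times in the final ordering are still unknown;
  \<open>\<tau>\<close> stands for them and is constrained only by what the current prefix
  guarantees.\<close>

definition serves :: "(user \<Rightarrow> nat) \<Rightarrow> nat list \<Rightarrow> bool" where
  "serves \<tau> S \<longleftrightarrow> (\<forall>u\<in>set us. \<forall>k\<le>length S. \<not> unsat (topics_of ds (take k S)) u \<longrightarrow> \<tau> u \<le> k)"

lemma serves_appendD: "serves \<tau> (S @ P) \<Longrightarrow> serves \<tau> S"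
  unfolding serves_def by fastforce

lemma serves_append_new:
  assumes "serves \<tau> (S @ P)" and "u \<in> set us" and "\<not> unsat (topics_of ds P) u"
  shows "\<tau> u \<le> length S + length P"
proof -
  have "set (topics_of ds P) \<subseteq> set (topics_of ds (S @ P))"
    by (auto simp: set_topics_of)
  then have "\<not> unsat (topics_of ds (take (length (S @ P)) (S @ P))) u"
    using assms(3) unsat_antimono by (metis order_refl take_all)
  then show ?thesis
    using assms(1,2) unfolding serves_def by (metis length_append order_refl)
qed

text \<open>
  With \<open>c = 544 * \<rho>\<close>, \<open>4 * c * t * length U\<close> pays for the remaining users: a phase doubles \<open>t\<close>, but it
  leaves at most an eighth of the users unless many users are late in the given ordering \<open>\<sigma>\<close>. The
  terms \<open>min t (2 * user_time ds \<sigma> u)\<close> pay for the latter.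
\<close>

definition invariant :: "nat list \<Rightarrow> nat \<times> nat list \<times> user list \<Rightarrow> bool" where
  "invariant \<sigma> = (\<lambda>(t, S, U). 0 < t \<and> set U \<subseteq> set us \<and>
     (\<forall>Q. length (filter Q U) \<le> length (filter Q us)) \<and>
     real (length S) \<le> 544 * \<rho> * (real t - 1) \<and>
     (\<forall>\<tau>. serves \<tau> S \<longrightarrow>
       real (\<Sum>u\<leftarrow>us. \<tau> u) + 4 * (544 * \<rho>) * real t * real (length U) \<le>
       real (\<Sum>u\<leftarrow>U. \<tau> u) + 4 * (544 * \<rho>) * real (length us) +
       96 * (544 * \<rho>) * real (\<Sum>u\<leftarrow>us. min t (2 * user_time ds \<sigma> u))))"

text \<open>The reserve for the remaining users changes from 4 c t |U| to 8 c t |U'|, and each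
  removed user costs at most 2 c t. So 6 c t |U'| must be paid from 2 c t |U| and from the late
  users.\<close>

lemma invariant_phase_step:
  assumes \<sigma>: "set \<sigma> = {..<length ds}" "distinct \<sigma>" and inv: "invariant \<sigma> st"
  shows "invariant \<sigma> (phase_step sc ds nt (\<Sum>u\<leftarrow>us. snd u) st)"
proof (cases "fst st \<le> length ds")
  case True
  obtain t S U where st: "st = (t, S, U)"
    by (cases st)
  define c where "c = 544 * \<rho>"
  define P where "P = phase sc ds nt t (\<Sum>u\<leftarrow>us. snd u) U"
  define U' where "U' = filter (unsat (topics_of ds P)) U"
  define q where "q = length (filter (\<lambda>u. t < user_time ds \<sigma> u) U)"
  define ch where "ch t = real (\<Sum>u\<leftarrow>us. min t (2 * user_time ds \<sigma> u))" for t
  have t: "0 < t" and U: "set U \<subseteq> set us" and sub: "\<And>Q. length (filter Q U) \<le> length (filter Q us)"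
    and S: "real (length S) \<le> c * (real t - 1)"
    and cost: "\<And>\<tau>. serves \<tau> S \<Longrightarrow> real (\<Sum>u\<leftarrow>us. \<tau> u) + 4 * c * real t * real (length U) \<le>
       real (\<Sum>u\<leftarrow>U. \<tau> u) + 4 * c * real (length us) + 96 * c * ch t"
    using inv unfolding invariant_def st c_def ch_def by auto
  have c: "544 \<le> c"
    using rho by (simp add: c_def)
  have phase_step: "phase_step sc ds nt (\<Sum>u\<leftarrow>us. snd u) st = (2 * t, S @ P, U')"
    using True by (simp add: phase_step_def st P_def U'_def)
  have P: "real (length P) \<le> c * real t"
    using length_phase[OF t] by (simp add: P_def c_def)
  have len: "real (length (S @ P)) \<le> c * (real (2 * t) - 1)"
    using S P by (simp add: algebra_simps)
  have sub': "length (filter Q U') \<le> length (filter Q us)" for Q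
  proof -
    have "length (filter Q U') \<le> length (filter Q U)"
      unfolding U'_def by (induction U) auto
    then show ?thesis
      using sub[of Q] by linarith
  qed
  have unsatisfied: "8 * real (length U') \<le> real (length U) + 128 * real q"
  proof -
    have "8 * length U' \<le> length U + 128 * q"
      using phase_unsatisfied[OF t U \<sigma>] by (simp add: P_def U'_def q_def)
    then have "real (8 * length U') \<le> real (length U + 128 * q)"
      by (simp only: of_nat_le_iff)
    then show ?thesis by simp
  qed
  \<comment> \<open>For a user with time above \<open>t\<close> the term rises from \<open>t\<close>
    to \<open>2 * t\<close>; no other term falls.\<close>
  have late: "real t * real q \<le> ch (2 * t) - ch t"
  proof -
    have "q \<le> length (filter (\<lambda>u. t < user_time ds \<sigma> u) us)"
      unfolding q_def by (rule sub)
    then have "t * q \<le> t * length (filter (\<lambda>u. t < user_time ds \<sigma> u) us)"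
      by simp
    also have "\<dots> + (\<Sum>u\<leftarrow>us. min t (2 * user_time ds \<sigma> u)) \<le> (\<Sum>u\<leftarrow>us. min (2 * t) (2 * user_time ds \<sigma> u))"
      by (induction us) auto
    finally have "t * q + (\<Sum>u\<leftarrow>us. min t (2 * user_time ds \<sigma> u)) \<le> (\<Sum>u\<leftarrow>us. min (2 * t) (2 * user_time ds \<sigma> u))"
      by simp
    then have "real (t * q + (\<Sum>u\<leftarrow>us. min t (2 * user_time ds \<sigma> u))) \<le>
        real (\<Sum>u\<leftarrow>us. min (2 * t) (2 * user_time ds \<sigma> u))"
      by (simp only: of_nat_le_iff)
    then show ?thesis
      unfolding ch_def by simp
  qed
  have "real (\<Sum>u\<leftarrow>us. \<tau> u) + 4 * c * real (2 * t) * real (length U') \<le>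
       real (\<Sum>u\<leftarrow>U'. \<tau> u) + 4 * c * real (length us) + 96 * c * ch (2 * t)" if \<tau>: "serves \<tau> (S @ P)" for \<tau>
  proof -
    have "real (\<tau> u) \<le> 2 * c * real t" if "u \<in> set U" "\<not> unsat (topics_of ds P) u" for u
    proof -
      have "\<tau> u \<le> length (S @ P)"
        using serves_append_new[OF \<tau> _ that(2)] that(1) U by auto
      then show ?thesis
        using len c by (simp add: algebra_simps flip: of_nat_le_iff[where 'a = real])
    qed
    then have removed: "real (\<Sum>u\<leftarrow>U. \<tau> u) + 2 * c * real t * real (length U') \<le>
        real (\<Sum>u\<leftarrow>U'. \<tau> u) + 2 * c * real t * real (length U)"
      unfolding U'_def
    proof (induction U)
      case (Cons u U)
      have u: "\<not> unsat (topics_of ds P) u \<Longrightarrow> real (\<tau> u) \<le> 2 * c * real t"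
        using Cons.prems[of u] by simp
      have IH: "real (\<Sum>u\<leftarrow>U. \<tau> u) + 2 * c * real t * real (length (filter (unsat (topics_of ds P)) U)) \<le>
          real (\<Sum>u\<leftarrow>filter (unsat (topics_of ds P)) U. \<tau> u) + 2 * c * real t * real (length U)"
        using Cons by simp
      show ?case
        using u IH by (cases "unsat (topics_of ds P) u") (simp_all add: distrib_left)
    qed simp
    \<comment> \<open>As an atom, \<open>k\<close> keeps the comparison linear. Six eighths of 128
      is 96, the coefficient in the invariant.\<close>
    define k where "k = c * real t"
    have "k * (8 * real (length U')) \<le> k * (real (length U) + 128 * real q)"
      using unsatisfied c by (intro mult_left_mono) (auto simp: k_def)
    then have "8 * (k * real (length U')) \<le> k * real (length U) + 128 * (k * real q)"
      by (simp add: distrib_left)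
    moreover have "0 \<le> k * real (length U)"
      using c by (simp add: k_def)
    ultimately have "6 * (k * real (length U')) \<le> 2 * (k * real (length U)) + 96 * (k * real q)"
      by linarith
    then have "6 * (c * real t) * real (length U') \<le> 2 * (c * real t) * real (length U) + 96 * c * (real t * real q)"
      by (simp add: k_def mult.assoc)
    also have "\<dots> \<le> 2 * (c * real t) * real (length U) + 96 * c * (ch (2 * t) - ch t)"
      using late c by (intro add_left_mono mult_left_mono) auto
    finally have "6 * (c * real t) * real (length U') \<le>
        2 * (c * real t) * real (length U) + 96 * c * ch (2 * t) - 96 * c * ch t"
      by (simp add: right_diff_distrib)
    then show ?thesis
      using cost[OF serves_appendD[OF \<tau>]] removed by (simp add: mult.assoc)
  qed
  then show ?thesis
    unfolding phase_step invariant_def using t U len sub' unfolding c_def ch_def by (auto simp: U'_def)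
next
  case False
  then show ?thesis
    using inv by (simp add: phase_step_def)
qed

lemma invariant_all_phases:
  assumes "set \<sigma> = {..<length ds}" "distinct \<sigma>"
  shows "invariant \<sigma> (all_phases sc ds nt us)" and "length ds < fst (all_phases sc ds nt us)"
proof -
  let ?st = "\<lambda>i. (phase_step sc ds nt (\<Sum>u\<leftarrow>us. snd u) ^^ i) (1, [], us)"
  have "invariant \<sigma> (?st i)" for i
  proof (induction i)
    case 0
    show ?case
      using rho by (simp add: invariant_def)
  next
    case (Suc i)
    then show ?case
      using invariant_phase_step[OF assms] by simp
  qed
  then show "invariant \<sigma> (all_phases sc ds nt us)"
    by (simp add: all_phases_def)
  have "fst (?st i) = 2 ^ i \<or> length ds < fst (?st i)" for i
    by (induction i) (auto simp: phase_step_def)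
  from this[of "length ds"] show "length ds < fst (all_phases sc ds nt us)"
    using less_exp[of "length ds"] unfolding all_phases_def by auto
qed

lemma set_all_phases: "set (fst (snd (all_phases sc ds nt us))) \<subseteq> {..<length ds}"
proof -
  have "set (fst (snd ((phase_step sc ds nt L ^^ i) (1, [], us)))) \<subseteq> set (map fst ds)" for i L
    by (induction i) (use set_phase_subset in \<open>auto simp: phase_step_def\<close>)
  then show ?thesis
    unfolding fst_ds all_phases_def by (simp add: atLeast0LessThan)
qed

lemma schedule_permutation: "distinct (schedule sc ds nt us)" "set (schedule sc ds nt us) = {..<length ds}"
  using set_all_phases by (auto simp: schedule_def distinct_dedup_onto fst_ds simp del: map_eq_conv)

text \<open>Removing repetitions from the first \<open>k\<close> entries leaves a prefix of the
  final ordering with the same topics and at most \<open>k\<close> documents.\<close>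

lemma serves_schedule:
  "serves (user_time ds (schedule sc ds nt us)) (fst (snd (all_phases sc ds nt us)))"
  unfolding serves_def
proof (intro ballI allI impI)
  define S where "S = fst (snd (all_phases sc ds nt us))"
  fix u k
  assume sat: "\<not> unsat (topics_of ds (take k (fst (snd (all_phases sc ds nt us))))) u"
  let ?D = "dedup_onto [] (take k S)"
  have "schedule sc ds nt us = dedup_onto ?D (drop k S @ map fst ds)"
    unfolding schedule_def S_def[symmetric] dedup_onto_append[symmetric]
    by (simp add: append.assoc[symmetric] del: append.assoc)
  then obtain b where "schedule sc ds nt us = ?D @ b"
    using dedup_onto_prefix by metis
  then have "take (length ?D) (schedule sc ds nt us) = ?D"
    by simp
  moreover have "\<not> unsat (topics_of ds ?D) u"
    using sat unsat_cong[of "topics_of ds ?D" "topics_of ds (take k S)"] by (simp add: S_def set_topics_of)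
  ultimately have "user_time ds (schedule sc ds nt us) u \<le> length ?D"
    by (intro user_time_le) simp
  also have "\<dots> \<le> k"
    using length_dedup_onto_le[of "[]" "take k S"] by simp
  finally show "user_time ds (schedule sc ds nt us) u \<le> k" .
qed

text \<open>106624 = 196 * 544 and 196 = 4 + 96 * 2: every user takes at least one step in
  \<open>\<sigma>\<close>, which pays for 4 c per user, and the capped terms sum to at most twice
  the cost of \<open>\<sigma>\<close>.\<close>

lemma schedule_cost:
  assumes \<sigma>: "set \<sigma> = {..<length ds}" "distinct \<sigma>"
  shows "real (\<Sum>u\<leftarrow>us. user_time ds (schedule sc ds nt us) u) \<le>
    106624 * \<rho> * real (\<Sum>u\<leftarrow>us. user_time ds \<sigma> u)"
proof -
  let ?\<tau> = "user_time ds (schedule sc ds nt us)"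
  define opt where "opt = (\<Sum>u\<leftarrow>us. user_time ds \<sigma> u)"
  define c where "c = 544 * \<rho>"
  obtain t S U where st: "all_phases sc ds nt us = (t, S, U)"
    by (metis prod_cases3)
  have c: "1 \<le> c"
    using rho by (simp add: c_def)
  have t: "length ds < t"
    using invariant_all_phases(2)[OF \<sigma>] st by simp
  have U: "set U \<subseteq> set us"
    and cost: "real (\<Sum>u\<leftarrow>us. ?\<tau> u) + 4 * c * real t * real (length U) \<le>
      real (\<Sum>u\<leftarrow>U. ?\<tau> u) + 4 * c * real (length us) + 96 * c * real (\<Sum>u\<leftarrow>us. min t (2 * user_time ds \<sigma> u))"
    using invariant_all_phases(1)[OF \<sigma>] serves_schedule unfolding st invariant_def c_def by auto
  have perm: "length (schedule sc ds nt us) = length ds"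
    using schedule_permutation distinct_card by fastforce
  have "?\<tau> u \<le> t" if "u \<in> set us" for u
  proof -
    have "set (topics_of ds (take (length ds) (schedule sc ds nt us))) = set (topics_of ds [0..<length ds])"
      using schedule_permutation(2) perm by (simp add: set_topics_of atLeast0LessThan)
    then have "?\<tau> u \<le> length ds"
      using demand[OF that] unsat_cong by (intro user_time_le) blast
    then show ?thesis
      using t by simp
  qed
  \<comment> \<open>Users left after the last phase wait for at most all documents, fewer than
    \<open>t\<close>; their reserve on the left of the invariant covers this.\<close>
  then have "(\<Sum>u\<leftarrow>U. ?\<tau> u) \<le> (\<Sum>u\<leftarrow>U. t)"
    using U by (intro sum_list_mono) auto
  then have "real (\<Sum>u\<leftarrow>U. ?\<tau> u) \<le> real (t * length U)"
    by (simp only: of_nat_le_iff sum_list_triv) (simp add: mult.commute)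
  also have "\<dots> \<le> 4 * c * (real t * real (length U))"
    using c mult_right_mono[of 1 "4 * c" "real t * real (length U)"] by simp
  finally have rest: "real (\<Sum>u\<leftarrow>U. ?\<tau> u) \<le> 4 * c * real t * real (length U)"
    by (simp add: mult.assoc)
  have pos: "1 \<le> user_time ds \<sigma> u" if "u \<in> set us" for u
  proof -
    have "0 < user_time ds \<sigma> u"
    proof (rule less_user_time)
      show "unsat (topics_of ds (take 0 \<sigma>)) u"
        using demand[OF that] by (simp add: unsat_def topics_of_def)
      have "set (topics_of ds \<sigma>) = set (topics_of ds [0..<length ds])"
        using \<sigma>(1) by (auto simp: topics_of_nth)
      then show "\<not> unsat (topics_of ds \<sigma>) u"
        using demand[OF that] unsat_cong by blast
    qed
    then show ?thesis by simp
  qed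
  have "(\<Sum>u\<leftarrow>us. 1) \<le> opt"
    unfolding opt_def using pos by (intro sum_list_mono) auto
  then have "real (length us) \<le> real opt"
    by (simp add: sum_list_triv)
  then have "4 * c * real (length us) \<le> 4 * c * real opt"
    using c by simp
  moreover have "(\<Sum>u\<leftarrow>us. min t (2 * user_time ds \<sigma> u)) \<le> 2 * opt"
    unfolding opt_def sum_list_const_mult[symmetric] by (intro sum_list_mono) auto
  then have "real (\<Sum>u\<leftarrow>us. min t (2 * user_time ds \<sigma> u)) \<le> real (2 * opt)"
    by (simp only: of_nat_le_iff)
  then have "96 * c * real (\<Sum>u\<leftarrow>us. min t (2 * user_time ds \<sigma> u)) \<le> 96 * c * real (2 * opt)"
    using c by (intro mult_left_mono) auto
  ultimately have "real (\<Sum>u\<leftarrow>us. ?\<tau> u) \<le> 196 * c * real opt"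
    using cost rest by simp
  then show ?thesis
    by (simp add: c_def opt_def)
qed

end

section \<open>From instances to lists\<close>

type_synonym rdc_input = "bool list list \<times> (bool list \<times> nat) list"

definition bits :: "bool list \<Rightarrow> nat list" where
  "bits bs = map fst (filter (\<lambda>p. snd p) (List.enumerate 0 bs))"

definition doc_list :: "rdc_input \<Rightarrow> doc list" where
  "doc_list x = map (\<lambda>p. (fst p, bits (snd p))) (List.enumerate 0 (fst x))"

definition user_list :: "rdc_input \<Rightarrow> user list" where
  "user_list x = map (\<lambda>u. (bits (fst u), snd u)) (snd x)"

text \<open>All rows have the same length, and the last one decides. Without documents the value 0
  is right, because every topic belongs to some document.\<close>

definition topic_count :: "rdc_input \<Rightarrow> nat" where
  "topic_count x = fold (\<lambda>r a. length r) (fst x) 0"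

definition cover_list :: "(bool list list \<times> bool list \<Rightarrow> bool list) \<Rightarrow> rdc_input \<Rightarrow> nat list \<Rightarrow> nat list" where
  "cover_list g x H = bits (g (fst x, map (\<lambda>i. i \<in> set H) [0..<topic_count x]))"

definition schedule_of :: "(bool list list \<times> bool list \<Rightarrow> bool list) \<Rightarrow> rdc_input \<Rightarrow> nat list" where
  "schedule_of g x = schedule (cover_list g x) (doc_list x) (topic_count x) (user_list x)"

definition bit_vector :: "nat \<Rightarrow> nat set \<Rightarrow> bool list" where
  "bit_vector n A = map (\<lambda>i. i \<in> A) [0..<n]"

definition doc_matrix :: "rdc \<Rightarrow> bool list list" where
  "doc_matrix R = map (\<lambda>s. bit_vector (num_topics R) (doc_topics R s)) [0..<num_docs R]"

definition rdc_input :: "rdc \<Rightarrow> rdc_input" where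
  "rdc_input R = (doc_matrix R,
     map (\<lambda>u. (bit_vector (num_topics R) (interests R u), demand R u)) [0..<num_users R])"

lemma tree_of_bit_vector: "tree_of (bit_vector n A) = enc_set n A"
  by (simp add: bit_vector_def enc_set_def tree_of_list_def tree_of_bool_def o_def)

lemma tree_of_doc_matrix: "tree_of (doc_matrix R) = enc_docs R"
  by (simp add: doc_matrix_def enc_docs_def tree_of_list_def[of "map _ _"] tree_of_bit_vector o_def)

lemma tree_of_rdc_input: "tree_of (rdc_input R) = enc_rdc R"
  by (simp add: rdc_input_def enc_rdc_def tree_of_doc_matrix enc_users_def tree_of_list_def[of "map _ _"]
      tree_of_bit_vector tree_of_nat_def o_def)

lemma tree_of_ordering: "tree_of (\<sigma> :: nat list) = enc_ordering \<sigma>"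
  by (simp add: tree_of_list_def enc_ordering_def tree_of_nat_def)

lemma set_bits: "set (bits bs) = {i. i < length bs \<and> bs ! i}"
proof -
  have "{p \<in> set (List.enumerate 0 bs). snd p} = (\<lambda>i. (i, True)) ` {i. i < length bs \<and> bs ! i}"
    by (auto simp: in_set_enumerate_eq)
  then show ?thesis
    by (simp add: bits_def image_image)
qed

lemma set_bits_bit_vector: "set (bits (bit_vector n A)) = A \<inter> {..<n}"
  by (auto simp: set_bits bit_vector_def)

lemma length_doc_list: "length (doc_list (rdc_input R)) = num_docs R"
  by (simp add: doc_list_def rdc_input_def doc_matrix_def)

lemma doc_list_nth:
  assumes "s < num_docs R"
  shows "doc_list (rdc_input R) ! s = (s, bits (bit_vector (num_topics R) (doc_topics R s)))"
  using assms by (simp add: doc_list_def rdc_input_def doc_matrix_def nth_enumerate_eq)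

lemma doc_list_rdc_input:
  "doc_list (rdc_input R) = map (\<lambda>s. (s, bits (bit_vector (num_topics R) (doc_topics R s)))) [0..<num_docs R]"
  by (rule nth_equalityI) (simp_all add: length_doc_list doc_list_nth)

lemma set_topics_of_doc_list:
  assumes "rdc_instance R"
  shows "set (topics_of (doc_list (rdc_input R)) P) = (\<Union>s\<in>docs R \<inter> set P. doc_topics R s)"
proof -
  let ?f = "\<lambda>s. (s, bits (bit_vector (num_topics R) (doc_topics R s)))"
  have "{d \<in> set (doc_list (rdc_input R)). fst d \<in> set P} = ?f ` (docs R \<inter> set P)"
    by (auto simp: doc_list_rdc_input)
  moreover have "doc_topics R s \<subseteq> topics R" if "s \<in> docs R" for s
    using assms that by (auto simp: rdc_instance_def)
  ultimately show ?thesis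
    by (simp add: set_topics_of set_bits_bit_vector Int_absorb2)
qed

lemma topic_count_rdc_input:
  assumes "rdc_instance R" shows "topic_count (rdc_input R) = num_topics R"
proof (cases "num_docs R")
  case 0
  then have "topics R = {}"
    using assms by (auto simp: rdc_instance_def)
  then have "num_topics R = 0"
    by (metis lessThan_0 lessThan_eq_iff)
  then show ?thesis
    using 0 by (simp add: topic_count_def rdc_input_def doc_matrix_def)
next
  case (Suc n)
  then show ?thesis
    by (simp add: topic_count_def rdc_input_def doc_matrix_def bit_vector_def)
qed

section \<open>The conversions run in polynomial time\<close>

lemma ptime_bits [ptime_intros]: "ptime D b \<Longrightarrow> ptime D (\<lambda>x. bits (b x))"
  unfolding bits_def by (intro ptime_intros)

lemma ptime_doc_list [ptime_intros]: "ptime D x \<Longrightarrow> ptime D (\<lambda>z. doc_list (x z))"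
  unfolding doc_list_def by (intro ptime_intros)

lemma ptime_user_list [ptime_intros]: "ptime D x \<Longrightarrow> ptime D (\<lambda>z. user_list (x z))"
  unfolding user_list_def by (intro ptime_intros)

lemma ptime_topic_count [ptime_intros]:
  assumes "ptime D x" shows "ptime D (\<lambda>z. topic_count (x z))"
  unfolding topic_count_def
proof (rule ptime_fold_grow[where h = "\<lambda>z. tsize (fst (x z))"])
  show "tsize (length e) \<le> tsize b + tsize (fst (x z))" if "e \<in> set (fst (x z))" for z e and b :: nat
    using tsize_elem[OF that] length_le_tsize[of e] by simp
qed (intro ptime_intros assms ptime_size)+

lemma ptime_cover_list:
  assumes g: "ptime E g" and x: "ptime D x" and H: "ptime D H"
    and E: "\<And>z. z \<in> D \<Longrightarrow> (fst (x z), map (\<lambda>i. i \<in> set (H z)) [0..<topic_count (x z)]) \<in> E"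
  shows "ptime D (\<lambda>z. cover_list g (x z) (H z))"
  unfolding cover_list_def
proof (intro ptime_bits ptime_comp[OF g])
  show "ptime D (\<lambda>z. (fst (x z), map (\<lambda>i. i \<in> set (H z)) [0..<topic_count (x z)]))"
    by (intro ptime_intros x H ptime_outer)
qed (use E in auto)

section \<open>The set cover algorithm as a subroutine\<close>

text \<open>A run is chosen for each encoded input, not for each instance: instances differing only
  in their users share the input of \<open>A\<close>, and the same output meets the bound of each of
  them.\<close>

lemma set_cover_function:
  assumes A: "sc_lp_algorithm \<rho> \<I> A"
  obtains g where "ptime {(doc_matrix R, bit_vector (num_topics R) F) | R F. R \<in> \<I> \<and> F \<subseteq> topics R} g"
    and "\<And>R F. R \<in> \<I> \<Longrightarrow> F \<subseteq> topics R \<Longrightarrow>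
      \<exists>H. g (doc_matrix R, bit_vector (num_topics R) F) = bit_vector (num_docs R) H \<and> set_cover R F H \<and>
        real (card H) \<le> \<rho> R * lp_opt R F"
proof -
  let ?D = "{(doc_matrix R, bit_vector (num_topics R) F) | R F. R \<in> \<I> \<and> F \<subseteq> topics R}"
  have enc: "tree_of (doc_matrix R, bit_vector (num_topics R) F) = enc_sc R F" for R F
    by (simp add: tree_of_doc_matrix tree_of_bit_vector enc_sc_def)
  have poly: "poly_time A {enc_sc R F | R F. R \<in> \<I> \<and> F \<subseteq> topics R}"
    and cover: "\<And>R F y. R \<in> \<I> \<Longrightarrow> F \<subseteq> topics R \<Longrightarrow> y \<in> set_pmf (out_dist A (enc_sc R F)) \<Longrightarrow>
      \<exists>H. y = enc_set (num_docs R) H \<and> set_cover R F H \<and> real (card H) \<le> \<rho> R * lp_opt R F"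
    using A by (simp_all add: sc_lp_algorithm_def)
  from poly obtain p where p0: "\<forall>x\<in>{enc_sc R F | R F. R \<in> \<I> \<and> F \<subseteq> topics R}. halts_within A x (poly p (size x))"
    unfolding poly_time_def by (rule exE)
  have p: "halts_within A (enc_sc R F) (poly p (size (enc_sc R F)))" if "R \<in> \<I>" "F \<subseteq> topics R" for R F
    using that by (intro bspec[OF p0]) blast
  have "\<forall>z\<in>?D. \<exists>st. runs A ((\<lambda>v. Leaf)(0 := tree_of z)) (poly p (tsize z)) st \<and>
      st 0 \<in> set_pmf (out_dist A (tree_of z))"
  proof
    fix z assume "z \<in> ?D"
    then obtain R F where z: "R \<in> \<I>" "F \<subseteq> topics R" "z = (doc_matrix R, bit_vector (num_topics R) F)"
      by blast
    show "\<exists>st. runs A ((\<lambda>v. Leaf)(0 := tree_of z)) (poly p (tsize z)) st \<and>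
        st 0 \<in> set_pmf (out_dist A (tree_of z))"
      unfolding z(3) enc by (rule runs_of_halts_within[OF p[OF z(1,2)]])
  qed
  from bchoice[OF this] obtain st where st: "\<And>z. z \<in> ?D \<Longrightarrow> runs A ((\<lambda>v. Leaf)(0 := tree_of z)) (poly p (tsize z)) (st z)"
      "\<And>z. z \<in> ?D \<Longrightarrow> st z 0 \<in> set_pmf (out_dist A (tree_of z))"
    by blast
  \<comment> \<open>Decoding is sound on the domain because \<open>tree_of\<close> is injective on
    bit lists.\<close>
  define g :: "bool list list \<times> bool list \<Rightarrow> bool list" where "g z = inv tree_of (st z 0)" for z
  have spec: "\<exists>H. st z 0 = tree_of (bit_vector (num_docs R) H) \<and> g z = bit_vector (num_docs R) H \<and>
      set_cover R F H \<and> real (card H) \<le> \<rho> R * lp_opt R F"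
    if z: "R \<in> \<I>" "F \<subseteq> topics R" "z = (doc_matrix R, bit_vector (num_topics R) F)" for R F z
  proof -
    have "z \<in> ?D"
      using z by blast
    from st(2)[OF this] have "st z 0 \<in> set_pmf (out_dist A (enc_sc R F))"
      unfolding z(3) enc .
    then obtain H where H: "st z 0 = enc_set (num_docs R) H" "set_cover R F H"
        "real (card H) \<le> \<rho> R * lp_opt R F"
      using cover[OF z(1,2)] by blast
    have tree: "st z 0 = tree_of (bit_vector (num_docs R) H)"
      by (simp only: H(1) tree_of_bit_vector)
    then have "g z = bit_vector (num_docs R) H"
      by (simp only: g_def inv_f_f[OF inj_tree_of_bool_list])
    then show ?thesis
      using tree H(2,3) by blast
  qed
  have tree_g: "st z 0 = tree_of (g z)" if "z \<in> ?D" for z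
  proof -
    obtain R F where z: "R \<in> \<I>" "F \<subseteq> topics R" "z = (doc_matrix R, bit_vector (num_topics R) F)"
      using \<open>z \<in> ?D\<close> by blast
    show ?thesis
      using spec[OF z] by auto
  qed
  obtain j where "com_below j A"
    using com_below_ex by blast
  then obtain k where k: "com_below k A" and k0: "0 < k"
    using com_below_mono[of j A "Suc j"] by auto
  have "computes (Seq (clear k) A) (Suc k) ?D (\<lambda>z. 2 * k + 1 + poly p (tsize z) + 1) g"
    unfolding computes_def
  proof (intro ballI allI impI)
    fix z and s0 :: store
    assume z: "z \<in> ?D" "s0 0 = tree_of z"
    let ?s1 = "\<lambda>v. if 0 < v \<and> v \<le> k then Leaf else s0 v"
    \<comment> \<open>After clearing, the caller's store looks like the initial store to
      \<open>A\<close>.\<close>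
    have "((\<lambda>v. Leaf)(0 := tree_of z)) v = ?s1 v" if "v < k" for v
      using that z(2) by auto
    from runs_local[OF k this st(1)[OF z(1)]] obtain s2 where
      s2: "runs A ?s1 (poly p (tsize z)) s2" "\<forall>v<k. s2 v = st z v" "\<forall>v\<ge>k. s2 v = ?s1 v"
      by blast
    have "s2 0 = tree_of (g z)"
      using s2(2) k0 tree_g[OF z(1)] by simp
    moreover have "\<forall>v\<ge>Suc k. s2 v = s0 v"
      using s2(3) by auto
    ultimately show "\<exists>st'. runs (Seq (clear k) A) s0 (2 * k + 1 + poly p (tsize z) + 1) st' \<and>
        st' 0 = tree_of (g z) \<and> (\<forall>v\<ge>Suc k. st' v = s0 v)"
      using runs_Seq[OF runs_clear s2(1)] by blast
  qed
  moreover have "poly_bounded ?D (\<lambda>z. 2 * k + 1 + poly p (tsize z) + 1)"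
    by (intro poly_bounded_add poly_bounded_const) (auto simp: poly_bounded_def)
  moreover have "poly_bounded ?D (\<lambda>z. tsize (g z))"
  proof (rule poly_bounded_mono[OF poly_bounded_mult[OF poly_bounded_const poly_bounded_tsize]])
    fix z assume "z \<in> ?D"
    then obtain R F where z: "R \<in> \<I>" "F \<subseteq> topics R" "z = (doc_matrix R, bit_vector (num_topics R) F)"
      by blast
    obtain H where "g z = bit_vector (num_docs R) H"
      using spec[OF z] by blast
    moreover have "tsize (bit_vector n H) \<le> 2 * n" for n
    proof -
      have "tsize (bit_vector n H) \<le> (\<Sum>i\<leftarrow>[0..<n]. 2)"
        unfolding tsize_list bit_vector_def map_map o_def
        by (intro sum_list_mono) (use tsize_bool_le in fastforce)
      then show ?thesis by (simp add: sum_list_triv)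
    qed
    moreover have "num_docs R \<le> tsize z"
      using length_le_tsize[of "doc_matrix R"] z(3) by (simp add: doc_matrix_def)
    ultimately show "tsize (g z) \<le> 2 * tsize z"
      by (metis le_trans mult_le_mono2)
  qed
  ultimately have "ptime ?D g"
    unfolding ptime_def by blast
  then show ?thesis
    by (rule that) (use spec in blast)
qed


section \<open>Guarantees for instances\<close>

lemma lp_opt_le:
  assumes "lp_feasible R F x" shows "lp_opt R F \<le> (\<Sum>s\<in>docs R. x s)"
  unfolding lp_opt_def
proof (rule cINF_lower)
  show "bdd_below ((\<lambda>x. \<Sum>s\<in>docs R. x s) ` {x. lp_feasible R F x})"
    by (rule bdd_belowI[of _ 0]) (auto simp: lp_feasible_def intro!: sum_nonneg)
qed (use assms in simp)

lemma rdc_lists_instance: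
  assumes R: "rdc_instance R" and \<rho>: "1 \<le> \<rho>"
    and g: "\<And>F. F \<subseteq> topics R \<Longrightarrow> \<exists>H. g (doc_matrix R, bit_vector (num_topics R) F) = bit_vector (num_docs R) H \<and>
      set_cover R F H \<and> real (card H) \<le> \<rho> * lp_opt R F"
  shows "rdc_lists (doc_list (rdc_input R)) (num_topics R) (user_list (rdc_input R)) (cover_list g (rdc_input R)) \<rho>"
proof
  let ?ds = "doc_list (rdc_input R)" and ?nt = "num_topics R" and ?sc = "cover_list g (rdc_input R)"
  have C: "doc_topics R s \<subseteq> {..<?nt}" if "s < num_docs R" for s
    using R that by (auto simp: rdc_instance_def)
  have ds: "?ds ! s = (s, bits (bit_vector ?nt (doc_topics R s)))" "set (snd (?ds ! s)) = doc_topics R s"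
    if "s < num_docs R" for s
    using doc_list_nth[OF that] C[OF that] by (auto simp: set_bits_bit_vector)
  show "map fst ?ds = [0..<length ?ds]"
    by (rule nth_equalityI) (auto simp: length_doc_list ds)
  show "set (snd d) \<subseteq> {..<?nt}" if d: "d \<in> set ?ds" for d
  proof -
    obtain s where "s < num_docs R" "d = ?ds ! s"
      using d by (auto simp: in_set_conv_nth length_doc_list)
    then show ?thesis
      using C ds(2) by simp
  qed
  show "0 < snd u \<and> \<not> unsat (topics_of ?ds [0..<length ?ds]) u" if "u \<in> set (user_list (rdc_input R))" for u
  proof -
    from that obtain v where v: "v < num_users R" "u = (bits (bit_vector ?nt (interests R v)), demand R v)"
      by (auto simp: user_list_def rdc_input_def)
    have I: "interests R v \<subseteq> {..<?nt}" "0 < demand R v" "demand R v \<le> card (interests R v)"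
      using R v(1) by (auto simp: rdc_instance_def)
    have "set (topics_of ?ds [0..<length ?ds]) = {..<?nt}"
      using R by (simp add: set_topics_of_doc_list[OF R] length_doc_list atLeast0LessThan rdc_instance_def)
    then show ?thesis
      using I by (simp add: v(2) unsat_def set_bits_bit_vector Int_absorb2)
  qed
  have sc: "\<exists>H'. set (?sc H) = H' \<and> set_cover R (set H) H' \<and> real (card H') \<le> \<rho> * lp_opt R (set H)"
    if H: "set H \<subseteq> {..<?nt}" for H
  proof -
    have "?sc H = bits (g (doc_matrix R, bit_vector ?nt (set H)))"
      by (simp add: cover_list_def topic_count_rdc_input[OF R]) (simp add: rdc_input_def bit_vector_def)
    moreover obtain H' where H': "g (doc_matrix R, bit_vector ?nt (set H)) = bit_vector (num_docs R) H'"
        "set_cover R (set H) H'" "real (card H') \<le> \<rho> * lp_opt R (set H)"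
      using g[OF H] by blast
    moreover have "H' \<subseteq> docs R"
      using H'(2) by (simp add: set_cover_def)
    ultimately have "set (?sc H) = H'"
      by (simp add: set_bits_bit_vector Int_absorb2)
    then show ?thesis
      using H' by blast
  qed
  show "set H \<subseteq> set (topics_of ?ds (?sc H))" if H: "set H \<subseteq> {..<?nt}" for H
  proof -
    obtain H' where "set (?sc H) = H'" "set_cover R (set H) H'"
      using sc[OF H] by blast
    then show ?thesis
      unfolding set_topics_of_doc_list[OF R] set_cover_def by blast
  qed
  show "real (card (set (?sc H))) \<le> \<rho> * (\<Sum>i<length ?ds. y i)"
    if H: "set H \<subseteq> {..<?nt}" and pos: "\<And>i. i < length ?ds \<Longrightarrow> 0 \<le> y i"
      and cover: "\<And>e. e \<in> set H \<Longrightarrow> 1 \<le> (\<Sum>i<length ?ds. if e \<in> set (snd (?ds ! i)) then y i else 0)" for H y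
  proof -
    have "lp_feasible R (set H) y"
      unfolding lp_feasible_def
    proof (intro conjI ballI)
      fix e assume "e \<in> set H"
      have "(\<Sum>i<length ?ds. if e \<in> set (snd (?ds ! i)) then y i else 0) =
          (\<Sum>i<num_docs R. if e \<in> doc_topics R i then y i else 0)"
        unfolding length_doc_list by (intro sum.cong) (auto simp: ds(2))
      also have "\<dots> = (\<Sum>s | s \<in> docs R \<and> e \<in> doc_topics R s. y s)"
        by (rule sum.inter_filter[symmetric]) simp
      finally show "1 \<le> (\<Sum>s | s \<in> docs R \<and> e \<in> doc_topics R s. y s)"
        using cover[OF \<open>e \<in> set H\<close>] by simp
    qed (use pos in \<open>simp add: length_doc_list\<close>)
    then have "lp_opt R (set H) \<le> (\<Sum>i<length ?ds. y i)"
      using lp_opt_le by (simp add: length_doc_list)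
    then have "\<rho> * lp_opt R (set H) \<le> \<rho> * (\<Sum>i<length ?ds. y i)"
      using \<rho> by (intro mult_left_mono) auto
    then show ?thesis
      using sc[OF H] by auto
  qed
qed (rule \<rho>)

lemma sat_time_eq_user_time:
  assumes R: "rdc_instance R" and u: "u < num_users R" and \<sigma>: "set \<sigma> \<subseteq> docs R"
  shows "sat_time R \<sigma> u = user_time (doc_list (rdc_input R)) \<sigma> (bits (bit_vector (num_topics R) (interests R u)), demand R u)"
proof -
  let ?ds = "doc_list (rdc_input R)"
  have I: "interests R u \<subseteq> {..<num_topics R}"
    using R u by (auto simp: rdc_instance_def)
  have "set (take t \<sigma>) \<subseteq> docs R" for t
    using \<sigma> set_take_subset by fast
  then have "set (topics_of ?ds (take t \<sigma>)) = (\<Union>s\<in>set (take t \<sigma>). doc_topics R s)" for t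
    unfolding set_topics_of_doc_list[OF R] by (simp add: Int_absorb1)
  then show ?thesis
    unfolding sat_time_def user_time_def unsat_def
    using I by (simp add: set_bits_bit_vector Int_absorb2 not_less)
qed

lemma total_time_eq:
  assumes R: "rdc_instance R" and \<sigma>: "set \<sigma> \<subseteq> docs R"
  shows "total_time R \<sigma> = (\<Sum>u\<leftarrow>user_list (rdc_input R). user_time (doc_list (rdc_input R)) \<sigma> u)"
proof -
  have "(\<Sum>u\<leftarrow>user_list (rdc_input R). user_time (doc_list (rdc_input R)) \<sigma> u) =
      (\<Sum>u<num_users R. user_time (doc_list (rdc_input R)) \<sigma> (bits (bit_vector (num_topics R) (interests R u)), demand R u))"
    by (simp add: user_list_def rdc_input_def o_def sum_list_distinct_conv_sum_set atLeast0LessThan)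
  then show ?thesis
    unfolding total_time_def using sat_time_eq_user_time[OF R _ \<sigma>] by simp
qed

text \<open>\<open>computes\<close> refers to runs under \<open>dstep\<close>; \<open>derand\<close>
  carries them over to \<open>step\<close>, where the output distribution is a point mass.\<close>

lemma approx_algorithm_of_ptime:
  assumes "ptime (rdc_input ` \<I>) f"
    and f: "\<And>R. R \<in> \<I> \<Longrightarrow> f (rdc_input R) \<in> orderings R"
    and cost: "\<And>R. R \<in> \<I> \<Longrightarrow> real (total_time R (f (rdc_input R))) \<le> \<alpha> R * real (opt_time R)"
  shows "\<exists>B. rdc_approx_algorithm \<alpha> \<I> B"
proof -
  from assms(1) obtain P k T where T: "poly_bounded (rdc_input ` \<I>) T" and P: "computes P k (rdc_input ` \<I>) T f"
    unfolding ptime_def by blast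
  obtain p where p: "\<And>R. R \<in> \<I> \<Longrightarrow> T (rdc_input R) \<le> poly p (size (enc_rdc R))"
    using T unfolding poly_bounded_def by (auto simp: tree_of_rdc_input)
  have run: "\<exists>st. runs P ((\<lambda>v. Leaf)(0 := enc_rdc R)) (poly p (size (enc_rdc R))) st \<and> st 0 = enc_ordering (f (rdc_input R))"
    if R: "R \<in> \<I>" for R
  proof -
    have "((\<lambda>v. Leaf)(0 := enc_rdc R)) 0 = tree_of (rdc_input R)"
      by (simp add: tree_of_rdc_input)
    then obtain st where "runs P ((\<lambda>v. Leaf)(0 := enc_rdc R)) (T (rdc_input R)) st"
        "st 0 = tree_of (f (rdc_input R))"
      using P R unfolding computes_def by blast
    then show ?thesis
      using runs_mono[OF _ p[OF R]] by (auto simp: tree_of_ordering)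
  qed
  have "poly_time (derand P) (enc_rdc ` \<I>)"
    unfolding poly_time_def using run halts_within_derand(1) by blast
  moreover have "\<exists>\<mu>. out_dist (derand P) (enc_rdc R) = map_pmf enc_ordering \<mu> \<and> set_pmf \<mu> \<subseteq> orderings R \<and>
      measure_pmf.expectation \<mu> (\<lambda>\<sigma>. real (total_time R \<sigma>)) \<le> \<alpha> R * real (opt_time R)" if "R \<in> \<I>" for R
  proof (intro exI conjI)
    show "out_dist (derand P) (enc_rdc R) = map_pmf enc_ordering (return_pmf (f (rdc_input R)))"
      using run[OF that] halts_within_derand(2) by fastforce
  qed (use f[OF that] cost[OF that] in simp_all)
  ultimately show ?thesis
    unfolding rdc_approx_algorithm_def by blast
qed

lemma rdc_approximation:
  assumes \<I>: "\<And>R. R \<in> \<I> \<Longrightarrow> rdc_instance R \<and> 1 \<le> \<rho> R" and A: "sc_lp_algorithm \<rho> \<I> A"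
  shows "\<exists>B. rdc_approx_algorithm (\<lambda>R. 106624 * \<rho> R) \<I> B"
proof -
  obtain g where g: "ptime {(doc_matrix R, bit_vector (num_topics R) F) | R F. R \<in> \<I> \<and> F \<subseteq> topics R} g"
    and spec: "\<And>R F. R \<in> \<I> \<Longrightarrow> F \<subseteq> topics R \<Longrightarrow>
      \<exists>H. g (doc_matrix R, bit_vector (num_topics R) F) = bit_vector (num_docs R) H \<and> set_cover R F H \<and>
        real (card H) \<le> \<rho> R * lp_opt R F"
    using set_cover_function[OF A] by blast
  have lists: "rdc_lists (doc_list (rdc_input R)) (num_topics R) (user_list (rdc_input R))
      (cover_list g (rdc_input R)) (\<rho> R)" if "R \<in> \<I>" for R
    using rdc_lists_instance \<I>[OF that] spec[OF that] by blast
  have schedule: "schedule_of g (rdc_input R) = schedule (cover_list g (rdc_input R)) (doc_list (rdc_input R))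
      (num_topics R) (user_list (rdc_input R))" if "R \<in> \<I>" for R
    using \<I>[OF that] by (simp add: schedule_of_def topic_count_rdc_input)
  have "ptime (rdc_input ` \<I>) (schedule_of g)"
    unfolding schedule_of_def
  proof (rule ptime_schedule)
    let ?D = "{p. fst p \<in> rdc_input ` \<I>}"
    fix H :: "rdc_input \<times> nat \<times> nat list \<times> user list \<Rightarrow> nat list"
    assume H: "ptime ?D H"
    have dom: "(fst (fst p), map (\<lambda>i. i \<in> set (H p)) [0..<topic_count (fst p)]) \<in>
        {(doc_matrix R, bit_vector (num_topics R) F) | R F. R \<in> \<I> \<and> F \<subseteq> topics R}" if p: "p \<in> ?D" for p
    proof -
      obtain R where R: "R \<in> \<I>" "fst p = rdc_input R"
        using p by blast
      \<comment> \<open>\<open>H p\<close> may list arbitrary numbers, but the bit vector cuts it to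
        the topics, so every query stays in the domain of \<open>g\<close>.\<close>
      then have "(fst (fst p), map (\<lambda>i. i \<in> set (H p)) [0..<topic_count (fst p)]) =
          (doc_matrix R, bit_vector (num_topics R) (set (H p) \<inter> topics R))"
        using \<I> by (simp add: topic_count_rdc_input bit_vector_def) (simp add: rdc_input_def)
      then show ?thesis
        using R(1) by blast
    qed
    show "ptime ?D (\<lambda>p. cover_list g (fst p) (H p))"
      by (rule ptime_cover_list[OF g ptime_fst[OF ptime_id] H dom])
  qed (intro ptime_intros)+
  then show ?thesis
  proof (rule approx_algorithm_of_ptime)
    fix R assume R: "R \<in> \<I>"
    interpret rdc_lists "doc_list (rdc_input R)" "num_topics R" "user_list (rdc_input R)"
      "cover_list g (rdc_input R)" "\<rho> R"
      using lists[OF R] .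
    show perm: "schedule_of g (rdc_input R) \<in> orderings R"
      using schedule_permutation by (simp add: schedule[OF R] permutations_of_set_def length_doc_list)
    have "finite (orderings R)" "orderings R \<noteq> {}"
      by simp_all
    then have "opt_time R \<in> total_time R ` orderings R"
      unfolding opt_time_def by (intro Min_in) auto
    then obtain \<sigma> where \<sigma>: "\<sigma> \<in> orderings R" "opt_time R = total_time R \<sigma>"
      by blast
    have set: "set \<sigma> = docs R" "distinct \<sigma>" "set (schedule_of g (rdc_input R)) = docs R"
      using \<sigma>(1) perm by (auto simp: permutations_of_set_def)
    have inst: "rdc_instance R"
      using \<I>[OF R] by simp
    show "real (total_time R (schedule_of g (rdc_input R))) \<le> 106624 * \<rho> R * real (opt_time R)"
      using schedule_cost[of \<sigma>] set by (simp add: \<sigma>(2) total_time_eq[OF inst] schedule[OF R] length_doc_list)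
  qed
qed

theorem theorem3:
  shows "\<exists>c::real. c > 0 \<and>
    (\<forall>(\<I> :: rdc set) (\<rho> :: rdc \<Rightarrow> real).
       (\<forall>R\<in>\<I>. rdc_instance R \<and> \<rho> R \<ge> 1) \<longrightarrow>
       (\<exists>A. sc_lp_algorithm \<rho> \<I> A) \<longrightarrow>
       (\<exists>B. rdc_approx_algorithm (\<lambda>R. c * \<rho> R) \<I> B))"
  using rdc_approximation by (intro exI[of _ 106624]) auto

end
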